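(* Let $p\in \mathscr H_{4}$ be real-valued and let $\alpha_1<\alpha_2<\dots$ be the eigenvalues of the operator $hy=-y''-py$ on $L^2(0,1)$ with boundary conditions $y(0)=y(1)=0$. Put $p_0=\int_0^1p(t)\,dt$ and $P=\int_0^1(p''(t)+p^2(t))\,dt$. Then $$\sum_{n\ge1}\Big(\alpha_{n}^2-\big((\pi n)^2-p_0\big)^2-\frac{P-p_0^2}{2}\Big)=\frac{P+p_0^2}{4}-\frac{p^2(0)+p^2(1)}{4}-\frac{p''(0)+p''(1)}{8},$$ where the series converges absolutely and uniformly on any bounded subset of $\mathscr H_4$.
   Context: For $m\ge 0$, $\mathscr H_m=\{f\in L^1(0,1): f^{(m)}\in L^1(0,1)\}$ (with its natural Sobolev norm, built from $L^1$ norms). All eigenvalues of $h$ are real and simple. *)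

theory Defs
  imports "HOL-Analysis.Analysis"
begin

abbreviation unit_measure :: "real measure" where
  "unit_measure \<equiv> lebesgue_on {0<..<1}"

text \<open>
  Elements of the Lebesgue and Sobolev spaces over the interval (0,1) are represented by functions
  on the reals; only their values almost everywhere in (0,1) matter.
\<close>

definition test_function :: "(real \<Rightarrow> real) \<Rightarrow> bool" where
  "test_function \<phi> \<longleftrightarrow>
     (\<forall>k x. (deriv ^^ k) \<phi> field_differentiable at x) \<and>
     closure {x. \<phi> x \<noteq> 0} \<subseteq> {0<..<1}"

definition has_weak_deriv ::
    "nat \<Rightarrow> (real \<Rightarrow> 'a::{banach, second_countable_topology}) \<Rightarrow> (real \<Rightarrow> 'a) \<Rightarrow> bool" where
  "has_weak_deriv m f g \<longleftrightarrow>
     integrable unit_measure f \<and> integrable unit_measure g \<and>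
     (\<forall>\<phi>. test_function \<phi> \<longrightarrow>
        (\<integral>x. (deriv ^^ m) \<phi> x *\<^sub>R f x \<partial>unit_measure) =
        (-1) ^ m *\<^sub>R (\<integral>x. \<phi> x *\<^sub>R g x \<partial>unit_measure))"

definition sobolev :: "nat \<Rightarrow> (real \<Rightarrow> 'a::{banach, second_countable_topology}) set" where
  "sobolev m = {f. \<exists>g. has_weak_deriv m f g}"

text \<open>The choice below is unique up to a null set; nothing that follows depends on it.\<close>

definition weak_deriv ::
    "nat \<Rightarrow> (real \<Rightarrow> 'a::{banach, second_countable_topology}) \<Rightarrow> real \<Rightarrow> 'a" where
  "weak_deriv m f = (SOME g. has_weak_deriv m f g)"

definition sobolev_norm :: "nat \<Rightarrow> (real \<Rightarrow> 'a::{banach, second_countable_topology}) \<Rightarrow> real" where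
  "sobolev_norm m f = (\<Sum>j\<le>m. \<integral>x. norm (weak_deriv j f x) \<partial>unit_measure)"

text \<open>
  Point values, in particular the values at the endpoints 0 and 1, are those of the continuous
  representative on [0,1], which is unique there when it exists.  For m > 0 it exists for every element of
  the Sobolev space of order m and for its derivatives of order less than m.
\<close>

definition cont_rep :: "(real \<Rightarrow> 'a::topological_space) \<Rightarrow> real \<Rightarrow> 'a" where
  "cont_rep f = (SOME g. continuous_on {0..1} g \<and> (AE x in unit_measure. f x = g x))"

definition square_integrable :: "(real \<Rightarrow> complex) \<Rightarrow> bool" where
  "square_integrable f \<longleftrightarrow>
     f \<in> borel_measurable unit_measure \<and> integrable unit_measure (\<lambda>x. (norm (f x))\<^sup>2)"

definition h_op :: "(real \<Rightarrow> real) \<Rightarrow> (real \<Rightarrow> complex) \<Rightarrow> real \<Rightarrow> complex" where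
  "h_op p y = (\<lambda>x. - weak_deriv 2 y x - complex_of_real (p x) * y x)"

definition h_domain :: "(real \<Rightarrow> real) \<Rightarrow> (real \<Rightarrow> complex) set" where
  "h_domain p =
     {y. square_integrable y \<and> y \<in> sobolev 2 \<and> square_integrable (h_op p y) \<and>
         cont_rep y 0 = 0 \<and> cont_rep y 1 = 0}"

definition h_eigenvalues :: "(real \<Rightarrow> real) \<Rightarrow> complex set" where
  "h_eigenvalues p =
     {\<mu>. \<exists>y \<in> h_domain p. \<not> (AE x in unit_measure. y x = 0) \<and>
                        (AE x in unit_measure. h_op p y x = \<mu> * y x)}"

end

theory Submission
  imports Defs "HOL-Complex_Analysis.Complex_Analysis"
begin

text \<open>
  Replace \<open>p\<close> by its \<open>C\<^sup>3\<close> representative and put \<open>q = p\<^sub>0 - p\<close>, which has mean zero and shifts the spectrum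
  by \<open>p\<^sub>0\<close>.  The shifted eigenvalues are the zeros, all real and simple, of the entire function
  \<open>\<Delta>(\<lambda>) = \<phi>(1, \<lambda>)\<close>, where \<open>\<phi>'' = (q - \<lambda>) \<phi>\<close>, \<open>\<phi>(0) = 0\<close>, \<open>\<phi>'(0) = 1\<close>.  With \<open>\<lambda> = k\<^sup>2\<close>, the Liouville--Green
  approximation gives, for all complex \<open>k\<close> of large modulus and uniformly on bounded sets of potentials,
  \<open>k \<Delta>(k\<^sup>2) = sin k (1 + E/k\<^sup>2 + F/k\<^sup>4) + B cos k/k\<^sup>3 + O(exp \<bar>Im k\<bar>/\<bar>k\<bar>\<^sup>5)\<close>.  On the circles
  \<open>\<bar>\<lambda>\<bar> = \<pi>\<^sup>2 (N + 1/2)\<^sup>2\<close> this makes \<open>\<Delta>(\<lambda>) / (sin k/k)\<close> close to 1, so the argument principle, integrated by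
  parts, turns the difference of \<open>\<Sum> (\<lambda>\<^sup>2 + c \<lambda>)\<close> over the first \<open>N\<close> zeros of \<open>\<Delta>\<close> and of \<open>sin k/k\<close> into a contour
  integral of the logarithm of this ratio, which the expansion evaluates up to \<open>O(1/N)\<close>.  This is the
  trace formula, with uniform convergence.  The same expansion at the zeros themselves bounds the \<open>n\<close>-th
  term by \<open>O(1/n\<^sup>2)\<close>, which gives absolute convergence.
\<close>

section \<open>Primitives of integrable functions on the unit interval\<close>

text \<open>The fourth derivative of the potential is only integrable. Derivatives are therefore
  encoded as indefinite integrals (\<open>prim\<close>), and the approximation error is measured by
  the L1 norm of a residual. The order of the expansion is forced: on the circle of radius r^2 in
  \<lambda> the weight 2 \<lambda> + c has size r^2 and the length is 2 \<pi> r^2, so a logarithm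
  known up to O(r^-5) leaves O(1/r). The amplitude contributes powers of 1/\<lambda>, evaluated by
  residues. The phase contributes B cot k / k^3, which is no Laurent polynomial in \<lambda>; but
  cot k / k is 1/\<lambda> plus twice the logarithmic derivative of sin k / k, so the argument
  principle for the unperturbed problem integrates it. Of the resulting 2 B (2 N + 1), the part 4 B
  N supplies the constant in each term of the series, and 2 B stays in the trace. No asymptotics of
  the n-th eigenvalue are presupposed: the same contour identity with weight 1 counts the zeros in
  each disc and so fixes the index. All constants depend only on one bound \<open>M\<close> for the
  potential, which yields uniformity.\<close>

definition prim :: "(real \<Rightarrow> 'a::euclidean_space) \<Rightarrow> (real \<Rightarrow> 'a) \<Rightarrow> bool" where
  "prim F g \<longleftrightarrow> g absolutely_integrable_on {0..1} \<and> (\<forall>x\<in>{0..1}. F x = F 0 + integral {0..x} g)"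

lemma prim_eq: "\<lbrakk>prim F g; 0 \<le> x; x \<le> 1\<rbrakk> \<Longrightarrow> F x = F 0 + integral {0..x} g"
  unfolding prim_def by (meson atLeastAtMost_iff)

lemma prim_abs: "prim F g \<Longrightarrow> g absolutely_integrable_on {0..1}"
  by (simp add: prim_def)

lemma prim_has_integral:
  assumes "prim F g" "0 \<le> a" "a \<le> b" "b \<le> 1"
  shows "(g has_integral (F b - F a)) {a..b}"
proof -
  have g: "g integrable_on {0..1}"
    using assms(1) set_lebesgue_integral_eq_integral(1) unfolding prim_def by blast
  then have gb: "g integrable_on {0..b}"
    using assms by (auto intro: integrable_on_subinterval)
  then have gab: "g integrable_on {a..b}"
    using assms by (auto intro: integrable_on_subinterval)
  have "integral {0..a} g + integral {a..b} g = integral {0..b} g"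
    using Henstock_Kurzweil_Integration.integral_combine[OF _ _ gb, of a] assms by auto
  moreover have "F a = F 0 + integral {0..a} g" "F b = F 0 + integral {0..b} g"
    by (rule prim_eq[OF assms(1)]; use assms in simp)+
  ultimately have "F b - F a = integral {a..b} g"
    by (simp add: algebra_simps)
  with gab show ?thesis by (simp add: has_integral_iff)
qed

lemma primI:
  assumes "g absolutely_integrable_on {0..1}"
    and "\<And>x. \<lbrakk>0 \<le> x; x \<le> 1\<rbrakk> \<Longrightarrow> (g has_integral (F x - F 0)) {0..x}"
  shows "prim F g"
  unfolding prim_def
proof (intro conjI ballI)
  fix x :: real assume "x \<in> {0..1}"
  then have "integral {0..x} g = F x - F 0"
    using assms(2)[of x] by (simp add: integral_unique)
  then show "F x = F 0 + integral {0..x} g" by simp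
qed (rule assms(1))

lemma prim_continuous:
  assumes "prim F g" shows "continuous_on {0..1} F"
proof -
  have "g integrable_on {0..1}"
    using assms set_lebesgue_integral_eq_integral(1) unfolding prim_def by blast
  then have "continuous_on {0..1} (\<lambda>x. F 0 + integral {0..x} g)"
    by (intro continuous_intros indefinite_integral_continuous_1)
  then show ?thesis
    by (rule continuous_on_eq) (metis assms atLeastAtMost_iff prim_eq)
qed

lemma primI_derivative:
  assumes "continuous_on {0..1} g"
    and "\<And>x. x \<in> {0..1} \<Longrightarrow> (F has_vector_derivative g x) (at x within {0..1})"
  shows "prim F g"
proof (rule primI)
  show "g absolutely_integrable_on {0..1}"
    using assms(1) by (simp add: absolutely_integrable_continuous_real)
  fix x :: real assume "0 \<le> x" "x \<le> 1"
  then show "(g has_integral F x - F 0) {0..x}"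
    by (intro fundamental_theorem_of_calculus has_vector_derivative_within_subset[OF assms(2)]) auto
qed

lemma prim_derivative:
  assumes "prim F g" "continuous_on {0..1} g" "x \<in> {0..1}"
  shows "(F has_vector_derivative g x) (at x within {0..1})"
proof -
  have "((\<lambda>u. integral {0..u} g) has_vector_derivative g x) (at x within {0..1})"
    using integral_has_vector_derivative assms by blast
  then have "((\<lambda>u. F 0 + integral {0..u} g) has_vector_derivative g x) (at x within {0..1})"
    by (subst add.commute) (simp only: has_vector_derivative_add_const)
  then show ?thesis
    by (rule has_vector_derivative_transform[OF assms(3), rotated]) (metis assms(1) atLeastAtMost_iff prim_eq)
qed

lemma prim_const: "prim (\<lambda>x. c) (\<lambda>x. 0)"
  by (rule primI) auto

lemma prim_linear:
  assumes "prim F g" "bounded_linear h"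
  shows "prim (\<lambda>x. h (F x)) (\<lambda>x. h (g x))"
proof (rule primI)
  show "(\<lambda>x. h (g x)) absolutely_integrable_on {0..1}"
    using absolutely_integrable_linear[OF prim_abs[OF assms(1)] assms(2)] by (simp add: o_def)
  fix x :: real assume "0 \<le> x" "x \<le> 1"
  then have "((h \<circ> g) has_integral h (F x - F 0)) {0..x}"
    by (intro has_integral_linear[OF prim_has_integral[OF assms(1)] assms(2)]) auto
  then show "((\<lambda>x. h (g x)) has_integral h (F x) - h (F 0)) {0..x}"
    using assms(2) by (simp add: o_def linear_simps)
qed

lemma prim_add:
  assumes "prim F f" "prim G g"
  shows "prim (\<lambda>x. F x + G x) (\<lambda>x. f x + g x)"
proof (rule primI)
  show "(\<lambda>x. f x + g x) absolutely_integrable_on {0..1}"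
    using assms unfolding prim_def by (intro set_integral_add) auto
  fix x :: real assume "0 \<le> x" "x \<le> 1"
  then have "((\<lambda>x. f x + g x) has_integral (F x - F 0) + (G x - G 0)) {0..x}"
    by (intro has_integral_add prim_has_integral[OF assms(1)] prim_has_integral[OF assms(2)]) auto
  then show "((\<lambda>x. f x + g x) has_integral F x + G x - (F 0 + G 0)) {0..x}"
    by (simp add: algebra_simps)
qed

lemma prim_cong_AE:
  assumes "prim F f" "negligible N" "\<And>x. x \<in> {0..1} - N \<Longrightarrow> g x = f x"
    and "\<And>x. x \<in> {0..1} \<Longrightarrow> G x = F x"
  shows "prim G g"
proof (rule primI)
  show "g absolutely_integrable_on {0..1}"
    by (rule absolutely_integrable_spike[OF prim_abs[OF assms(1)] assms(2)]) (use assms(3) in auto)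
  fix x :: real assume x: "0 \<le> x" "x \<le> 1"
  have "(g has_integral (F x - F 0)) {0..x}"
    by (rule has_integral_spike[OF assms(2) _ prim_has_integral[OF assms(1)]]) (use x assms(3) in auto)
  then show "(g has_integral (G x - G 0)) {0..x}" using assms(4) x by simp
qed

lemma prim_cong:
  assumes "prim F f" "\<And>x. x \<in> {0..1} \<Longrightarrow> g x = f x" "\<And>x. x \<in> {0..1} \<Longrightarrow> G x = F x"
  shows "prim G g"
  by (rule prim_cong_AE[OF assms(1) negligible_empty]) (simp_all only: Diff_empty assms(2,3))

text \<open>Cutting [0,x] into pieces shorter than \<open>d\<close> reduces the claim to
  \<open>loc\<close>: the triangle inequality adds the increments of \<open>H\<close>, and those of
  \<open>V\<close> telescope. In \<open>prim_bilinear\<close> this replaces a mean value argument,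
  since no pointwise derivative is at hand there.\<close>

lemma norm_increment_le:
  fixes H :: "real \<Rightarrow> 'a::real_normed_vector" and V :: "real \<Rightarrow> real"
  assumes d: "d > 0"
    and loc: "\<And>a b. \<lbrakk>0 \<le> a; a \<le> b; b \<le> 1; b - a < d\<rbrakk> \<Longrightarrow> norm (H b - H a) \<le> V b - V a"
    and x: "0 \<le> x" "x \<le> 1"
  shows "norm (H x - H 0) \<le> V x - V 0"
proof -
  obtain n :: nat where n: "1 / d < real n" using reals_Archimedean2 by blast
  have "0 < 1 / d" using d by simp
  then have n0: "0 < real n" using n by linarith
  have nd: "x / real n < d"
    using n n0 d x by (smt (verit) divide_less_eq mult.commute)
  have "norm (H (real j * x / n) - H 0) \<le> V (real j * x / n) - V 0" if "j \<le> n" for j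
    using that
  proof (induction j)
    case (Suc j)
    let ?a = "real j * x / n" and ?b = "real (Suc j) * x / n"
    have diff: "?b - ?a = x / n" by (simp add: field_simps add_divide_distrib)
    have "real (Suc j) * x \<le> real n * 1"
      using Suc.prems x by (intro mult_mono) auto
    then have "?b \<le> 1" using n0 by (simp add: divide_le_eq)
    moreover have "0 \<le> ?a" using x by simp
    moreover have "?a \<le> ?b" using diff x n0 by (smt (verit) divide_nonneg_pos)
    ultimately have "norm (H ?b - H ?a) \<le> V ?b - V ?a"
      using nd diff by (intro loc) auto
    moreover have "norm (H ?a - H 0) \<le> V ?a - V 0" using Suc by simp
    moreover have "norm (H ?b - H 0) \<le> norm (H ?b - H ?a) + norm (H ?a - H 0)"
      using norm_triangle_ineq[of "H ?b - H ?a" "H ?a - H 0"] by simp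
    ultimately show ?case by linarith
  qed simp
  from this[of n] n0 show ?thesis by simp
qed

lemma continuous_bilinear_absolutely_integrable:
  fixes h :: "'a::euclidean_space \<Rightarrow> 'b::euclidean_space \<Rightarrow> 'c::euclidean_space"
  assumes "bounded_bilinear h" "continuous_on {0..1::real} F" "g absolutely_integrable_on {0..1}"
  shows "(\<lambda>x. h (F x) (g x)) absolutely_integrable_on {0..1}"
  by (rule absolutely_integrable_bounded_measurable_product[OF bilinear_conv_bounded_bilinear[THEN iffD2, OF assms(1)] _ _ _ assms(3)])
     (use assms(2) in \<open>auto intro: continuous_imp_measurable_on_sets_lebesgue
        compact_imp_bounded compact_continuous_image\<close>)

lemma bilinear_continuous_absolutely_integrable:
  fixes h :: "'a::euclidean_space \<Rightarrow> 'b::euclidean_space \<Rightarrow> 'c::euclidean_space"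
  assumes "bounded_bilinear h" "f absolutely_integrable_on {0..1::real}" "continuous_on {0..1} G"
  shows "(\<lambda>x. h (f x) (G x)) absolutely_integrable_on {0..1}"
  using continuous_bilinear_absolutely_integrable
    [OF bounded_bilinear.flip[OF assms(1)] assms(3,2)] by simp

text \<open>The product rule for absolutely continuous functions. On [a,b] the increment of
  \<open>h (F x) (G x)\<close> minus that of the integral of \<open>?w\<close> is the integral of
  \<open>h (f t) (G b - G t) + h (F a - F t) (g t)\<close>. By uniform continuity it is at most
  \<open>e * K\<close> times the integral of norm f + norm g on short intervals, hence on all of
  [0,x]; then e tends to 0.\<close>

lemma prim_bilinear:
  fixes h :: "'a::euclidean_space \<Rightarrow> 'b::euclidean_space \<Rightarrow> 'c::euclidean_space"
  assumes h: "bounded_bilinear h" and F: "prim F f" and G: "prim G g"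
  shows "prim (\<lambda>x. h (F x) (G x)) (\<lambda>x. h (f x) (G x) + h (F x) (g x))"
    (is "prim _ ?w")
proof -
  interpret h: bounded_bilinear h by fact
  obtain K where K: "0 < K" "\<And>a b. norm (h a b) \<le> norm a * norm b * K"
    using h.pos_bounded by blast
  note Fc = prim_continuous[OF F] and Gc = prim_continuous[OF G]
  have wabs: "?w absolutely_integrable_on {0..1}"
    by (intro set_integral_add(1) bilinear_continuous_absolutely_integrable[OF h prim_abs[OF F] Gc]
        continuous_bilinear_absolutely_integrable[OF h Fc prim_abs[OF G]])
  let ?v = "\<lambda>x. norm (f x) + norm (g x)"
  have vabs: "?v absolutely_integrable_on {0..1}"
    using absolutely_integrable_norm[OF prim_abs[OF F]] absolutely_integrable_norm[OF prim_abs[OF G]]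
    by (intro set_integral_add(1)) (auto simp: o_def)
  define W where "W x = integral {0..x} ?w" for x
  define V where "V x = integral {0..x} ?v" for x
  have W: "prim W ?w" and V: "prim V ?v"
    using wabs vabs by (auto simp: prim_def W_def V_def)
  define H where "H x = h (F x) (G x) - W x" for x
  have small: "norm (H x - H 0) \<le> e * K * (V x - V 0)" if e: "e > 0" and x: "0 \<le> x" "x \<le> 1" for e x
  proof -
    obtain d1 where "d1 > 0"
      and d1: "\<And>x x'. \<lbrakk>x \<in> {0..1}; x' \<in> {0..1}; dist x' x < d1\<rbrakk> \<Longrightarrow> dist (F x') (F x) < e"
      using compact_uniformly_continuous[OF Fc compact_Icc] e
      unfolding uniformly_continuous_on_def by blast
    obtain d2 where "d2 > 0"
      and d2: "\<And>x x'. \<lbrakk>x \<in> {0..1}; x' \<in> {0..1}; dist x' x < d2\<rbrakk> \<Longrightarrow> dist (G x') (G x) < e"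
      using compact_uniformly_continuous[OF Gc compact_Icc] e
      unfolding uniformly_continuous_on_def by blast
    note d = \<open>d1 > 0\<close> \<open>d2 > 0\<close>
    have "norm (H x - H 0) \<le> (e * K * V x) - (e * K * V 0)"
    proof (rule norm_increment_le[where d = "min d1 d2" and V = "\<lambda>x. e * K * V x"])
      fix a b :: real assume ab: "0 \<le> a" "a \<le> b" "b \<le> 1" "b - a < min d1 d2"
      have 1: "((\<lambda>t. h (f t) (G b)) has_integral h (F b - F a) (G b)) {a..b}"
        using has_integral_linear[OF prim_has_integral[OF F ab(1-3)] h.bounded_linear_left, of "G b"]
        by (simp add: o_def)
      have 2: "((\<lambda>t. h (F a) (g t)) has_integral h (F a) (G b - G a)) {a..b}"
        using has_integral_linear[OF prim_has_integral[OF G ab(1-3)] h.bounded_linear_right, of "F a"]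
        by (simp add: o_def)
      have "((\<lambda>t. h (f t) (G b) + h (F a) (g t) - ?w t) has_integral
               h (F b - F a) (G b) + h (F a) (G b - G a) - (W b - W a)) {a..b}"
        by (intro has_integral_diff has_integral_add 1 2 prim_has_integral[OF W ab(1-3)])
      moreover have "h (F b - F a) (G b) + h (F a) (G b - G a) - (W b - W a) = H b - H a"
        by (simp add: H_def h.diff_left h.diff_right)
      moreover have "h (f t) (G b) + h (F a) (g t) - ?w t = h (f t) (G b - G t) + h (F a - F t) (g t)" for t
        by (simp add: h.diff_left h.diff_right)
      ultimately have I: "((\<lambda>t. h (f t) (G b - G t) + h (F a - F t) (g t)) has_integral H b - H a) {a..b}"
        by simp
      have bd: "norm (h (f t) (G b - G t) + h (F a - F t) (g t)) \<le> e * K * ?v t" if t: "t \<in> {a..b}" for t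
      proof -
        have "dist (G b) (G t) < e" "dist (F a) (F t) < e"
          using t ab by (auto intro!: d1 d2 simp: dist_real_def)
        then have e2: "norm (G b - G t) \<le> e" "norm (F a - F t) \<le> e"
          by (auto simp: dist_norm)
        have "norm (h (f t) (G b - G t)) \<le> norm (f t) * e * K"
          using e2 K by (intro order_trans[OF K(2)] mult_right_mono mult_left_mono) auto
        moreover have "norm (h (F a - F t) (g t)) \<le> e * norm (g t) * K"
          using e2 K by (intro order_trans[OF K(2)] mult_right_mono) auto
        ultimately show ?thesis
          by (intro order_trans[OF norm_triangle_ineq]) (simp add: algebra_simps)
      qed
      have IV: "((\<lambda>t. e * K * ?v t) has_integral e * K * (V b - V a)) {a..b}"
        by (intro has_integral_mult_right prim_has_integral[OF V ab(1-3)])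
      show "norm (H b - H a) \<le> e * K * V b - e * K * V a"
        using integral_norm_bound_integral[OF has_integral_integrable[OF I] has_integral_integrable[OF IV] bd]
          integral_unique[OF I] integral_unique[OF IV] by (simp add: algebra_simps)
    qed (use d x in auto)
    then show ?thesis by (simp add: algebra_simps)
  qed
  have H0: "H x = H 0" if x: "0 \<le> x" "x \<le> 1" for x
  proof (rule ccontr)
    assume "H x \<noteq> H 0"
    then have p: "norm (H x - H 0) > 0" by simp
    define C where "C = K * (V x - V 0)"
    have 1: "norm (H x - H 0) \<le> e * C" if "e > 0" for e
      using small[OF that x] by (simp add: C_def mult.assoc)
    have "C > 0" using 1[of 1] p by linarith
    then have "norm (H x - H 0) \<le> norm (H x - H 0) / 2"
      using 1[of "norm (H x - H 0) / (2 * C)"] p by simp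
    with p show False by simp
  qed
  show ?thesis
  proof (rule primI[OF wabs])
    fix x :: real assume x: "0 \<le> x" "x \<le> 1"
    have "h (F x) (G x) - h (F 0) (G 0) = W x - W 0"
      using H0[OF x] by (simp add: H_def algebra_simps)
    then show "(?w has_integral h (F x) (G x) - h (F 0) (G 0)) {0..x}"
      using prim_has_integral[OF W, of 0 x] x by simp
  qed
qed

lemma prim_mult:
  fixes F G :: "real \<Rightarrow> complex"
  assumes "prim F f" "prim G g"
  shows "prim (\<lambda>x. F x * G x) (\<lambda>x. f x * G x + F x * g x)"
  using prim_bilinear[OF bounded_bilinear_mult assms] .

lemma prim_mult_real:
  fixes F G :: "real \<Rightarrow> real"
  assumes "prim F f" "prim G g"
  shows "prim (\<lambda>x. F x * G x) (\<lambda>x. f x * G x + F x * g x)"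
  using prim_bilinear[OF bounded_bilinear_mult assms] .

lemma prim_scaleR:
  assumes "prim F f" "prim G g"
  shows "prim (\<lambda>x. F x *\<^sub>R G x) (\<lambda>x. f x *\<^sub>R G x + F x *\<^sub>R g x)"
  using prim_bilinear[OF bounded_bilinear_scaleR assms] .

section \<open>Smooth functions and bump functions\<close>

lemma all_le_Suc: "(\<forall>j\<le>Suc k. Q j) \<longleftrightarrow> Q 0 \<and> (\<forall>j\<le>k. Q (Suc j))"
  by (metis Suc_le_mono not0_implies_Suc zero_le)

text \<open>Recursion through \<open>deriv f\<close> lets closure under sums, products and affine
  substitutions be proved by induction on \<open>k\<close> with \<open>f\<close> arbitrary. The
  conjunction over all \<open>k\<close> is smoothness, by \<open>Ck_iff\<close>.\<close>

fun Ck :: "nat \<Rightarrow> (real \<Rightarrow> real) \<Rightarrow> bool" where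
  "Ck 0 f \<longleftrightarrow> True"
| "Ck (Suc k) f \<longleftrightarrow> (\<forall>x. f field_differentiable at x) \<and> Ck k (deriv f)"

lemma Ck_iff: "(\<forall>k. Ck k f) \<longleftrightarrow> (\<forall>k x. (deriv ^^ k) f field_differentiable at x)"
proof -
  have "Ck (Suc k) f \<longleftrightarrow> (\<forall>j\<le>k. \<forall>x. (deriv ^^ j) f field_differentiable at x)" for k f
  proof (induction k arbitrary: f)
    case (Suc k)
    have "Ck (Suc (Suc k)) f \<longleftrightarrow> (\<forall>x. f field_differentiable at x) \<and> Ck (Suc k) (deriv f)"
      by simp
    also have "\<dots> \<longleftrightarrow> (\<forall>x. f field_differentiable at x) \<and>
        (\<forall>j\<le>k. \<forall>x. (deriv ^^ Suc j) f field_differentiable at x)"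
      using Suc.IH[of "deriv f"] by (simp add: funpow_swap1)
    also have "\<dots> \<longleftrightarrow> (\<forall>j\<le>Suc k. \<forall>x. (deriv ^^ j) f field_differentiable at x)"
      using all_le_Suc[where Q = "\<lambda>j. \<forall>x. (deriv ^^ j) f field_differentiable at x"] by simp
    finally show ?case .
  qed simp
  note * = this
  show ?thesis
  proof
    assume "\<forall>k. Ck k f"
    then show "\<forall>k x. (deriv ^^ k) f field_differentiable at x" using * by blast
  next
    assume A: "\<forall>k x. (deriv ^^ k) f field_differentiable at x"
    show "\<forall>k. Ck k f"
    proof
      fix k show "Ck k f" using A * by (cases k) auto
    qed
  qed
qed

lemma Ck_SucD: "Ck (Suc k) f \<Longrightarrow> Ck k f"
proof (induction k arbitrary: f)
  case (Suc k)
  then have "Ck k (deriv f)" using Suc.IH[of "deriv f"] by simp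
  with Suc.prems show ?case by simp
qed simp

lemma deriv_add_real:
  fixes f g :: "real \<Rightarrow> real"
  assumes "\<forall>x. f field_differentiable at x" "\<forall>x. g field_differentiable at x"
  shows "deriv (\<lambda>x. f x + g x) = (\<lambda>x. deriv f x + deriv g x)"
  using assms by (intro ext deriv_add) auto

lemma deriv_mult_real:
  fixes f g :: "real \<Rightarrow> real"
  assumes "\<forall>x. f field_differentiable at x" "\<forall>x. g field_differentiable at x"
  shows "deriv (\<lambda>x. f x * g x) = (\<lambda>x. f x * deriv g x + deriv f x * g x)"
  using assms by (intro ext deriv_mult) auto

lemma Ck_add: "\<lbrakk>Ck k f; Ck k g\<rbrakk> \<Longrightarrow> Ck k (\<lambda>x. f x + g x)"
  by (induction k arbitrary: f g) (auto simp: deriv_add_real intro: field_differentiable_add)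

lemma Ck_mult: "\<lbrakk>Ck k f; Ck k g\<rbrakk> \<Longrightarrow> Ck k (\<lambda>x. f x * g x)"
proof (induction k arbitrary: f g)
  case (Suc k)
  have "Ck k (\<lambda>x. f x * deriv g x + deriv f x * g x)"
    using Suc.prems Ck_SucD[of k f] Ck_SucD[of k g] by (intro Ck_add Suc.IH) auto
  then show ?case
    using Suc.prems by (auto simp: deriv_mult_real intro: field_differentiable_mult)
qed simp

lemma Ck_const: "Ck k (\<lambda>x. c)"
  by (induction k arbitrary: c) auto

lemma Ck_affine: "Ck k f \<Longrightarrow> Ck k (\<lambda>x. f (a * x + b))"
proof (induction k arbitrary: f)
  case (Suc k)
  have d: "((\<lambda>x. f (a * x + b)) has_field_derivative (a * deriv f (a * x + b))) (at x)" for x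
  proof -
    have "(f has_field_derivative deriv f (a * x + b)) (at (a * x + b))"
      using Suc.prems by (simp add: field_differentiable_derivI)
    then have "((f \<circ> (\<lambda>x. a * x + b)) has_field_derivative (deriv f (a * x + b) * a)) (at x)"
      by (intro DERIV_chain) (auto intro!: derivative_eq_intros)
    then show ?thesis by (simp add: o_def mult.commute)
  qed
  then have "deriv (\<lambda>x. f (a * x + b)) = (\<lambda>x. a * deriv f (a * x + b))"
    by (intro ext DERIV_imp_deriv)
  moreover have "Ck k (\<lambda>x. a * deriv f (a * x + b))"
    using Suc by (intro Ck_mult Ck_const) auto
  ultimately show ?case using d by (auto simp: field_differentiable_def)
qed simp

lemma higher_deriv_comb:
  "\<lbrakk>Ck m f; Ck m g\<rbrakk> \<Longrightarrow> (deriv ^^ m) (\<lambda>x. f x - c * g x) = (\<lambda>x. (deriv ^^ m) f x - c * (deriv ^^ m) g x)"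
proof (induction m arbitrary: f g)
  case (Suc m)
  have "deriv (\<lambda>x. f x - c * g x) = (\<lambda>x. deriv f x - c * deriv g x)"
  proof
    fix x
    have "(f has_field_derivative deriv f x) (at x)" "(g has_field_derivative deriv g x) (at x)"
      using Suc.prems by (auto simp: field_differentiable_derivI)
    then show "deriv (\<lambda>x. f x - c * g x) x = deriv f x - c * deriv g x"
      by (intro DERIV_imp_deriv derivative_eq_intros refl | simp)+
  qed
  then have "(deriv ^^ Suc m) (\<lambda>x. f x - c * g x) = (deriv ^^ m) (\<lambda>x. deriv f x - c * deriv g x)"
    by (simp add: funpow_swap1)
  also have "\<dots> = (\<lambda>x. (deriv ^^ m) (deriv f) x - c * (deriv ^^ m) (deriv g) x)"
    using Suc by (intro Suc.IH) auto
  finally show ?case by (simp add: funpow_swap1)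
qed simp

text \<open>The functions P(1/x) exp(-1/x), extended by 0 to x <= 0, form a family closed under
  differentiation, so smoothness of all of them follows from one derivative computation.\<close>

definition flat :: "real poly \<Rightarrow> real \<Rightarrow> real" where
  "flat P x = (if x > 0 then poly P (1 / x) * exp (- (1 / x)) else 0)"

lemma poly_times_exp_tendsto_0: "((\<lambda>t. poly P t * exp (- t)) \<longlongrightarrow> (0::real)) at_top"
proof -
  have "((\<lambda>t. \<Sum>i\<le>degree P. coeff P i * (t ^ i / exp t)) \<longlongrightarrow> (\<Sum>i\<le>degree P. coeff P i * 0)) at_top"
    by (intro tendsto_intros tendsto_power_div_exp_0)
  moreover have "poly P t * exp (- t) = (\<Sum>i\<le>degree P. coeff P i * (t ^ i / exp t))" for t
    by (simp add: poly_altdef sum_distrib_right exp_minus divide_inverse mult.assoc)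
  ultimately show ?thesis by simp
qed

text \<open>With t = 1/x the chain rule gives t^2 (P(t) - P'(t)) exp(-t), whence the factor
  \<open>[:0, 0, 1:]\<close>. At 0 the difference quotient from the right is t P(t) exp(-t), which
  has the same form and tends to 0.\<close>

lemma has_derivative_flat:
  "(flat P has_field_derivative flat ([:0, 0, 1:] * (P - pderiv P)) x) (at x)"
proof -
  consider "x > 0" | "x < 0" | "x = 0" by linarith
  then show ?thesis
  proof cases
    case 1
    have "((\<lambda>x. poly P (1 / x) * exp (- (1 / x))) has_field_derivative
            poly ([:0, 0, 1:] * (P - pderiv P)) (1 / x) * exp (- (1 / x))) (at x)"
      using 1 by (auto intro!: derivative_eq_intros DERIV_chain'[of "\<lambda>x. 1 / x" _ _ _ "poly P"] poly_DERIV
          simp: field_simps power2_eq_square)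
    then show ?thesis
      using 1 by (auto simp: flat_def intro: has_field_derivative_transform_within_open[where S = "{0<..}"])
  next
    case 2
    have "((\<lambda>x. 0::real) has_field_derivative 0) (at x)" by simp
    then have "(flat P has_field_derivative 0) (at x)"
      by (rule has_field_derivative_transform_within_open[where S = "{..<0}"]) (use 2 in \<open>auto simp: flat_def\<close>)
    then show ?thesis using 2 by (simp add: flat_def)
  next
    case 3
    have r: "((\<lambda>h. flat P h / h) \<longlongrightarrow> 0) (at_right 0)"
    proof -
      have "filterlim (\<lambda>h::real. 1 / h) at_top (at_right 0)"
        using filterlim_inverse_at_top_right by (simp add: divide_inverse)
      from filterlim_compose[OF poly_times_exp_tendsto_0[of "[:0, 1:] * P"] this]
      have "((\<lambda>h. poly ([:0, 1:] * P) (1 / h) * exp (- (1 / h))) \<longlongrightarrow> 0) (at_right 0)" .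
      then show ?thesis
        by (rule Lim_transform_eventually)
          (auto simp: flat_def eventually_at_filter)
    qed
    have l: "((\<lambda>h. flat P h / h) \<longlongrightarrow> 0) (at_left 0)"
      by (rule tendsto_eventually) (auto simp: flat_def eventually_at_filter)
    have "((\<lambda>h. flat P h / h) \<longlongrightarrow> 0) (at 0)"
      using l r by (simp add: filterlim_split_at)
    then show ?thesis
      using 3 by (simp add: has_field_derivative_iff flat_def)
  qed
qed

lemma Ck_flat: "Ck k (flat P)"
proof (induction k arbitrary: P)
  case (Suc k)
  have "deriv (flat P) = flat ([:0, 0, 1:] * (P - pderiv P))"
    using has_derivative_flat by (intro ext DERIV_imp_deriv) blast
  then show ?case
    using Suc has_derivative_flat by (auto simp: field_differentiable_def)
qed simp

text \<open>The affine substitutions produce exp(-1/(n (x - a))) exp(-1/(n (b - x))) on (a,b).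
  Enlarging \<open>n\<close> pushes both factors towards 1, so the functions converge pointwise to
  the indicator of the open interval.\<close>

definition bump :: "real \<Rightarrow> real \<Rightarrow> real \<Rightarrow> real \<Rightarrow> real" where
  "bump n a b x = flat 1 (n * x + (- n * a)) * flat 1 ((- n) * x + n * b)"

lemma bump_eq:
  assumes "n > 0"
  shows "bump n a b x = (if a < x \<and> x < b then exp (- (1 / (n * (x - a)))) * exp (- (1 / (n * (b - x)))) else 0)"
  using assms by (auto simp: bump_def flat_def algebra_simps)

lemma test_bump:
  assumes "0 < a" "b < 1" "n > 0"
  shows "test_function (bump n a b)"
proof -
  have "Ck k (bump n a b)" for k
    unfolding bump_def by (intro Ck_mult Ck_affine Ck_flat)
  moreover have "{x. bump n a b x \<noteq> 0} \<subseteq> {a..b}"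
    using assms by (auto simp: bump_eq)
  then have "closure {x. bump n a b x \<noteq> 0} \<subseteq> {a..b}"
    by (rule closure_minimal) simp
  then have "closure {x. bump n a b x \<noteq> 0} \<subseteq> {0<..<1}" using assms by auto
  ultimately show ?thesis
    using Ck_iff[of "bump n a b"] by (simp add: test_function_def)
qed

section \<open>Weak derivatives\<close>

lemma test_function_iff:
  "test_function \<phi> \<longleftrightarrow> (\<forall>k. Ck k \<phi>) \<and> (\<exists>a b. 0 < a \<and> a < b \<and> b < 1 \<and> (\<forall>x. x \<notin> {a..b} \<longrightarrow> \<phi> x = 0))"
proof -
  have "closure {x. \<phi> x \<noteq> 0} \<subseteq> {0<..<1} \<longleftrightarrow>
    (\<exists>a b. 0 < a \<and> a < b \<and> b < 1 \<and> (\<forall>x. x \<notin> {a..b} \<longrightarrow> \<phi> x = 0))" (is "?L \<longleftrightarrow> ?R")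
  proof
    assume L: ?L
    let ?S = "closure {x. \<phi> x \<noteq> 0}"
    show ?R
    proof (cases "?S = {}")
      case True
      then have "\<phi> x = 0" for x using closure_subset[of "{x. \<phi> x \<noteq> 0}"] by auto
      then show ?thesis by (intro exI[of _ "1/3"] exI[of _ "1/2"]) auto
    next
      case False
      have b: "bounded ?S" by (rule bounded_subset[OF _ L]) simp
      have cp: "compact ?S" using b by (simp add: compact_eq_bounded_closed)
      obtain a where a: "a \<in> ?S" "\<And>x. x \<in> ?S \<Longrightarrow> a \<le> x"
        using compact_attains_inf[OF cp False] by blast
      obtain c where c: "c \<in> ?S" "\<And>x. x \<in> ?S \<Longrightarrow> x \<le> c"
        using compact_attains_sup[OF cp False] by blast
      have z: "\<phi> x = 0" if "x \<notin> {a..c}" for x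
        using a c that closure_subset[of "{x. \<phi> x \<noteq> 0}"] by fastforce
      have "0 < a" "c < 1" "a \<le> c" using a c L by auto
      \<comment> \<open>The right end of the support is pushed outwards to keep the interval
        nondegenerate.\<close>
      moreover from this obtain d where "c < d" "d < 1" using dense by blast
      ultimately show ?thesis
        using z by (intro exI[of _ a] exI[of _ d]) auto
    qed
  next
    assume ?R
    then obtain a b where ab: "0 < a" "b < 1" and z: "\<And>x. x \<notin> {a..b} \<Longrightarrow> \<phi> x = 0" by blast
    have "{x. \<phi> x \<noteq> 0} \<subseteq> {a..b}" using z by blast
    then have "closure {x. \<phi> x \<noteq> 0} \<subseteq> {a..b}" by (rule closure_minimal) simp
    then show ?L using ab by auto
  qed
  then show ?thesis by (simp add: test_function_def Ck_iff)
qed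

lemma test_function_Ck: "test_function \<phi> \<Longrightarrow> Ck k \<phi>"
  by (simp add: test_function_iff)

lemma test_function_has_deriv:
  assumes "test_function \<phi>" shows "(\<phi> has_field_derivative deriv \<phi> x) (at x)"
  using test_function_Ck[OF assms, of 1] by (simp add: field_differentiable_derivI)

lemma test_function_continuous: 
  assumes "test_function \<phi>" shows "continuous_on S \<phi>"
  by (rule DERIV_continuous_on) (rule has_field_derivative_at_within[OF test_function_has_deriv[OF assms]])

lemma test_function_deriv:
  assumes "test_function \<phi>" shows "test_function (deriv \<phi>)"
proof -
  obtain a b where ab: "0 < a" "a < b" "b < 1" and z: "\<And>x. x \<notin> {a..b} \<Longrightarrow> \<phi> x = 0"
    using assms unfolding test_function_iff by blast
  have "deriv \<phi> x = 0" if "x \<notin> {a..b}" for x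
  proof -
    have "((\<lambda>x. 0::real) has_field_derivative 0) (at x)" by simp
    then have "(\<phi> has_field_derivative 0) (at x)"
      by (rule has_field_derivative_transform_within_open[where S = "-{a..b}"]) (use that z in \<open>auto simp: open_Compl\<close>)
    then show ?thesis by (rule DERIV_imp_deriv)
  qed
  moreover have "Ck k (deriv \<phi>)" for k
    using test_function_Ck[OF assms, of "Suc k"] by simp
  ultimately show ?thesis
    unfolding test_function_iff using ab by blast
qed

lemma test_function_higher_deriv:
  "test_function \<phi> \<Longrightarrow> test_function ((deriv ^^ m) \<phi>)"
  by (induction m) (auto intro: test_function_deriv)

lemma test_function_comb:
  assumes "test_function f" "test_function g"
  shows "test_function (\<lambda>x. f x - c * g x)"
proof -
  obtain a b where ab: "0 < a" "a < b" "b < 1" and z: "\<And>x. x \<notin> {a..b} \<Longrightarrow> f x = 0"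
    using assms(1) unfolding test_function_iff by blast
  obtain a' b' where ab': "0 < a'" "a' < b'" "b' < 1" and z': "\<And>x. x \<notin> {a'..b'} \<Longrightarrow> g x = 0"
    using assms(2) unfolding test_function_iff by blast
  have "Ck k (\<lambda>x. f x + (- c) * g x)" for k
    using assms by (intro Ck_add Ck_mult Ck_const) (auto simp: test_function_Ck)
  moreover have "f x - c * g x = 0" if "x \<notin> {min a a'..max b b'}" for x
  proof -
    have "x \<notin> {a..b}" "x \<notin> {a'..b'}" using that by auto
    then show ?thesis using z[of x] z'[of x] by simp
  qed
  ultimately show ?thesis
    unfolding test_function_iff using ab ab'
    by (intro conjI allI exI[of _ "min a a'"] exI[of _ "max b b'"]) auto
qed

lemma test_function_prim:
  assumes "test_function \<phi>" shows "prim \<phi> (deriv \<phi>)"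
  using assms
  by (intro primI_derivative test_function_continuous test_function_deriv)
     (auto intro!: has_field_derivative_at_within test_function_has_deriv
           simp flip: has_real_derivative_iff_has_vector_derivative)

lemma test_function_ends: "test_function \<phi> \<Longrightarrow> \<phi> 0 = 0" "test_function \<phi> \<Longrightarrow> \<phi> 1 = 0"
  unfolding test_function_iff by fastforce+

text \<open>Mean zero is exactly what makes the primitive vanish on both sides of the support: it is
  constant on each side, is 0 at 0, and takes the same value at 1.\<close>

lemma test_function_antiderivative:
  assumes \<psi>: "test_function \<psi>" and z: "integral {0..1} \<psi> = 0"
  obtains \<phi> where "test_function \<phi>" "deriv \<phi> = \<psi>"
proof -
  obtain a b where ab: "0 < a" "a < b" "b < 1" and s: "\<And>x. x \<notin> {a..b} \<Longrightarrow> \<psi> x = 0"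
    using \<psi> unfolding test_function_iff by blast
  obtain \<Phi> where \<Phi>: "\<And>x. (\<Phi> has_field_derivative \<psi> x) (at x)"
  proof -
    have "\<exists>h. \<forall>x. (h has_vector_derivative \<psi> x) (at x)"
    proof -
      \<comment> \<open>For either sign of x one of the two integrals runs over an empty interval or
        a point and is 0; what remains is the signed integral from 0.\<close>
      define h where "h x = integral {0..x} \<psi> - integral {x..0} \<psi>" for x
      have i: "\<psi> integrable_on {u..v}" for u v
        by (rule integrable_continuous_real[OF test_function_continuous[OF \<psi>]])
      have "(h has_vector_derivative \<psi> x) (at x)" for x
      proof -
        define c where "c = - \<bar>x\<bar> - 1"
        have c0: "c \<le> 0" by (simp add: c_def)
        have e: "h y = integral {c..y} \<psi> - integral {c..0} \<psi>" if "y \<in> {c<..}" for y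
        proof (cases "0 \<le> y")
          case True
          have "integral {y..0} \<psi> = 0" using True by (cases "y = 0") auto
          with True show ?thesis
            using Henstock_Kurzweil_Integration.integral_combine[OF c0 True i] by (simp add: h_def)
        next
          case False
          have "integral {0..y} \<psi> = 0" using False by auto
          then show ?thesis
            using False that Henstock_Kurzweil_Integration.integral_combine[of c y 0 \<psi>] i by (auto simp: h_def)
        qed
        have "((\<lambda>u. integral {c..u} \<psi>) has_vector_derivative \<psi> x) (at x within {c..\<bar>x\<bar>+1})"
          by (rule integral_has_vector_derivative[OF test_function_continuous[OF \<psi>]]) (auto simp: c_def)
        then have "((\<lambda>u. integral {c..u} \<psi>) has_vector_derivative \<psi> x) (at x)"
          by (subst (asm) at_within_Icc_at) (auto simp: c_def)
        then have "((\<lambda>u. integral {c..u} \<psi> - integral {c..0} \<psi>) has_vector_derivative \<psi> x) (at x)"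
          by (simp add: has_vector_derivative_diff_const)
        then show ?thesis
          by (rule has_vector_derivative_transform_within_open[where S = "{c<..}"]) (auto simp: e c_def)
      qed
      then show ?thesis by blast
    qed
    then show ?thesis using that has_real_derivative_iff_has_vector_derivative by blast
  qed
  define \<phi> where "\<phi> x = \<Phi> x - \<Phi> 0" for x
  have d: "(\<phi> has_field_derivative \<psi> x) (at x)" for x
    unfolding \<phi>_def using \<Phi>[of x] by (auto intro!: derivative_eq_intros)
  have dd: "deriv \<phi> = \<psi>" using d by (intro ext DERIV_imp_deriv)
  have const: "\<phi> u = \<phi> v" if "u \<le> v" "{u<..<v} \<inter> {a..b} = {}" for u v
  proof (cases "u = v")
    case False
    with that have uv: "u < v" by simp
    have "continuous_on {u..v} \<phi>"
      by (rule DERIV_continuous_on) (rule has_field_derivative_at_within[OF d])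
    moreover have "(\<phi> has_real_derivative 0) (at x)" if "u < x" "x < v" for x
      using d[of x] s[of x] that \<open>{u<..<v} \<inter> {a..b} = {}\<close> by fastforce
    ultimately show ?thesis using DERIV_isconst2[OF uv, of \<phi> v] uv by simp
  qed auto
  have "(\<psi> has_integral \<phi> 1 - \<phi> 0) {0..1}"
    by (intro fundamental_theorem_of_calculus)
       (auto intro!: has_field_derivative_at_within d simp flip: has_real_derivative_iff_has_vector_derivative)
  then have 1: "\<phi> 1 = \<phi> 0" using z by (simp add: integral_unique)
  have 0: "\<phi> 0 = 0" by (simp add: \<phi>_def)
  have "\<phi> x = 0" if out: "x \<notin> {a..b}" for x
  proof -
    consider "x < a" | "x > b" using out by fastforce
    then show ?thesis
    proof cases
      assume 1: "x < a"
      then have "{x<..<0} \<inter> {a..b} = {}" "{0<..<x} \<inter> {a..b} = {}" using ab by auto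
      then have "\<phi> x = \<phi> 0" using const[of x 0] const[of 0 x] by linarith
      then show ?thesis using 0 by simp
    next
      assume "x > b"
      then have "{x<..<1} \<inter> {a..b} = {}" "{1<..<x} \<inter> {a..b} = {}" using ab by auto
      then have "\<phi> x = \<phi> 1" using const[of x 1] const[of 1 x] by linarith
      then show ?thesis using 0 1 by simp
    qed
  qed
  moreover have "Ck k \<phi>" for k
    using test_function_Ck[OF \<psi>] d dd by (cases k) (auto simp: field_differentiable_def)
  ultimately have "test_function \<phi>" unfolding test_function_iff using ab by blast
  then show ?thesis using dd that by blast
qed


section \<open>From the Lebesgue measure on (0,1) to gauge integrals on [0,1], and uniqueness of
  weak derivatives\<close>

lemma unit_integrable_iff:
  fixes f :: "real \<Rightarrow> 'a::euclidean_space"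
  shows "integrable unit_measure f \<longleftrightarrow> f absolutely_integrable_on {0..1}"
  using absolutely_integrable_on_Icc_iff_Ioo[where f = f and a = 0 and b = 1]
    integrable_restrict_space[where \<Omega> = "{0<..<1::real}" and M = lebesgue and f = f]
  by (simp add: set_integrable_def)

lemma unit_integral_eq:
  fixes f :: "real \<Rightarrow> 'a::euclidean_space"
  assumes "f absolutely_integrable_on {0..1}"
  shows "(\<integral>x. f x \<partial>unit_measure) = integral {0..1} f"
proof -
  have "(\<integral>x. f x \<partial>unit_measure) = integral {0<..<1} f"
    by (rule lebesgue_integral_eq_integral) (use assms unit_integrable_iff in auto)
  then show ?thesis by (simp add: integral_open_interval_real)
qed

lemma unit_AE_iff: "(AE x in unit_measure. P x) \<longleftrightarrow> negligible {x \<in> {0<..<1}. \<not> P x}"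
proof -
  have "(AE x in unit_measure. P x) \<longleftrightarrow> (AE x in lebesgue. x \<in> {0<..<1} \<longrightarrow> P x)"
    by (subst AE_restrict_space_iff) auto
  also have "\<dots> \<longleftrightarrow> (\<exists>N\<in>null_sets lebesgue. {x. \<not> (x \<in> {0<..<1} \<longrightarrow> P x)} \<subseteq> N)"
    by (auto simp: eventually_ae_filter)
  also have "\<dots> \<longleftrightarrow> negligible {x \<in> {0<..<1}. \<not> P x}" (is "?L \<longleftrightarrow> ?R")
  proof
    assume ?L
    then obtain N where N: "negligible N" "{x. \<not> (x \<in> {0<..<1} \<longrightarrow> P x)} \<subseteq> N"
      unfolding negligible_iff_null_sets by blast
    show ?R by (rule negligible_subset[OF N(1)]) (use N(2) in auto)
  next
    assume ?R
    then show ?L unfolding negligible_iff_null_sets by (rule bexI[rotated]) auto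
  qed
  finally show ?thesis .
qed

lemma unit_AE_obtain:
  assumes "AE x in unit_measure. P x"
  obtains N where "negligible N" "\<And>x. x \<in> {0..1} - N \<Longrightarrow> P x"
proof
  show "negligible ({x \<in> {0<..<1}. \<not> P x} \<union> {0, 1})"
    using assms unfolding unit_AE_iff by (intro negligible_Un) auto
qed auto

text \<open>The set in (0,1) where \<open>F\<close> and \<open>G\<close> differ is open and
  negligible, hence empty. Closedness of the coincidence set then carries equality to 0 and 1, which
  no almost-everywhere statement can see.\<close>

lemma continuous_AE_eq:
  fixes F G :: "real \<Rightarrow> 'a::t2_space"
  assumes F: "continuous_on {0..1} F" and G: "continuous_on {0..1} G"
    and AE: "AE x in unit_measure. F x = G x" and x: "x \<in> {0..1}"
  shows "F x = G x"
proof -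
  let ?E = "{x \<in> {0..1}. F x = G x}"
  have cl: "closed ?E"
  proof -
    have "continuous_on {0..1} (\<lambda>x. (F x, G x))" using F G by (intro continuous_intros)
    then have "closed ({0..1} \<inter> (\<lambda>x. (F x, G x)) -` {y. \<exists>x. y = (x, x)})"
      by (intro continuous_closed_preimage closed_diagonal) auto
    then show ?thesis by (rule back_subst[where P = closed]) auto
  qed
  have "{x \<in> {0<..<1}. \<not> F x = G x} = {0<..<1} - ?E" by auto
  then have "open {x \<in> {0<..<1}. \<not> F x = G x}" using cl by (simp add: open_Diff)
  moreover have "negligible {x \<in> {0<..<1}. \<not> F x = G x}" using AE unfolding unit_AE_iff .
  ultimately have "{x \<in> {0<..<1}. \<not> F x = G x} = {}" using open_not_negligible by blast
  then have "{0<..<1} \<subseteq> ?E" by auto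
  then have "closure {0<..<1} \<subseteq> ?E" using cl by (rule closure_minimal)
  then show ?thesis using x by auto
qed

text \<open>Uniqueness of the continuous representative lets the \<open>SOME\<close> in
  \<open>cont_rep\<close> be evaluated, endpoints included.\<close>

lemma cont_rep_eq:
  fixes F :: "real \<Rightarrow> 'a::t2_space"
  assumes F: "continuous_on {0..1} F" and AE: "AE x in unit_measure. f x = F x" and x: "x \<in> {0..1}"
  shows "cont_rep f x = F x"
proof -
  have "continuous_on {0..1} (cont_rep f) \<and> (AE x in unit_measure. f x = cont_rep f x)"
    unfolding cont_rep_def by (rule someI[where x = F]) (use F AE in blast)
  then show ?thesis
    using AE by (intro continuous_AE_eq[OF _ F _ x]) (auto elim: eventually_elim2)
qed

lemma absolutely_integrable_test_scaleR:
  fixes f :: "real \<Rightarrow> 'a::euclidean_space"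
  assumes "test_function \<phi>" "f absolutely_integrable_on {0..1}"
  shows "(\<lambda>x. \<phi> x *\<^sub>R f x) absolutely_integrable_on {0..1}"
  by (rule continuous_bilinear_absolutely_integrable
      [OF bounded_bilinear_scaleR test_function_continuous[OF assms(1)] assms(2)])

lemma has_weak_deriv_iff:
  fixes f :: "real \<Rightarrow> 'a::euclidean_space"
  shows "has_weak_deriv m f g \<longleftrightarrow> f absolutely_integrable_on {0..1} \<and> g absolutely_integrable_on {0..1} \<and>
    (\<forall>\<phi>. test_function \<phi> \<longrightarrow>
       integral {0..1} (\<lambda>x. (deriv ^^ m) \<phi> x *\<^sub>R f x) = (-1) ^ m *\<^sub>R integral {0..1} (\<lambda>x. \<phi> x *\<^sub>R g x))"
proof (cases "f absolutely_integrable_on {0..1} \<and> g absolutely_integrable_on {0..1}")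
  case True
  then have "(\<integral>x. (deriv ^^ m) \<phi> x *\<^sub>R f x \<partial>unit_measure) = integral {0..1} (\<lambda>x. (deriv ^^ m) \<phi> x *\<^sub>R f x)"
    "(\<integral>x. \<phi> x *\<^sub>R g x \<partial>unit_measure) = integral {0..1} (\<lambda>x. \<phi> x *\<^sub>R g x)"
    if "test_function \<phi>" for \<phi>
    by (intro unit_integral_eq absolutely_integrable_test_scaleR test_function_higher_deriv that; simp)+
  then show ?thesis
    unfolding has_weak_deriv_def unit_integrable_iff by simp
next
  case False
  then show ?thesis
    unfolding has_weak_deriv_def unit_integrable_iff by blast
qed

lemma test_by_parts:
  fixes F :: "real \<Rightarrow> 'a::euclidean_space"
  assumes \<phi>: "test_function \<phi>" and F: "prim F g"
  shows "integral {0..1} (\<lambda>x. deriv \<phi> x *\<^sub>R F x) = - integral {0..1} (\<lambda>x. \<phi> x *\<^sub>R g x)"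
proof -
  have P: "prim (\<lambda>x. \<phi> x *\<^sub>R F x) (\<lambda>x. deriv \<phi> x *\<^sub>R F x + \<phi> x *\<^sub>R g x)"
    by (rule prim_scaleR[OF test_function_prim[OF \<phi>] F])
  have "((\<lambda>x. deriv \<phi> x *\<^sub>R F x + \<phi> x *\<^sub>R g x) has_integral 0) {0..1}"
    using prim_has_integral[OF P, of 0 1] test_function_ends[OF \<phi>] by simp
  moreover have i: "(\<lambda>x. deriv \<phi> x *\<^sub>R F x) integrable_on {0..1}"
    by (intro integrable_continuous_real continuous_intros prim_continuous[OF F]
        test_function_continuous test_function_deriv \<phi>)
  moreover have "(\<lambda>x. \<phi> x *\<^sub>R g x) integrable_on {0..1}"
    by (rule set_lebesgue_integral_eq_integral(1)[OF absolutely_integrable_test_scaleR[OF \<phi> prim_abs[OF F]]])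
  ultimately have "0 = integral {0..1} (\<lambda>x. deriv \<phi> x *\<^sub>R F x) + integral {0..1} (\<lambda>x. \<phi> x *\<^sub>R g x)"
    by (simp add: integral_add[symmetric] integral_unique)
  then show ?thesis by (simp add: eq_neg_iff_add_eq_0)
qed

text \<open>Lebesgue differentiation: outside a negligible set the averages over [x, x+h] converge
  to f x, and for small h they are all 0.\<close>

lemma integral_zero_imp_AE_zero:
  fixes f :: "real \<Rightarrow> 'a::euclidean_space"
  assumes f: "f absolutely_integrable_on {0..1}"
    and z: "\<And>a b. \<lbrakk>0 < a; a < b; b < 1\<rbrakk> \<Longrightarrow> integral {a..b} f = 0"
  shows "AE x in unit_measure. f x = 0"
proof -
  define F where "F x = (if x \<in> {0..1} then f x else 0)" for x
  have "F absolutely_integrable_on UNIV"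
    using f absolutely_integrable_restrict_UNIV[of "{0..1}" f] unfolding F_def by blast
  then have "F integrable_on UNIV" using set_lebesgue_integral_eq_integral(1) by blast
  then have "F integrable_on cbox a b" for a b
    using integrable_on_subcbox by blast
  then obtain N where N: "negligible N" and
    e: "\<And>x e. \<lbrakk>x \<notin> N; 0 < e\<rbrakk> \<Longrightarrow>
               \<exists>d>0. \<forall>h. 0 < h \<and> h < d \<longrightarrow>
                         norm(integral (cbox x (x + h *\<^sub>R One)) F /\<^sub>R h ^ DIM(real) - F x) < e"
    using integrable_ccontinuous_explicit by blast
  have "f x = 0" if x: "x \<in> {0<..<1}" "x \<notin> N" for x
  proof (rule ccontr)
    assume "f x \<noteq> 0"
    then obtain d where "d > 0" and
      d: "\<And>h. 0 < h \<and> h < d \<Longrightarrow> norm(integral (cbox x (x + h *\<^sub>R One)) F /\<^sub>R h ^ DIM(real) - F x) < norm (f x)"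
      using e[OF x(2), of "norm (f x)"] by auto
    define h where "h = min (d / 2) ((1 - x) / 2)"
    have h: "0 < h" "h < d" "x + h < 1" using \<open>d > 0\<close> x by (auto simp: h_def min_def field_simps)
    have "integral {x..x + h} F = integral {x..x + h} f"
      by (rule integral_cong) (use h x in \<open>auto simp: F_def\<close>)
    also have "\<dots> = 0" using h x by (intro z) auto
    finally have "norm (F x) < norm (f x)" using d[of h] h by simp
    then show False using x by (simp add: F_def)
  qed
  then have "{x \<in> {0<..<1}. \<not> f x = 0} \<subseteq> N" by auto
  then show ?thesis unfolding unit_AE_iff using N negligible_subset by blast
qed

text \<open>The fundamental lemma of the calculus of variations. The bumps on (a,b) are bounded by 1
  and converge to the indicator, so dominated convergence turns vanishing against test functions
  into vanishing integrals over all subintervals.\<close>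

lemma test_zero_imp_AE_zero:
  fixes f :: "real \<Rightarrow> 'a::euclidean_space"
  assumes f: "f absolutely_integrable_on {0..1}"
    and z: "\<And>\<phi>. test_function \<phi> \<Longrightarrow> integral {0..1} (\<lambda>x. \<phi> x *\<^sub>R f x) = 0"
  shows "AE x in unit_measure. f x = 0"
proof (rule integral_zero_imp_AE_zero[OF f])
  fix a b :: real assume ab: "0 < a" "a < b" "b < 1"
  define \<phi> where "\<phi> n = bump (real (Suc n)) a b" for n
  have t: "test_function (\<phi> n)" for n using ab by (simp add: \<phi>_def test_bump)
  have fi: "integrable unit_measure f" using f unit_integrable_iff by blast
  have lim: "(\<lambda>n. \<phi> n x) \<longlonglongrightarrow> indicator {a<..<b} x" for x
  proof (cases "x \<in> {a<..<b}")
    case True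
    have "(\<lambda>n. exp (- (1 / (x - a) * inverse (real (Suc n)))) * exp (- (1 / (b - x) * inverse (real (Suc n))))) 
      \<longlonglongrightarrow> exp (- (1 / (x - a) * 0)) * exp (- (1 / (b - x) * 0))"
      by (intro tendsto_intros LIMSEQ_inverse_real_of_nat)
    then show ?thesis using True
      by (simp add: \<phi>_def bump_eq field_simps)
  qed (auto simp: \<phi>_def bump_eq)
  have le1: "\<bar>\<phi> n x\<bar> \<le> 1" for n x
  proof -
    have "exp (- (1 / (real (Suc n) * (x - a)))) * exp (- (1 / (real (Suc n) * (b - x)))) \<le> 1 * 1"
      if "a < x" "x < b" using that by (intro mult_mono) auto
    then show ?thesis by (auto simp: \<phi>_def bump_eq)
  qed
  have "(\<lambda>n. \<integral>x. \<phi> n x *\<^sub>R f x \<partial>unit_measure) \<longlonglongrightarrow> (\<integral>x. indicator {a<..<b} x *\<^sub>R f x \<partial>unit_measure)"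
  proof (rule integral_dominated_convergence[where w = "\<lambda>x. norm (f x)"])
    show "integrable unit_measure (\<lambda>x. norm (f x))" using fi by simp
    have fm: "f \<in> borel_measurable unit_measure" using fi by simp
    show "(\<lambda>x. \<phi> n x *\<^sub>R f x) \<in> borel_measurable unit_measure" for n
      using absolutely_integrable_test_scaleR[OF t f, of n]
      by (intro borel_measurable_integrable) (simp only: unit_integrable_iff)
    have "{a<..<b} \<inter> {0<..<1} = {a<..<b}" using ab by auto
    then have "{a<..<b} \<in> sets unit_measure"
      using ab by (auto simp: sets_restrict_space image_iff intro!: bexI[of _ "{a<..<b}"])
    then show "(\<lambda>x. indicator {a<..<b} x *\<^sub>R f x) \<in> borel_measurable unit_measure"
      using fm by (intro borel_measurable_scaleR borel_measurable_indicator) auto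
    show "AE x in unit_measure. (\<lambda>n. \<phi> n x *\<^sub>R f x) \<longlonglongrightarrow> indicator {a<..<b} x *\<^sub>R f x"
      using lim by (intro always_eventually allI tendsto_intros)
    show "AE x in unit_measure. norm (\<phi> n x *\<^sub>R f x) \<le> norm (f x)" for n
      using le1 by (intro always_eventually allI) (auto intro: mult_left_le_one_le)
  qed
  moreover have "(\<integral>x. \<phi> n x *\<^sub>R f x \<partial>unit_measure) = 0" for n
    using z[OF t] unit_integral_eq[OF absolutely_integrable_test_scaleR[OF t f]] by simp
  ultimately have "(\<integral>x. indicator {a<..<b} x *\<^sub>R f x \<partial>unit_measure) = 0"
    by (simp add: tendsto_const_iff)
  moreover have "(\<integral>x. indicator {a<..<b} x *\<^sub>R f x \<partial>unit_measure) = integral {a..b} f"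
  proof -
    have "(\<integral>x. indicator {a<..<b} x *\<^sub>R f x \<partial>unit_measure) = (\<integral>x. f x \<partial>lebesgue_on {a<..<b})"
    proof -
      have "(\<integral>x. indicator {a<..<b} x *\<^sub>R f x \<partial>unit_measure) =
          (\<integral>x. indicator {0<..<1} x *\<^sub>R indicator {a<..<b} x *\<^sub>R f x \<partial>lebesgue)"
        by (rule integral_restrict_space) simp
      also have "(\<lambda>x. indicator {0<..<1} x *\<^sub>R indicator {a<..<b} x *\<^sub>R f x) = (\<lambda>x. indicator {a<..<b} x *\<^sub>R f x)"
        using ab by (auto simp: indicator_def fun_eq_iff)
      also have "(\<integral>x. indicator {a<..<b} x *\<^sub>R f x \<partial>lebesgue) = (\<integral>x. f x \<partial>lebesgue_on {a<..<b})"
        by (rule integral_restrict_space[symmetric]) simp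
      finally show ?thesis .
    qed
    also have "\<dots> = integral {a<..<b} f"
    proof (rule lebesgue_integral_eq_integral)
      have "f absolutely_integrable_on {a..b}"
        by (rule absolutely_integrable_on_subinterval[OF f]) (use ab in auto)
      then have "f absolutely_integrable_on {a<..<b}"
        by (simp add: absolutely_integrable_on_Icc_iff_Ioo)
      then show "integrable (lebesgue_on {a<..<b}) f"
        by (rule absolutely_integrable_imp_integrable) auto
    qed auto
    finally show ?thesis by (simp add: integral_open_interval_real)
  qed
  ultimately show "integral {a..b} f = 0" by simp
qed

lemma has_weak_deriv_unique:
  fixes f :: "real \<Rightarrow> 'a::euclidean_space"
  assumes "has_weak_deriv m f g" "has_weak_deriv m f h"
  shows "AE x in unit_measure. g x = h x"
proof -
  have gh: "g absolutely_integrable_on {0..1}" "h absolutely_integrable_on {0..1}"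
    using assms by (auto simp: has_weak_deriv_iff)
  have "AE x in unit_measure. g x - h x = 0"
  proof (rule test_zero_imp_AE_zero)
    show "(\<lambda>x. g x - h x) absolutely_integrable_on {0..1}" using gh by (rule set_integral_diff)
    fix \<phi> assume \<phi>: "test_function \<phi>"
    have i: "(\<lambda>x. \<phi> x *\<^sub>R g x) integrable_on {0..1}" "(\<lambda>x. \<phi> x *\<^sub>R h x) integrable_on {0..1}"
      by (intro set_lebesgue_integral_eq_integral(1) absolutely_integrable_test_scaleR \<phi> gh)+
    have "(-1) ^ m *\<^sub>R integral {0..1} (\<lambda>x. \<phi> x *\<^sub>R g x) = (-1) ^ m *\<^sub>R integral {0..1} (\<lambda>x. \<phi> x *\<^sub>R h x)"
    proof -
      have "integral {0..1} (\<lambda>x. (deriv ^^ m) \<phi> x *\<^sub>R f x) = (-1) ^ m *\<^sub>R integral {0..1} (\<lambda>x. \<phi> x *\<^sub>R g x)"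
        "integral {0..1} (\<lambda>x. (deriv ^^ m) \<phi> x *\<^sub>R f x) = (-1) ^ m *\<^sub>R integral {0..1} (\<lambda>x. \<phi> x *\<^sub>R h x)"
        using assms \<phi> unfolding has_weak_deriv_iff by blast+
      then show ?thesis by simp
    qed
    then have "integral {0..1} (\<lambda>x. \<phi> x *\<^sub>R g x) = integral {0..1} (\<lambda>x. \<phi> x *\<^sub>R h x)" by simp
    then show "integral {0..1} (\<lambda>x. \<phi> x *\<^sub>R (g x - h x)) = 0"
      using i by (simp add: scaleR_diff_right integral_diff)
  qed
  then show ?thesis by simp
qed

lemma obtain_unit_test_function:
  obtains \<omega> where "test_function \<omega>" "integral {0..1} \<omega> = 1"
proof -
  have t: "test_function (bump 1 (1/3) (2/3))" by (intro test_bump) auto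
  let ?I = "integral {0..1} (bump 1 (1/3) (2/3))"
  have c: "continuous_on {0..1} (bump 1 (1/3) (2/3))" by (rule test_function_continuous[OF t])
  have "?I \<noteq> 0"
  proof
    assume I: "?I = 0"
    have "bump 1 (1/3) (2/3) x \<ge> 0" for x by (simp add: bump_eq)
    then have "\<forall>x\<in>{0..1}. bump 1 (1/3) (2/3) x = 0"
      using I integral_eq_0_iff[OF c zero_less_one] by blast
    then have "bump 1 (1/3) (2/3) (1/2) = 0" by (rule bspec) simp
    then show False by (simp add: bump_eq)
  qed
  define \<omega> where "\<omega> x = 0 - (- 1 / ?I) * bump 1 (1/3) (2/3) x" for x
  \<comment> \<open>Closure is available for combinations f - c g only, so the zero function is
    produced as the bump minus itself.\<close>
  have "test_function (\<lambda>x. (bump 1 (1/3) (2/3) x - 1 * bump 1 (1/3) (2/3) x) - (- 1 / ?I) * bump 1 (1/3) (2/3) x)"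
    by (intro test_function_comb t)
  then have "test_function \<omega>"
    by (rule back_subst[where P = test_function]) (simp add: \<omega>_def fun_eq_iff)
  moreover have "integral {0..1} \<omega> = 1"
  proof -
    have "integral {0..1} \<omega> = integral {0..1} (\<lambda>x. (1 / ?I) * bump 1 (1/3) (2/3) x)"
      by (rule integral_cong) (simp add: \<omega>_def)
    also have "\<dots> = (1 / ?I) * ?I" by (rule integral_mult_right)
    finally show ?thesis using \<open>?I \<noteq> 0\<close> by simp
  qed
  ultimately show ?thesis by (rule that)
qed

text \<open>Testing against primitives of test functions of the form \<open>\<psi> - (\<integral>\<psi>) \<omega>\<close>, where \<open>\<omega>\<close> has integral 1,
  lowers the order by one.\<close>

lemma has_weak_deriv_imp_chain:
  fixes f :: "real \<Rightarrow> 'a::euclidean_space"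
  assumes "has_weak_deriv m f g"
  shows "\<exists>F::nat \<Rightarrow> real \<Rightarrow> 'a. (AE x in unit_measure. f x = F 0 x) \<and>
           (\<forall>j<m. prim (F j) (F (Suc j))) \<and> F m = g"
  using assms
proof (induction m arbitrary: g)
  case 0
  have "has_weak_deriv 0 f f" using 0 by (simp add: has_weak_deriv_def)
  then have "AE x in unit_measure. f x = g x" using 0 by (rule has_weak_deriv_unique)
  then show ?case by (intro exI[of _ "\<lambda>_. g"]) auto
next
  case (Suc m)
  have fa: "f absolutely_integrable_on {0..1}" and ga: "g absolutely_integrable_on {0..1}"
    and W: "\<And>\<phi>. test_function \<phi> \<Longrightarrow> integral {0..1} (\<lambda>x. (deriv ^^ Suc m) \<phi> x *\<^sub>R f x) =
        (-1) ^ Suc m *\<^sub>R integral {0..1} (\<lambda>x. \<phi> x *\<^sub>R g x)"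
    using Suc.prems unfolding has_weak_deriv_iff by auto
  define G where "G x = integral {0..x} g" for x
  have G: "prim G g" using ga by (simp add: prim_def G_def)
  obtain \<omega> where \<omega>: "test_function \<omega>" "integral {0..1} \<omega> = 1" by (rule obtain_unit_test_function)
  define A where "A \<psi> = integral {0..1} (\<lambda>x. (deriv ^^ m) \<psi> x *\<^sub>R f x)" for \<psi>
  define B where "B \<psi> = integral {0..1} (\<lambda>x. \<psi> x *\<^sub>R G x)" for \<psi>
  \<comment> \<open>The constant of integration, read off by testing with \<omega>: it makes
    \<open>A \<omega> = (-1) ^ m *\<^sub>R (B \<omega> + c)\<close> true.\<close>
  define c where "c = (-1) ^ m *\<^sub>R A \<omega> - B \<omega>"
  have iA: "(\<lambda>x. (deriv ^^ m) \<psi> x *\<^sub>R f x) integrable_on {0..1}" if "test_function \<psi>" for \<psi>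
    by (rule set_lebesgue_integral_eq_integral(1)
        [OF absolutely_integrable_test_scaleR[OF test_function_higher_deriv[OF that] fa]])
  have iB: "(\<lambda>x. \<psi> x *\<^sub>R G x) integrable_on {0..1}" if "test_function \<psi>" for \<psi>
    by (intro integrable_continuous_real continuous_intros prim_continuous[OF G]
        test_function_continuous that)
  have key: "A \<psi> = (-1) ^ m *\<^sub>R (B \<psi> + integral {0..1} \<psi> *\<^sub>R c)" if \<psi>: "test_function \<psi>" for \<psi>
  proof -
    define I where "I = integral {0..1} \<psi>"
    define \<eta> where "\<eta> x = \<psi> x - I * \<omega> x" for x
    have \<eta>: "test_function \<eta>" unfolding \<eta>_def by (rule test_function_comb[OF \<psi> \<omega>(1)])
    have i\<psi>: "\<psi> integrable_on {0..1}" "\<omega> integrable_on {0..1}"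
      by (intro integrable_continuous_real test_function_continuous \<psi> \<omega>)+
    have "integral {0..1} \<eta> = 0"
      using integral_diff[OF i\<psi>(1) integrable_cmul[OF i\<psi>(2), of I]] \<omega>(2)
      by (simp add: I_def \<eta>_def[abs_def])
    then obtain \<phi> where \<phi>: "test_function \<phi>" "deriv \<phi> = \<eta>"
      using test_function_antiderivative[OF \<eta>] by blast
    have "A \<eta> = (-1) ^ Suc m *\<^sub>R integral {0..1} (\<lambda>x. \<phi> x *\<^sub>R g x)"
      using W[OF \<phi>(1)] \<phi>(2) by (simp add: A_def funpow_swap1)
    also have "integral {0..1} (\<lambda>x. \<phi> x *\<^sub>R g x) = - B \<eta>"
      using test_by_parts[OF \<phi>(1) G] \<phi>(2) by (simp add: B_def)
    finally have 1: "A \<eta> = (-1) ^ m *\<^sub>R B \<eta>" by simp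
    have "(deriv ^^ m) \<eta> = (\<lambda>x. (deriv ^^ m) \<psi> x - I * (deriv ^^ m) \<omega> x)"
      unfolding \<eta>_def by (rule higher_deriv_comb) (auto intro: test_function_Ck \<psi> \<omega>)
    then have 2: "A \<eta> = A \<psi> - I *\<^sub>R A \<omega>"
      using integral_diff[OF iA[OF \<psi>] integrable_cmul[OF iA[OF \<omega>(1)], of I]]
      by (simp only: A_def scaleR_diff_left scaleR_scaleR[symmetric] integral_cmul)
    have 3: "B \<eta> = B \<psi> - I *\<^sub>R B \<omega>"
      using integral_diff[OF iB[OF \<psi>] integrable_cmul[OF iB[OF \<omega>(1)], of I]]
      by (simp only: B_def \<eta>_def scaleR_diff_left scaleR_scaleR[symmetric] integral_cmul)
    have "(-1) ^ m * (-1) ^ m = (1::real)" by (simp flip: power_mult_distrib)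
    then have s: "(-1) ^ m *\<^sub>R (-1) ^ m *\<^sub>R x = x" for x :: 'a
      unfolding scaleR_scaleR by simp
    have "A \<psi> = A \<eta> + I *\<^sub>R A \<omega>" using 2 by simp
    then have "A \<psi> = (-1) ^ m *\<^sub>R (B \<psi> - I *\<^sub>R B \<omega>) + I *\<^sub>R A \<omega>" by (simp only: 1 3)
    also have "\<dots> = (-1) ^ m *\<^sub>R (B \<psi> - I *\<^sub>R B \<omega>) + (-1) ^ m *\<^sub>R (-1) ^ m *\<^sub>R I *\<^sub>R A \<omega>"
      by (simp only: s)
    also have "\<dots> = (-1) ^ m *\<^sub>R (B \<psi> + I *\<^sub>R c)"
      by (simp add: c_def scaleR_diff_right scaleR_add_right scaleR_left_commute)
    finally show ?thesis by (simp add: I_def)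
  qed
  have "has_weak_deriv m f (\<lambda>x. G x + c)"
    unfolding has_weak_deriv_iff
  proof (intro conjI allI impI fa)
    show "(\<lambda>x. G x + c) absolutely_integrable_on {0..1}"
      by (intro absolutely_integrable_continuous_real continuous_intros prim_continuous[OF G])
    fix \<psi> assume \<psi>: "test_function \<psi>"
    have i: "\<psi> integrable_on {0..1}"
      by (intro integrable_continuous_real test_function_continuous \<psi>)
    then have "((\<lambda>x. \<psi> x *\<^sub>R c) has_integral integral {0..1} \<psi> *\<^sub>R c) {0..1}"
      using has_integral_linear[OF integrable_integral[OF i] bounded_linear_scaleR_left] by (simp add: o_def)
    then have "integral {0..1} (\<lambda>x. \<psi> x *\<^sub>R (G x + c)) = B \<psi> + integral {0..1} \<psi> *\<^sub>R c"
      using has_integral_add[OF integrable_integral[OF iB[OF \<psi>]]]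
      by (simp add: scaleR_add_right B_def integral_unique)
    then show "integral {0..1} (\<lambda>x. (deriv ^^ m) \<psi> x *\<^sub>R f x) =
        (- 1) ^ m *\<^sub>R integral {0..1} (\<lambda>x. \<psi> x *\<^sub>R (G x + c))"
      using key[OF \<psi>] by (simp add: A_def)
  qed
  from Suc.IH[OF this] obtain F :: "nat \<Rightarrow> real \<Rightarrow> 'a" where
    F: "AE x in unit_measure. f x = F 0 x" "\<And>j. j < m \<Longrightarrow> prim (F j) (F (Suc j))" "F m = (\<lambda>x. G x + c)"
    by blast
  have "prim (\<lambda>x. G x + c) g"
    using prim_add[OF G prim_const[of c]] by simp
  then show ?case
    using F by (intro exI[of _ "F(Suc m := g)"]) (auto simp: less_Suc_eq)
qed

text \<open>Integration by parts \<open>m\<close> times; the boundary terms vanish because test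
  functions and their derivatives are 0 at both ends. Passing from \<open>f\<close> to
  \<open>F 0\<close> alters integrands on a negligible set only.\<close>

lemma chain_imp_has_weak_deriv:
  fixes f :: "real \<Rightarrow> 'a::euclidean_space" and F :: "nat \<Rightarrow> real \<Rightarrow> 'a"
  assumes F: "\<And>j. j < m \<Longrightarrow> prim (F j) (F (Suc j))"
    and f: "f absolutely_integrable_on {0..1}" "AE x in unit_measure. f x = F 0 x"
    and Fm: "F m absolutely_integrable_on {0..1}"
  shows "has_weak_deriv m f (F m)"
  unfolding has_weak_deriv_iff
proof (intro conjI allI impI f(1) Fm)
  fix \<phi> assume \<phi>: "test_function \<phi>"
  obtain N where N: "negligible N" "\<And>x. x \<in> {0..1} - N \<Longrightarrow> f x = F 0 x"
    using unit_AE_obtain[OF f(2)] by metis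
  have "integral {0..1} (\<lambda>x. (deriv ^^ m) \<phi> x *\<^sub>R f x) = integral {0..1} (\<lambda>x. (deriv ^^ m) \<phi> x *\<^sub>R F 0 x)"
    by (rule integral_spike[OF N(1)]) (use N(2) in auto)
  moreover have "integral {0..1} (\<lambda>x. (deriv ^^ j) \<phi> x *\<^sub>R F 0 x) = (-1) ^ j *\<^sub>R integral {0..1} (\<lambda>x. \<phi> x *\<^sub>R F j x)"
    if "j \<le> m" "test_function \<phi>" for j \<phi>
    using that
  proof (induction j arbitrary: \<phi>)
    case (Suc j)
    have "integral {0..1} (\<lambda>x. (deriv ^^ Suc j) \<phi> x *\<^sub>R F 0 x) =
        (-1) ^ j *\<^sub>R integral {0..1} (\<lambda>x. deriv \<phi> x *\<^sub>R F j x)"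
      using Suc.IH[of "deriv \<phi>"] Suc.prems test_function_deriv by (simp add: funpow_swap1)
    also have "integral {0..1} (\<lambda>x. deriv \<phi> x *\<^sub>R F j x) = - integral {0..1} (\<lambda>x. \<phi> x *\<^sub>R F (Suc j) x)"
      using Suc.prems by (intro test_by_parts F) auto
    finally show ?case by simp
  qed simp
  ultimately show "integral {0..1} (\<lambda>x. (deriv ^^ m) \<phi> x *\<^sub>R f x) = (-1) ^ m *\<^sub>R integral {0..1} (\<lambda>x. \<phi> x *\<^sub>R F m x)"
    using \<phi> by simp
qed

lemma weak_deriv_AE_eq:
  fixes f :: "real \<Rightarrow> 'a::euclidean_space"
  assumes "has_weak_deriv m f g"
  shows "AE x in unit_measure. weak_deriv m f x = g x"
proof -
  have "has_weak_deriv m f (weak_deriv m f)"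
    unfolding weak_deriv_def using assms by (rule someI[where P = "has_weak_deriv m f"])
  then show ?thesis using assms by (rule has_weak_deriv_unique)
qed

section \<open>The initial value problem\<close>

lemma prim_bound_power:
  assumes "prim F f" "0 \<le> x" "x \<le> 1" "\<And>t. \<lbrakk>0 \<le> t; t \<le> x\<rbrakk> \<Longrightarrow> norm (f t) \<le> B * t ^ n"
  shows "norm (F x - F 0) \<le> B * x ^ Suc n / real (Suc n)"
proof -
  have I: "((\<lambda>t. B * t ^ n) has_integral B * x ^ Suc n / real (Suc n)) {0..x}"
  proof -
    have d: "((\<lambda>t. B * t ^ Suc n / real (Suc n)) has_vector_derivative B * t ^ n) (at t within {0..x})" for t
      unfolding has_real_derivative_iff_has_vector_derivative[symmetric]
      by (auto intro!: derivative_eq_intros simp del: power_Suc)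
    show ?thesis
      using fundamental_theorem_of_calculus[OF assms(2) d] by simp
  qed
  note F = prim_has_integral[OF assms(1) order_refl assms(2,3)]
  show ?thesis
    using integral_norm_bound_integral[OF has_integral_integrable[OF F] has_integral_integrable[OF I]] assms(4)
      integral_unique[OF F] integral_unique[OF I] by simp
qed

lemma prim_bound:
  assumes "prim F f" "0 \<le> x" "x \<le> 1" "\<And>t. \<lbrakk>0 \<le> t; t \<le> x\<rbrakk> \<Longrightarrow> norm (f t) \<le> B"
  shows "norm (F x - F 0) \<le> B * x"
  using prim_bound_power[of F f x B 0] assms by simp

lemma prim_bound1:
  assumes "prim F f" "0 \<le> x" "x \<le> 1" "\<And>t. \<lbrakk>0 \<le> t; t \<le> 1\<rbrakk> \<Longrightarrow> norm (f t) \<le> B"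
  shows "norm (F x - F 0) \<le> B"
proof -
  have "norm (F x - F 0) \<le> B * x" using assms by (intro prim_bound) auto
  moreover have "0 \<le> B" using assms(4)[of 0] order_trans[OF norm_ge_zero] by auto
  ultimately show ?thesis using assms(2,3) mult_left_le by fastforce
qed

lemma prim_diff:
  assumes "prim F f" "prim G g"
  shows "prim (\<lambda>x. F x - G x) (\<lambda>x. f x - g x)"
  using prim_add[OF assms(1) prim_linear[OF assms(2) bounded_linear_minus[OF bounded_linear_ident]]] by simp

lemma prim_integral:
  assumes "continuous_on {0..1} f"
  shows "prim (\<lambda>x. integral {0..x} f) f"
  using assms by (auto simp: prim_def absolutely_integrable_continuous_real)

definition sol :: "(real \<Rightarrow> complex) \<Rightarrow> (real \<Rightarrow> complex) \<Rightarrow> (real \<Rightarrow> complex) \<Rightarrow> bool" where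
  "sol V y y' \<longleftrightarrow> prim y y' \<and> prim y' (\<lambda>x. V x * y x)"

text \<open>Picard iteration for the twice integrated equation: \<open>T f\<close> is the double
  integral of \<open>V f\<close>, and the iterates of a + b x are summed. The majorants C m^n x^n /
  n! give convergence together with the bound by exp m.\<close>

lemma sol_exists:
  assumes V: "continuous_on {0..1} V" and m: "\<And>x. \<lbrakk>0 \<le> x; x \<le> 1\<rbrakk> \<Longrightarrow> norm (V x) \<le> m"
  shows "\<exists>y y'. sol V y y' \<and> y 0 = a \<and> y' 0 = b \<and>
           (\<forall>x\<in>{0..1}. norm (y x) \<le> (norm a + norm b) * exp m)"
proof -
  have m0: "0 \<le> m" using m[of 0] order_trans[OF norm_ge_zero] by auto
  define J where "J f x = integral {0..x} (\<lambda>t. V t * f t)" for f x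
  define T where "T f x = integral {0..x} (J f)" for f x
  have J: "prim (J f) (\<lambda>t. V t * f t)" if "continuous_on {0..1} f" for f
    unfolding J_def using that V by (intro prim_integral continuous_intros)
  have T: "prim (T f) (J f)" if "continuous_on {0..1} f" for f
    unfolding T_def by (intro prim_integral prim_continuous[OF J[OF that]])
  have [simp]: "J f 0 = 0" "T f 0 = 0" for f by (auto simp: J_def T_def)
  define C where "C = norm a + norm b"
  define u where "u n = (T ^^ n) (\<lambda>x. a + b * of_real x)" for n
  have u0: "continuous_on {0..1} (\<lambda>x. a + b * of_real x)" by (intro continuous_intros)
  have uS: "u (Suc n) = T (u n)" for n by (simp add: u_def)
  have uc: "continuous_on {0..1} (u n)" for n
  proof (induction n)
    case 0 then show ?case using u0 by (simp add: u_def)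
  next
    case (Suc n) then show ?case unfolding uS by (rule prim_continuous[OF T])
  qed
  have ub: "norm (u n x) \<le> C * m ^ n / fact n * x ^ n" if "0 \<le> x" "x \<le> 1" for n x
    using that
  proof (induction n arbitrary: x)
    case 0
    have "norm (a + b * of_real x) \<le> norm a + norm b * \<bar>x\<bar>"
      by (rule order_trans[OF norm_triangle_ineq]) (simp add: norm_mult)
    also have "\<dots> \<le> C" unfolding C_def using 0 by (simp add: mult_left_le)
    finally show ?case by (simp add: u_def)
  next
    case (Suc n)
    let ?B = "C * m ^ n / fact n"
    have C0: "0 \<le> C" by (simp add: C_def)
    have Jb: "norm (J (u n) t) \<le> (m * ?B) * t ^ Suc n / real (Suc n)" if "0 \<le> t" "t \<le> 1" for t
    proof -
      have "norm (J (u n) t - J (u n) 0) \<le> (m * ?B) * t ^ Suc n / real (Suc n)"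
      proof (rule prim_bound_power[OF J[OF uc] that])
        fix s assume s: "0 \<le> s" "s \<le> t"
        have "norm (V s * u n s) \<le> m * (?B * s ^ n)"
          unfolding norm_mult using s that by (intro mult_mono m Suc.IH m0) auto
        then show "norm (V s * u n s) \<le> m * ?B * s ^ n" by (simp add: mult.assoc)
      qed
      then show ?thesis by simp
    qed
    \<comment> \<open>The inner integration alone gains the factor 1/(n+1); the outer one is merely
      bounded using x <= 1, which already suffices for factorial decay.\<close>
    have "norm (T (u n) x - T (u n) 0) \<le> ((m * ?B) * x ^ Suc n / real (Suc n)) * x"
    proof (rule prim_bound[OF T[OF uc] Suc.prems])
      fix t assume t: "0 \<le> t" "t \<le> x"
      have "norm (J (u n) t) \<le> (m * ?B) * t ^ Suc n / real (Suc n)" using Jb t Suc.prems by auto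
      also have "\<dots> \<le> (m * ?B) * x ^ Suc n / real (Suc n)"
        using t m0 C0 by (intro divide_right_mono mult_left_mono power_mono) auto
      finally show "norm (J (u n) t) \<le> (m * ?B) * x ^ Suc n / real (Suc n)" .
    qed
    also have "\<dots> \<le> (m * ?B) * x ^ Suc n / real (Suc n)"
      using Suc.prems m0 C0 by (intro mult_left_le) auto
    also have "\<dots> = C * m ^ Suc n / fact (Suc n) * x ^ Suc n"
      by (simp add: field_simps)
    finally show ?case by (simp add: uS)
  qed
  have ub1: "norm (u n x) \<le> C * (m ^ n /\<^sub>R fact n)" if "x \<in> {0..1}" for n x
  proof -
    have "norm (u n x) \<le> C * m ^ n / fact n * x ^ n" using ub that by auto
    also have "\<dots> \<le> C * m ^ n / fact n" using that m0 by (intro mult_left_le) (auto simp: C_def power_le_one)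
    finally show ?thesis by (simp add: divide_inverse mult_ac)
  qed
  have sm: "summable (\<lambda>n. C * (m ^ n /\<^sub>R fact n))"
    by (intro summable_mult summable_exp_generic)
  define y where "y x = (\<Sum>n. u n x)" for x
  have lim: "uniform_limit {0..1} (\<lambda>N x. \<Sum>n<N. u n x) y sequentially"
    unfolding y_def by (rule Weierstrass_m_test[OF ub1 sm])
  have Sc: "continuous_on {0..1} (\<lambda>x. \<Sum>n<N. u n x)" for N
    by (intro continuous_intros uc)
  have yc: "continuous_on {0..1} y"
    by (rule uniform_limit_theorem[OF always_eventually[OF allI[OF Sc]] lim]) simp
  \<comment> \<open>Partial sums satisfy the fixed point equation with N shifted by one; their
    uniform limit then satisfies it exactly.\<close>
  have Ssum: "(\<Sum>n<Suc N. u n x) = (a + b * of_real x) + T (\<lambda>x. \<Sum>n<N. u n x) x" if "x \<in> {0..1}" for N x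
  proof -
    have lin: "T (\<lambda>x. \<Sum>n<N. u n x) x = (\<Sum>n<N. T (u n) x)" if "x \<in> {0..1}" for x
      using that
    proof (induction N arbitrary: x)
      case 0 then show ?case by (simp add: T_def J_def[abs_def])
    next
      case (Suc N)
      let ?S = "\<lambda>x. \<Sum>n<N. u n x"
      have J1: "J (\<lambda>x. ?S x + u N x) t = J ?S t + J (u N) t" if "t \<in> {0..1}" for t
      proof -
        have "((\<lambda>s. V s * ?S s + V s * u N s) has_integral J ?S t + J (u N) t) {0..t}"
          using prim_has_integral[OF J[OF Sc], of 0 t N] prim_has_integral[OF J[OF uc], of 0 t N] that
          by (intro has_integral_add) auto
        then show ?thesis
          unfolding J_def[of "\<lambda>x. ?S x + u N x"] by (simp add: distrib_left integral_unique)
      qed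
      have "((\<lambda>s. J ?S s + J (u N) s) has_integral T ?S x + T (u N) x) {0..x}"
        using prim_has_integral[OF T[OF Sc], of 0 x N] prim_has_integral[OF T[OF uc], of 0 x N] Suc.prems
        by (intro has_integral_add) auto
      moreover have "T (\<lambda>x. ?S x + u N x) x = integral {0..x} (\<lambda>s. J ?S s + J (u N) s)"
        unfolding T_def by (rule integral_cong) (use J1 Suc.prems in auto)
      ultimately have "T (\<lambda>x. ?S x + u N x) x = T ?S x + T (u N) x"
        by (simp add: integral_unique)
      then show ?case using Suc by simp
    qed
    have "(\<Sum>n<Suc N. u n x) = u 0 x + (\<Sum>n<N. u (Suc n) x)" by (rule sum.lessThan_Suc_shift)
    then show ?thesis using lin[OF that] by (simp add: uS) (simp add: u_def)
  qed
  have fix1: "y x = (a + b * of_real x) + T y x" if x: "x \<in> {0..1}" for x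
  proof -
    have "(\<lambda>N. T (\<lambda>x. \<Sum>n<N. u n x) x) \<longlonglongrightarrow> T y x"
    proof (rule LIMSEQ_I)
      fix r :: real assume r: "0 < r"
      define e where "e = r / (2 * (m + 1))"
      have e: "e > 0" using r m0 by (simp add: e_def)
      have me: "m * e < r"
      proof -
        have "m * e \<le> (m + 1) * e" using e by (simp add: algebra_simps)
        also have "\<dots> = r / 2" using m0 by (simp add: e_def field_simps)
        finally show ?thesis using r by simp
      qed
      from uniform_limitD[OF lim e] obtain N0 where
        N0: "\<And>N x. \<lbrakk>N \<ge> N0; x \<in> {0..1}\<rbrakk> \<Longrightarrow> dist (\<Sum>n<N. u n x) (y x) < e"
        unfolding eventually_sequentially by blast
      have "norm (T (\<lambda>x. \<Sum>n<N. u n x) x - T y x) < r" if N: "N \<ge> N0" for N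
      proof -
        let ?S = "\<lambda>x. \<Sum>n<N. u n x"
        have j: "norm ((J ?S t - J y t) - (J ?S 0 - J y 0)) \<le> m * e" if t: "0 \<le> t" "t \<le> 1" for t
        proof (rule prim_bound1[OF prim_diff[OF J[OF Sc] J[OF yc]] t])
          fix s :: real assume s: "0 \<le> s" "s \<le> 1"
          have "norm (V s * ?S s - V s * y s) = norm (V s) * norm (?S s - y s)"
            by (simp add: norm_mult flip: right_diff_distrib)
          also have "\<dots> \<le> m * e"
            using N0[OF N, of s] s m m0 by (intro mult_mono) (auto simp: dist_norm)
          finally show "norm (V s * ?S s - V s * y s) \<le> m * e" .
        qed
        have "norm ((T ?S x - T y x) - (T ?S 0 - T y 0)) \<le> m * e"
          using x j by (intro prim_bound1[OF prim_diff[OF T[OF Sc] T[OF yc]]]) auto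
        then show ?thesis using me by simp
      qed
      then show "\<exists>no. \<forall>n\<ge>no. norm (T (\<lambda>x. \<Sum>n<n. u n x) x - T y x) < r" by blast
    qed
    then have "(\<lambda>N. (a + b * of_real x) + T (\<lambda>x. \<Sum>n<N. u n x) x) \<longlonglongrightarrow> (a + b * of_real x) + T y x"
      by (intro tendsto_intros)
    then have "(\<lambda>N. \<Sum>n<Suc N. u n x) \<longlonglongrightarrow> (a + b * of_real x) + T y x"
      by (simp only: Ssum[OF x])
    moreover have "(\<lambda>N. \<Sum>n<N. u n x) \<longlonglongrightarrow> y x"
      using tendsto_uniform_limitI[OF lim x] .
    then have "(\<lambda>N. \<Sum>n<Suc N. u n x) \<longlonglongrightarrow> y x" by (rule LIMSEQ_Suc)
    ultimately show ?thesis using LIMSEQ_unique by blast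
  qed
  have p0: "prim (\<lambda>x. a + b * of_real x) (\<lambda>x. b)"
    by (rule primI_derivative) (auto intro!: derivative_eq_intros)
  have p1: "prim y (\<lambda>x. b + J y x)"
    by (rule prim_cong[OF prim_add[OF p0 T[OF yc]]]) (use fix1 in auto)
  have p2: "prim (\<lambda>x. b + J y x) (\<lambda>x. V x * y x)"
    using prim_add[OF prim_const[of b] J[OF yc]] by simp
  have bd: "norm (y x) \<le> C * exp m" if "x \<in> {0..1}" for x
  proof -
    have "norm (y x) \<le> (\<Sum>n. C * (m ^ n /\<^sub>R fact n))"
      unfolding y_def using ub1[OF that] by (rule norm_suminf_le[OF _ sm])
    also have "\<dots> = C * exp m" unfolding exp_def by (rule suminf_mult[OF summable_exp_generic])
    finally show ?thesis .
  qed
  show ?thesis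
    using p1 p2 fix1[of 0] bd
    by (intro exI[of _ y] exI[of _ "\<lambda>x. b + J y x"]) (auto simp: sol_def C_def)
qed

lemma sol_continuous: "sol V y y' \<Longrightarrow> continuous_on {0..1} y" "sol V y y' \<Longrightarrow> continuous_on {0..1} y'"
  by (auto simp: sol_def intro: prim_continuous)

lemma sol_diff:
  assumes "sol V y y'" "sol V z z'"
  shows "sol V (\<lambda>x. y x - z x) (\<lambda>x. y' x - z' x)"
  using assms prim_diff unfolding sol_def by (auto simp: right_diff_distrib)

lemma wronskian:
  assumes "sol V y y'" "sol U z z'"
  shows "prim (\<lambda>x. y x * z' x - y' x * z x) (\<lambda>x. (U x - V x) * (y x * z x))"
proof -
  have "prim (\<lambda>x. y x * z' x - y' x * z x) (\<lambda>x. (y' x * z' x + y x * (U x * z x)) - (V x * y x * z x + y' x * z' x))"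
    using assms unfolding sol_def by (intro prim_diff prim_mult) auto
  then show ?thesis by (simp add: algebra_simps)
qed

lemma wronskian_const:
  assumes "sol V y y'" "sol V z z'" "0 \<le> x" "x \<le> 1"
  shows "y x * z' x - y' x * z x = y 0 * z' 0 - y' 0 * z 0"
proof -
  have "prim (\<lambda>x. y x * z' x - y' x * z x) (\<lambda>x. 0)"
    using wronskian[OF assms(1,2)] by simp
  from prim_has_integral[OF this order_refl assms(3,4)] show ?thesis
    by simp
qed

text \<open>Wronskians replace a Gronwall estimate. Those of the difference \<open>d\<close> with a
  normalised basis \<open>c\<close>, \<open>s\<close> vanish, and since c s' - c' s = 1 this linear
  system forces d = d' = 0.\<close>

lemma sol_unique:
  assumes V: "continuous_on {0..1} V" and y: "sol V y y'" and z: "sol V z z'"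
    and i: "y 0 = z 0" "y' 0 = z' 0" and x: "0 \<le> x" "x \<le> 1"
  shows "y x = z x" "y' x = z' x"
proof -
  obtain m where "\<And>x. x \<in> {0..1} \<Longrightarrow> norm (V x) \<le> m"
    using compact_imp_bounded[OF compact_continuous_image[OF V compact_Icc]]
    unfolding bounded_iff by blast
  then have m: "\<And>x. \<lbrakk>0 \<le> x; x \<le> 1\<rbrakk> \<Longrightarrow> norm (V x) \<le> m" by auto
  obtain c c' where c: "sol V c c'" "c 0 = 1" "c' 0 = 0" using sol_exists[OF V m] by blast
  obtain s s' where s: "sol V s s'" "s 0 = 0" "s' 0 = 1" using sol_exists[OF V m] by blast
  define d where "d x = y x - z x" for x
  define d' where "d' x = y' x - z' x" for x
  have d: "sol V d d'" unfolding d_def d'_def by (rule sol_diff[OF y z])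
  have d0: "d 0 = 0" "d' 0 = 0" using i by (auto simp: d_def d'_def)
  have 1: "c x * s' x - c' x * s x = 1" using wronskian_const[OF c(1) s(1) x] c s by simp
  have 2: "d x * s' x - d' x * s x = 0" using wronskian_const[OF d s(1) x] d0 by simp
  have 3: "d x * c' x - d' x * c x = 0" using wronskian_const[OF d c(1) x] d0 by simp
  have "d x * (c x * s' x - c' x * s x) = c x * (d x * s' x - d' x * s x) - s x * (d x * c' x - d' x * c x)"
    by (simp add: algebra_simps)
  then have "d x = 0" by (simp add: 1 2 3)
  then show "y x = z x" by (simp add: d_def)
  have "d' x * (c x * s' x - c' x * s x) = c' x * (d x * s' x - d' x * s x) - s' x * (d x * c' x - d' x * c x)"
    by (simp add: algebra_simps)
  then have "d' x = 0" by (simp add: 1 2 3)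
  then show "y' x = z' x" by (simp add: d'_def)
qed

section \<open>The fundamental solutions and the characteristic function\<close>

definition pot :: "(real \<Rightarrow> real) \<Rightarrow> complex \<Rightarrow> real \<Rightarrow> complex" where
  "pot q l x = of_real (q x) - l"

text \<open>Any choice gives the same values on [0,1] by \<open>sol_unique\<close>, once
  \<open>q\<close> is continuous. The first pair is modelled on sin(kx)/k and its derivative, the
  second on cos(kx), where l = k^2.\<close>

definition sine_cosine :: "(real \<Rightarrow> real) \<Rightarrow> complex \<Rightarrow>
    ((real \<Rightarrow> complex) \<times> (real \<Rightarrow> complex)) \<times> ((real \<Rightarrow> complex) \<times> (real \<Rightarrow> complex))" where
  "sine_cosine q l = (SOME r. sol (pot q l) (fst (fst r)) (snd (fst r)) \<and> sol (pot q l) (fst (snd r)) (snd (snd r)) \<and>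
      fst (fst r) 0 = 0 \<and> snd (fst r) 0 = 1 \<and> fst (snd r) 0 = 1 \<and> snd (snd r) 0 = 0)"

definition sin_sol where "sin_sol q l = fst (fst (sine_cosine q l))"
definition sin_sol' where "sin_sol' q l = snd (fst (sine_cosine q l))"
definition cos_sol where "cos_sol q l = fst (snd (sine_cosine q l))"
definition cos_sol' where "cos_sol' q l = snd (snd (sine_cosine q l))"

definition char_fun :: "(real \<Rightarrow> real) \<Rightarrow> complex \<Rightarrow> complex" where "char_fun q l = sin_sol q l 1"

lemma pot_continuous: "continuous_on {0..1} q \<Longrightarrow> continuous_on {0..1} (pot q l)"
  unfolding pot_def by (intro continuous_intros)

lemma pot_bound: "\<bar>q x\<bar> \<le> m \<Longrightarrow> norm (pot q l x) \<le> m + norm l"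
  unfolding pot_def by (rule order_trans[OF norm_triangle_ineq4]) simp

lemma continuous_bound:
  fixes q :: "real \<Rightarrow> real"
  assumes "continuous_on {0..1} q"
  obtains m where "\<And>x. x \<in> {0..1} \<Longrightarrow> \<bar>q x\<bar> \<le> m"
proof -
  obtain m where "\<forall>x\<in>q ` {0..1}. norm x \<le> m"
    using compact_imp_bounded[OF compact_continuous_image[OF assms compact_Icc]]
    unfolding bounded_iff by blast
  then show ?thesis by (intro that[of m]) auto
qed

lemma fundamental_sol:
  assumes q: "continuous_on {0..1} q"
  shows "sol (pot q l) (sin_sol q l) (sin_sol' q l)" "sol (pot q l) (cos_sol q l) (cos_sol' q l)"
    "sin_sol q l 0 = 0" "sin_sol' q l 0 = 1" "cos_sol q l 0 = 1" "cos_sol' q l 0 = 0"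
proof -
  obtain m where m: "\<And>x. x \<in> {0..1} \<Longrightarrow> \<bar>q x\<bar> \<le> m" using continuous_bound[OF q] by blast
  then have b: "\<And>x. \<lbrakk>0 \<le> x; x \<le> 1\<rbrakk> \<Longrightarrow> norm (pot q l x) \<le> m + norm l" using pot_bound by auto
  obtain c c' where c: "sol (pot q l) c c'" "c 0 = 1" "c' 0 = 0"
    using sol_exists[OF pot_continuous[OF q] b] by blast
  obtain s s' where s: "sol (pot q l) s s'" "s 0 = 0" "s' 0 = 1"
    using sol_exists[OF pot_continuous[OF q] b] by blast
  let ?P = "\<lambda>r. sol (pot q l) (fst (fst r)) (snd (fst r)) \<and> sol (pot q l) (fst (snd r)) (snd (snd r)) \<and>
      fst (fst r) 0 = 0 \<and> snd (fst r) 0 = 1 \<and> fst (snd r) 0 = 1 \<and> snd (snd r) 0 = 0"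
  have "?P (sine_cosine q l)"
    unfolding sine_cosine_def by (rule someI[where x = "((s, s'), (c, c'))"]) (use c s in simp)
  then show "sol (pot q l) (sin_sol q l) (sin_sol' q l)" "sol (pot q l) (cos_sol q l) (cos_sol' q l)"
    "sin_sol q l 0 = 0" "sin_sol' q l 0 = 1" "cos_sol q l 0 = 1" "cos_sol' q l 0 = 0"
    by (auto simp: sin_sol_def sin_sol'_def cos_sol_def cos_sol'_def)
qed

lemma fundamental_bound:
  assumes q: "continuous_on {0..1} q" and m: "\<And>x. x \<in> {0..1} \<Longrightarrow> \<bar>q x\<bar> \<le> m" and x: "x \<in> {0..1}"
  shows "norm (sin_sol q l x) \<le> exp (m + norm l)" "norm (cos_sol q l x) \<le> exp (m + norm l)"
proof -
  have b: "\<And>x. \<lbrakk>0 \<le> x; x \<le> 1\<rbrakk> \<Longrightarrow> norm (pot q l x) \<le> m + norm l" using m pot_bound by auto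
  note P = pot_continuous[OF q]
  have x': "0 \<le> x" "x \<le> 1" using x by auto
  obtain c c' where c: "sol (pot q l) c c'" "c 0 = 1" "c' 0 = 0" "\<forall>x\<in>{0..1}. norm (c x) \<le> (norm (1::complex) + norm (0::complex)) * exp (m + norm l)"
    using sol_exists[OF P b] by blast
  obtain s s' where s: "sol (pot q l) s s'" "s 0 = 0" "s' 0 = 1" "\<forall>x\<in>{0..1}. norm (s x) \<le> (norm (0::complex) + norm (1::complex)) * exp (m + norm l)"
    using sol_exists[OF P b] by blast
  have "sin_sol q l x = s x" 
    by (rule sol_unique(1)[OF P fundamental_sol(1)[OF q] s(1) _ _ x']) (simp_all add: fundamental_sol[OF q] s)
  then show "norm (sin_sol q l x) \<le> exp (m + norm l)" using s(4) x by auto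
  have "cos_sol q l x = c x" 
    by (rule sol_unique(1)[OF P fundamental_sol(2)[OF q] c(1) _ _ x']) (simp_all add: fundamental_sol[OF q] c)
  then show "norm (cos_sol q l x) \<le> exp (m + norm l)" using c(4) x by auto
qed

lemma char_fun_eqI:
  assumes "continuous_on {0..1} q" "sol (pot q l) y y'" "y 0 = 0" "y' 0 = 1"
  shows "char_fun q l = y 1"
  unfolding char_fun_def
  by (rule sol_unique(1)[OF pot_continuous[OF assms(1)] fundamental_sol(1)[OF assms(1)] assms(2)])
     (simp_all add: assms(3,4) fundamental_sol(3,4)[OF assms(1)])

text \<open>Variation of constants. The Wronskians of \<open>sin_sol q l\<close> with both basis
  solutions at parameter \<open>k\<close> have derivative l - k times a product, and the unit
  Wronskian of that basis solves for \<open>sin_sol q l x\<close>. The explicit factor l - k makes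
  complex differentiability in the parameter elementary.\<close>

lemma sin_sol_difference:
  assumes q: "continuous_on {0..1} q" and x: "x \<in> {0..1}"
  shows "sin_sol q l x - sin_sol q k x = (l - k) * (cos_sol q k x * integral {0..x} (\<lambda>t. sin_sol q l t * sin_sol q k t)
           - sin_sol q k x * integral {0..x} (\<lambda>t. sin_sol q l t * cos_sol q k t))"
proof -
  note sc = fundamental_sol[OF q]
  have x': "0 \<le> x" "x \<le> 1" using x by auto
  define W1 where "W1 = sin_sol q l x * cos_sol' q k x - sin_sol' q l x * cos_sol q k x"
  define W2 where "W2 = sin_sol q l x * sin_sol' q k x - sin_sol' q l x * sin_sol q k x"
  have e: "pot q k t - pot q l t = l - k" for t by (simp add: pot_def)
  have "((\<lambda>t. (l - k) * (sin_sol q l t * cos_sol q k t)) has_integral (W1 - (-1))) {0..x}"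
    using prim_has_integral[OF wronskian[OF sc(1)[of l] sc(2)[of k]] order_refl x'] sc(3-6)
    by (simp add: e W1_def)
  from integral_unique[OF this, unfolded integral_mult_right]
  have 1: "W1 = -1 + (l - k) * integral {0..x} (\<lambda>t. sin_sol q l t * cos_sol q k t)" by simp
  have "((\<lambda>t. (l - k) * (sin_sol q l t * sin_sol q k t)) has_integral W2) {0..x}"
    using prim_has_integral[OF wronskian[OF sc(1)[of l] sc(1)[of k]] order_refl x'] sc(3-6)
    by (simp add: e W2_def)
  from integral_unique[OF this, unfolded integral_mult_right]
  have 2: "W2 = (l - k) * integral {0..x} (\<lambda>t. sin_sol q l t * sin_sol q k t)" by simp
  have w: "cos_sol q k x * sin_sol' q k x - cos_sol' q k x * sin_sol q k x = 1"
    using wronskian_const[OF sc(2)[of k] sc(1)[of k] x'] sc(3-6) by simp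
  have "cos_sol q k x * W2 - sin_sol q k x * W1 = sin_sol q l x * (cos_sol q k x * sin_sol' q k x - cos_sol' q k x * sin_sol q k x)"
    by (simp add: W1_def W2_def algebra_simps)
  then have "sin_sol q l x = cos_sol q k x * W2 - sin_sol q k x * W1" using w by simp
  then show ?thesis unfolding 1 2 by (simp add: algebra_simps)
qed

text \<open>The difference quotient is exactly \<open>?I l 1\<close>. As \<open>sin_sol q l\<close>
  is uniformly within O(|l - k|) of \<open>sin_sol q k\<close>, again by
  \<open>sin_sol_difference\<close>, its integrals converge to those at \<open>k\<close>.\<close>

lemma char_fun_derivative:
  assumes q: "continuous_on {0..1} q"
  shows "(char_fun q has_field_derivative
     (cos_sol q k 1 * integral {0..1} (\<lambda>t. sin_sol q k t * sin_sol q k t) - char_fun q k * integral {0..1} (\<lambda>t. sin_sol q k t * cos_sol q k t))) (at k)"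
proof -
  note sc = fundamental_sol[OF q]
  have Sc: "continuous_on {0..1} (sin_sol q l)" "continuous_on {0..1} (cos_sol q l)" for l
    using sc sol_continuous by blast+
  obtain m where m: "\<And>x. x \<in> {0..1} \<Longrightarrow> \<bar>q x\<bar> \<le> m" using continuous_bound[OF q] by blast
  define M where "M = exp (m + norm k + 1)"
  have M0: "0 \<le> M" by (simp add: M_def)
  have bd: "norm (sin_sol q l x) \<le> M" "norm (cos_sol q l x) \<le> M" if "norm (l - k) \<le> 1" "x \<in> {0..1}" for l x
  proof -
    have "norm l \<le> norm (l - k) + norm k" using norm_triangle_ineq[of "l - k" k] by simp
    then have "exp (m + norm l) \<le> M" using that(1) by (simp add: M_def)
    then show "norm (sin_sol q l x) \<le> M" "norm (cos_sol q l x) \<le> M"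
      using fundamental_bound[OF q m that(2), of l] by linarith+
  qed
  have ib: "norm (integral {0..x} f) \<le> B"
    if "continuous_on {0..1} f" "\<And>t. t \<in> {0..1} \<Longrightarrow> norm (f t) \<le> B" "x \<in> {0..1}" for f :: "real \<Rightarrow> complex" and B x
    using prim_bound1[OF prim_integral[OF that(1)], of x B] that(2,3) by auto
  let ?I = "\<lambda>l x. cos_sol q k x * integral {0..x} (\<lambda>t. sin_sol q l t * sin_sol q k t) - sin_sol q k x * integral {0..x} (\<lambda>t. sin_sol q l t * cos_sol q k t)"
  have close: "norm (sin_sol q l x - sin_sol q k x) \<le> norm (l - k) * (2 * M ^ 3)" if l: "norm (l - k) \<le> 1" and x: "x \<in> {0..1}" for l x
  proof -
    have 1: "norm (integral {0..x} (\<lambda>t. sin_sol q l t * sin_sol q k t)) \<le> M * M"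
      using x bd l by (intro ib continuous_intros Sc) (auto simp: norm_mult M0 intro!: mult_mono)
    have 2: "norm (integral {0..x} (\<lambda>t. sin_sol q l t * cos_sol q k t)) \<le> M * M"
      using x bd l by (intro ib continuous_intros Sc) (auto simp: norm_mult M0 intro!: mult_mono)
    have "norm (?I l x) \<le> M * (M * M) + M * (M * M)"
      using 1 2 bd[of k x] x M0
      by (intro order_trans[OF norm_triangle_ineq4] add_mono) (auto simp: norm_mult intro!: mult_mono)
    then have "norm (?I l x) \<le> 2 * M ^ 3" by (simp add: power3_eq_cube)
    then show ?thesis unfolding sin_sol_difference[OF q x] norm_mult by (intro mult_left_mono) auto
  qed
  have diff: "norm (?I l 1 - ?I k 1) \<le> norm (l - k) * (4 * M ^ 5)" if l: "norm (l - k) \<le> 1" for l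
  proof -
    let ?e = "norm (l - k) * (2 * M ^ 3)"
    have i: "(\<lambda>t. sin_sol q l t * sin_sol q k t) integrable_on {0..1}" "(\<lambda>t. sin_sol q l t * cos_sol q k t) integrable_on {0..1}" for l
      by (intro integrable_continuous_real continuous_intros Sc)+
    have 1: "norm (integral {0..1} (\<lambda>t. (sin_sol q l t - sin_sol q k t) * sin_sol q k t)) \<le> ?e * M"
      using close[OF l] bd[of k] M0
      by (intro ib continuous_intros Sc) (auto simp: norm_mult M0 intro!: mult_mono)
    have 2: "norm (integral {0..1} (\<lambda>t. (sin_sol q l t - sin_sol q k t) * cos_sol q k t)) \<le> ?e * M"
      using close[OF l] bd[of k] M0
      by (intro ib continuous_intros Sc) (auto simp: norm_mult M0 intro!: mult_mono)
    have "?I l 1 - ?I k 1 = cos_sol q k 1 * integral {0..1} (\<lambda>t. (sin_sol q l t - sin_sol q k t) * sin_sol q k t) -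
        sin_sol q k 1 * integral {0..1} (\<lambda>t. (sin_sol q l t - sin_sol q k t) * cos_sol q k t)"
      using integral_diff[OF i(1)[of l] i(1)[of k]] integral_diff[OF i(2)[of l] i(2)[of k]]
      by (simp add: left_diff_distrib right_diff_distrib)
    also have "norm \<dots> \<le> M * (?e * M) + M * (?e * M)"
      using 1 2 bd[of k 1] M0
      by (intro order_trans[OF norm_triangle_ineq4] add_mono) (auto simp: norm_mult intro!: mult_mono)
    finally show ?thesis by (simp add: algebra_simps numeral_eq_Suc)
  qed
  have quot: "(char_fun q l - char_fun q k) / (l - k) = ?I l 1" if "l \<noteq> k" for l
    using sin_sol_difference[OF q, of 1 l k] that by (simp add: char_fun_def)
  have "((\<lambda>l. (char_fun q l - char_fun q k) / (l - k) - ?I k 1) \<longlongrightarrow> 0) (at k)"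
  proof (rule Lim_null_comparison)
    show "\<forall>\<^sub>F l in at k. norm ((char_fun q l - char_fun q k) / (l - k) - ?I k 1) \<le> norm (l - k) * (4 * M ^ 5)"
      unfolding eventually_at using quot diff
      by (intro exI[of _ 1]) (auto simp: dist_norm)
    have "((\<lambda>l. norm (l - k) * (4 * M ^ 5)) \<longlongrightarrow> norm (k - k) * (4 * M ^ 5)) (at k)"
      by (intro tendsto_intros)
    then show "((\<lambda>l. norm (l - k) * (4 * M ^ 5)) \<longlongrightarrow> 0) (at k)" by simp
  qed
  then have "((\<lambda>l. (char_fun q l - char_fun q k) / (l - k)) \<longlongrightarrow> ?I k 1) (at k)"
    by (simp add: LIM_zero_iff)
  then show ?thesis
    unfolding has_field_derivative_iff char_fun_def .
qed

lemma char_fun_holomorphic: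
  assumes "continuous_on {0..1} q" shows "char_fun q holomorphic_on A"
  using char_fun_derivative[OF assms] by (meson holomorphic_onI field_differentiable_at_within field_differentiable_def)

text \<open>At a real parameter \<open>sin_sol\<close> is real on [0,1], since its conjugate solves
  the same initial value problem. At a zero the derivative is therefore \<open>cos_sol\<close> at 1
  times the integral of a square that is not identically zero, and the unit Wronskian at 1 keeps
  \<open>cos_sol\<close> away from 0 there.\<close>

lemma char_fun_simple_zero:
  assumes q: "continuous_on {0..1} q" and k: "char_fun q (of_real k) = 0"
  shows "deriv (char_fun q) (of_real k) \<noteq> 0"
proof -
  note sc = fundamental_sol[OF q]
  let ?k = "complex_of_real k"
  have "sol (pot q ?k) (\<lambda>x. cnj (sin_sol q ?k x)) (\<lambda>x. cnj (sin_sol' q ?k x))"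
    using sc(1)[of ?k] prim_linear[OF _ bounded_linear_cnj, of "sin_sol q ?k" "sin_sol' q ?k"]
      prim_linear[OF _ bounded_linear_cnj, of "sin_sol' q ?k" "\<lambda>x. pot q ?k x * sin_sol q ?k x"]
    by (simp add: sol_def pot_def)
  then have cnj: "cnj (sin_sol q ?k x) = sin_sol q ?k x" if "0 \<le> x" "x \<le> 1" for x
    using sol_unique(1)[OF pot_continuous[OF q] _ sc(1)[of ?k], of "\<lambda>x. cnj (sin_sol q ?k x)"] sc(3,4) that by simp
  define f where "f x = (Re (sin_sol q ?k x))\<^sup>2" for x
  have sq: "sin_sol q ?k x * sin_sol q ?k x = of_real (f x)" if "x \<in> {0..1}" for x
    using cnj[of x] that by (auto simp: f_def complex_eq_iff power2_eq_square)
  have fc: "continuous_on {0..1} f"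
    unfolding f_def using sol_continuous[OF sc(1)] by (intro continuous_intros)
  have "integral {0..1} (\<lambda>x. sin_sol q ?k x * sin_sol q ?k x) = integral {0..1} (\<lambda>x. of_real (f x))"
    by (rule integral_cong) (use sq in auto)
  also have "\<dots> = of_real (integral {0..1} f)"
    using integral_linear[OF integrable_continuous_real[OF fc] bounded_linear_of_real] by (simp add: o_def)
  finally have I: "integral {0..1} (\<lambda>x. sin_sol q ?k x * sin_sol q ?k x) = of_real (integral {0..1} f)" .
  have "integral {0..1} f \<noteq> 0"
  proof
    assume "integral {0..1} f = 0"
    moreover have "f x \<ge> 0" for x by (simp add: f_def)
    ultimately have "\<forall>x\<in>{0..1}. f x = 0" using integral_eq_0_iff[OF fc zero_less_one] by blast
    then have z: "sin_sol q ?k x = 0" if "x \<in> {0..1}" for x using sq[OF that] that by simp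
    have "prim (sin_sol q ?k) (\<lambda>x. 0)"
      by (rule prim_cong[OF prim_const[of 0]]) (use z in auto)
    have "prim (sin_sol' q ?k) (\<lambda>x. pot q ?k x * sin_sol q ?k x)" using sc(1) by (simp add: sol_def)
    then have "prim (sin_sol' q ?k) (\<lambda>x. 0)" by (rule prim_cong) (use z in auto)
    then have one: "sin_sol' q ?k x = 1" if "x \<in> {0..1}" for x
      using prim_has_integral[of "sin_sol' q ?k" "\<lambda>x. 0" 0 x] that sc(4)[of ?k] by simp
    have "prim (sin_sol q ?k) (sin_sol' q ?k)" using sc(1) by (simp add: sol_def)
    then have "prim (sin_sol q ?k) (\<lambda>x. 1)" by (rule prim_cong) (use one in auto)
    from prim_has_integral[OF this, of 0 1] have "((\<lambda>x::real. 1::complex) has_integral sin_sol q ?k 1 - sin_sol q ?k 0) {0..1}" by simp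
    then have "sin_sol q ?k 1 - sin_sol q ?k 0 = 1" using has_integral_const_real[of "1::complex" 0 1]
      by (metis (no_types, lifting) content_real diff_zero has_integral_unique scaleR_one zero_le_one)
    then show False using z by simp
  qed
  moreover have "cos_sol q ?k 1 * sin_sol' q ?k 1 - cos_sol' q ?k 1 * sin_sol q ?k 1 = 1"
    using wronskian_const[OF sc(2)[of ?k] sc(1)[of ?k], of 1] sc(3-6) by simp
  then have "cos_sol q ?k 1 \<noteq> 0" using k by (auto simp: char_fun_def)
  ultimately have "cos_sol q ?k 1 * integral {0..1} (\<lambda>t. sin_sol q ?k t * sin_sol q ?k t) - char_fun q ?k * integral {0..1} (\<lambda>t. sin_sol q ?k t * cos_sol q ?k t) \<noteq> 0"
    using I k by simp
  then show ?thesis using DERIV_imp_deriv[OF char_fun_derivative[OF q, of ?k]] by simp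
qed

text \<open>Both sides have the same function \<open>pot\<close>, so even the choices coincide. This
  is the shift of the spectrum by the mean.\<close>

lemma char_fun_shift: "char_fun (\<lambda>x. q x - c) (l - of_real c) = char_fun q l"
proof -
  have "pot (\<lambda>x. q x - c) (l - of_real c) = pot q l" by (auto simp: pot_def)
  then show ?thesis by (simp add: char_fun_def sin_sol_def sine_cosine_def)
qed


section \<open>Eigenvalues as zeros of an entire function\<close>

lemma continuous_square_integrable:
  assumes "continuous_on {0..1} y" shows "square_integrable y"
proof -
  have "y absolutely_integrable_on {0..1}" "(\<lambda>x. (norm (y x))\<^sup>2) absolutely_integrable_on {0..1}"
    using assms by (auto intro!: absolutely_integrable_continuous_real continuous_intros)
  then show ?thesis unfolding square_integrable_def unit_integrable_iff[symmetric] by auto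
qed

text \<open>An eigenfunction has a representative F solving the equation with F(0) = F(1) = 0. Its
  Wronskian with \<open>cos_sol\<close> shows F'(1) to be nonzero, and then the one with
  \<open>sin_sol\<close> makes \<open>char_fun\<close> vanish. Conversely \<open>sin_sol\<close>
  itself is an eigenfunction. The operator contains -p, hence the potential -f.\<close>

lemma eigenvalue_iff:
  assumes p: "integrable unit_measure p" and f: "continuous_on {0..1} f"
    and pf: "AE x in unit_measure. p x = f x"
  shows "\<mu> \<in> h_eigenvalues p \<longleftrightarrow> char_fun (\<lambda>x. - f x) \<mu> = 0"
proof
  let ?q = "\<lambda>x. - f x"
  have q: "continuous_on {0..1} ?q" using f by (intro continuous_intros)
  note sc = fundamental_sol[OF q]
  {
    assume "\<mu> \<in> h_eigenvalues p"
    then obtain y where y: "y \<in> sobolev 2" "cont_rep y 0 = 0" "cont_rep y 1 = 0"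
      "\<not> (AE x in unit_measure. y x = 0)" "AE x in unit_measure. h_op p y x = \<mu> * y x"
      by (auto simp: h_eigenvalues_def h_domain_def)
    have "has_weak_deriv 2 y (weak_deriv 2 y)"
      using y(1) unfolding sobolev_def weak_deriv_def by (auto intro: someI[where P = "has_weak_deriv 2 y"])
    then obtain F :: "nat \<Rightarrow> real \<Rightarrow> complex" where
      F: "AE x in unit_measure. y x = F 0 x" "\<And>j. j < 2 \<Longrightarrow> prim (F j) (F (Suc j))" "F 2 = weak_deriv 2 y"
      using has_weak_deriv_imp_chain by blast
    have F0: "prim (F 0) (F 1)" and F1: "prim (F 1) (weak_deriv 2 y)" using F(2)[of 0] F(2)[of 1] F(3) by (auto simp: numeral_2_eq_2)
    note F0c = prim_continuous[OF F0]
    have "AE x in unit_measure. weak_deriv 2 y x = pot ?q \<mu> x * F 0 x"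
    proof (use y(5) pf F(1) in eventually_elim)
      case (elim x)
      then have "- weak_deriv 2 y x - of_real (f x) * F 0 x = \<mu> * F 0 x" by (simp add: h_op_def)
      then have "weak_deriv 2 y x = - (of_real (f x) * F 0 x) - \<mu> * F 0 x"
        by (metis add.commute add_uminus_conv_diff diff_eq_eq minus_diff_eq minus_minus)
      then show ?case by (simp add: pot_def algebra_simps)
    qed
    from unit_AE_obtain[OF this]
    obtain N where N: "negligible N" "\<And>x. x \<in> {0..1} - N \<Longrightarrow> weak_deriv 2 y x = pot ?q \<mu> x * F 0 x"
      by metis
    have "prim (F 1) (\<lambda>x. pot ?q \<mu> x * F 0 x)"
      by (rule prim_cong_AE[OF F1 N(1)]) (use N(2) in auto)
    then have s: "sol (pot ?q \<mu>) (F 0) (F 1)" using F0 by (simp add: sol_def)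
    have e: "F 0 0 = 0" "F 0 1 = 0"
      using y(2,3) cont_rep_eq[OF F0c F(1), of 0] cont_rep_eq[OF F0c F(1), of 1] by auto
    have n: "F 1 0 \<noteq> 0"
    proof
      assume "F 1 0 = 0"
      moreover have "sol (pot ?q \<mu>) (\<lambda>x. 0) (\<lambda>x. 0)" by (simp add: sol_def prim_const)
      ultimately have "F 0 x = 0" if "0 \<le> x" "x \<le> 1" for x
        using sol_unique(1)[OF pot_continuous[OF q] s, of "\<lambda>x. 0" "\<lambda>x. 0" x] e that by simp
      moreover have "AE x in unit_measure. x \<in> {0..1}" by (rule AE_I2) auto
      ultimately have "AE x in unit_measure. y x = 0" using F(1) by (auto elim!: eventually_elim2)
      then show False using y(4) by blast
    qed
    have "F 0 1 * sin_sol' ?q \<mu> 1 - F 1 1 * sin_sol ?q \<mu> 1 = F 0 0 * sin_sol' ?q \<mu> 0 - F 1 0 * sin_sol ?q \<mu> 0"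
      by (rule wronskian_const[OF s sc(1)]) auto
    then have w: "F 1 1 * sin_sol ?q \<mu> 1 = 0" using e sc by simp
    have "F 0 1 * cos_sol' ?q \<mu> 1 - F 1 1 * cos_sol ?q \<mu> 1 = F 0 0 * cos_sol' ?q \<mu> 0 - F 1 0 * cos_sol ?q \<mu> 0"
      by (rule wronskian_const[OF s sc(2)]) auto
    then have "F 1 1 \<noteq> 0" using e sc n by auto
    then show "char_fun ?q \<mu> = 0" using w by (simp add: char_fun_def)
  }
  {
    assume z: "char_fun ?q \<mu> = 0"
    let ?y = "sin_sol ?q \<mu>"
    have y: "prim ?y (sin_sol' ?q \<mu>)" "prim (sin_sol' ?q \<mu>) (\<lambda>x. pot ?q \<mu> x * ?y x)" using sc(1) by (auto simp: sol_def)
    note yc = prim_continuous[OF y(1)]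
    have Vy: "continuous_on {0..1} (\<lambda>x. pot ?q \<mu> x * ?y x)" by (intro continuous_intros pot_continuous q yc)
    define F where "F = (\<lambda>n::nat. if n = 0 then ?y else if n = 1 then sin_sol' ?q \<mu> else (\<lambda>x. pot ?q \<mu> x * ?y x))"
    have "has_weak_deriv 2 ?y (F 2)"
    proof (rule chain_imp_has_weak_deriv)
      fix j :: nat assume "j < 2"
      then consider "j = 0" | "j = 1" by linarith
      then show "prim (F j) (F (Suc j))" using y by cases (auto simp: F_def)
    qed (auto simp: F_def intro!: absolutely_integrable_continuous_real yc Vy)
    then have w: "has_weak_deriv 2 ?y (\<lambda>x. pot ?q \<mu> x * ?y x)" by (simp add: F_def)
    then have sob: "?y \<in> sobolev 2" by (auto simp: sobolev_def)
    have "has_weak_deriv 2 ?y (weak_deriv 2 ?y)"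
      unfolding weak_deriv_def using w by (rule someI[where P = "has_weak_deriv 2 ?y"])
    then have wm: "weak_deriv 2 ?y \<in> borel_measurable unit_measure"
      by (auto simp: has_weak_deriv_def)
    have h: "AE x in unit_measure. h_op p ?y x = \<mu> * ?y x"
    proof (use weak_deriv_AE_eq[OF w] pf in eventually_elim)
      case (elim x)
      then show ?case unfolding h_op_def elim pot_def by (simp add: algebra_simps)
    qed
    have sy: "square_integrable ?y" by (rule continuous_square_integrable[OF yc])
    have s\<mu>: "square_integrable (\<lambda>x. \<mu> * ?y x)"
      by (intro continuous_square_integrable continuous_intros yc)
    have hm: "h_op p ?y \<in> borel_measurable unit_measure"
    proof -
      have [measurable]: "?y \<in> borel_measurable unit_measure" using sy by (simp add: square_integrable_def)
      have [measurable]: "p \<in> borel_measurable unit_measure" using p by simp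
      note wm [measurable]
      show ?thesis unfolding h_op_def by measurable
    qed
    have "integrable unit_measure (\<lambda>x. (norm (h_op p ?y x))\<^sup>2)"
    proof (rule integrable_cong_AE_imp[where g = "\<lambda>x. (norm (\<mu> * ?y x))\<^sup>2"])
      show "integrable unit_measure (\<lambda>x. (norm (\<mu> * ?y x))\<^sup>2)" using s\<mu> by (simp add: square_integrable_def)
      show "(\<lambda>x. (norm (h_op p ?y x))\<^sup>2) \<in> borel_measurable unit_measure" using hm by measurable
      show "AE x in unit_measure. (norm (\<mu> * ?y x))\<^sup>2 = (norm (h_op p ?y x))\<^sup>2"
        using h by eventually_elim simp
    qed
    then have sh: "square_integrable (h_op p ?y)" using hm by (simp add: square_integrable_def)
    have cr: "cont_rep ?y x = ?y x" if "x \<in> {0..1}" for x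
      by (rule cont_rep_eq[OF yc _ that]) simp
    have dom: "?y \<in> h_domain p"
      using sy sob sh cr[of 0] cr[of 1] sc(3)[of \<mu>] z by (simp add: h_domain_def char_fun_def)
    have "\<not> (AE x in unit_measure. ?y x = 0)"
    proof
      assume "AE x in unit_measure. ?y x = 0"
      then have y0: "?y x = 0" if "x \<in> {0..1}" for x
        using continuous_AE_eq[OF yc continuous_on_const _ that] by simp
      have "cos_sol ?q \<mu> x * sin_sol' ?q \<mu> x - cos_sol' ?q \<mu> x * sin_sol ?q \<mu> x = 1" if "0 \<le> x" "x \<le> 1" for x
        using wronskian_const[OF sc(2) sc(1) that] sc by simp
      then have s': "cos_sol ?q \<mu> x * sin_sol' ?q \<mu> x = 1" if "0 \<le> x" "x \<le> 1" for x
        using y0 that by fastforce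
      have "(sin_sol' ?q \<mu> has_integral 0) {0..x}" if "0 \<le> x" "x \<le> 1" for x
        using prim_has_integral[OF y(1), of 0 x] y0 that by simp
      then have "AE x in unit_measure. sin_sol' ?q \<mu> x = 0"
      proof (intro integral_zero_imp_AE_zero)
        show "sin_sol' ?q \<mu> absolutely_integrable_on {0..1}" using prim_abs y(1) by blast
        fix a b :: real assume "0 < a" "a < b" "b < 1"
        then show "integral {a..b} (sin_sol' ?q \<mu>) = 0"
          using prim_has_integral[OF y(1), of a b] y0 by (simp add: integral_unique)
      qed
      then have "sin_sol' ?q \<mu> 0 = 0"
        using continuous_AE_eq[OF prim_continuous[OF y(2)] continuous_on_const, of 0 0] by simp
      then show False using sc(4)[of \<mu>] by simp
    qed
    then show "\<mu> \<in> h_eigenvalues p" using dom h by (auto simp: h_eigenvalues_def)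
  }
qed

section \<open>The Liouville--Green approximation\<close>

lemma prim_cdivide: 
  fixes \<rho> \<rho>' :: "real \<Rightarrow> complex"
  assumes "prim \<rho> \<rho>'" "continuous_on {0..1} \<rho>'" "\<And>x. x \<in> {0..1} \<Longrightarrow> \<rho> x \<noteq> 0"
  shows "prim (\<lambda>x. inverse (\<rho> x)) (\<lambda>x. - (inverse (\<rho> x) * \<rho>' x * inverse (\<rho> x)))"
proof (rule primI_derivative)
  note c = prim_continuous[OF assms(1)]
  show "continuous_on {0..1} (\<lambda>x. - (inverse (\<rho> x) * \<rho>' x * inverse (\<rho> x)))"
    using assms by (intro continuous_intros c) auto
  fix x :: real assume x: "x \<in> {0..1}"
  have "(\<rho> has_derivative (\<lambda>h. h *\<^sub>R \<rho>' x)) (at x within {0..1})"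
    using prim_derivative[OF assms(1,2) x] by (simp add: has_vector_derivative_def)
  from Deriv.has_derivative_inverse[OF assms(3)[OF x] this]
  show "((\<lambda>x. inverse (\<rho> x)) has_vector_derivative - (inverse (\<rho> x) * \<rho>' x * inverse (\<rho> x))) (at x within {0..1})"
    by (simp add: has_vector_derivative_def scaleR_conv_of_real algebra_simps)
qed

lemma prim_cexp:
  fixes \<Theta> \<theta> :: "real \<Rightarrow> complex"
  assumes "prim \<Theta> \<theta>" "continuous_on {0..1} \<theta>"
  shows "prim (\<lambda>x. exp (c * \<Theta> x)) (\<lambda>x. exp (c * \<Theta> x) * (c * \<theta> x))"
proof (rule primI_derivative)
  note C = prim_continuous[OF assms(1)]
  show "continuous_on {0..1} (\<lambda>x. exp (c * \<Theta> x) * (c * \<theta> x))"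
    using assms by (intro continuous_intros C) auto
  fix x :: real assume x: "x \<in> {0..1}"
  have "((\<lambda>x. c * \<Theta> x) has_vector_derivative c * \<theta> x) (at x within {0..1})"
    by (intro has_vector_derivative_mult_right prim_derivative[OF assms x])
  then have "((exp \<circ> (\<lambda>x. c * \<Theta> x)) has_vector_derivative c * \<theta> x * exp (c * \<Theta> x)) (at x within {0..1})"
    by (rule field_vector_diff_chain_within) (auto intro: DERIV_subset[OF DERIV_exp])
  then show "((\<lambda>x. exp (c * \<Theta> x)) has_vector_derivative exp (c * \<Theta> x) * (c * \<theta> x)) (at x within {0..1})"
    by (simp add: o_def mult.commute)
qed

lemma norm_sin_le_exp: "norm (sin z) \<le> exp \<bar>Im z\<bar>" for z :: complex
  using cmod_sin_le_exp[of 1 z] by simp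

lemma norm_cos_le_exp: "norm (cos z) \<le> exp \<bar>Im z\<bar>" for z :: complex
proof -
  have "norm (cos z) = norm (exp (\<i> * z) + exp (- (\<i> * z))) / 2"
    by (simp add: cos_exp_eq norm_divide)
  also have "\<dots> \<le> (norm (exp (\<i> * z)) + norm (exp (- (\<i> * z)))) / 2"
    by (intro divide_right_mono norm_triangle_ineq) auto
  also have "\<dots> \<le> (exp \<bar>Im z\<bar> + exp \<bar>Im z\<bar>) / 2"
    by (intro divide_right_mono add_mono) (auto simp: norm_exp_eq_Re)
  finally show ?thesis by simp
qed

text \<open>The quantities \<open>\<phi>' \<rho> - \<phi> \<rho>' \<plusminus> \<i> k \<phi> / \<rho>\<close>, multiplied by \<open>exp (\<mp> \<i> \<Theta>)\<close>, are constant up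
  to the residual \<open>R\<close> of the approximate solution \<open>\<rho> sin \<Theta>\<close>.\<close>

lemma liouville_green_error:
  fixes \<phi> \<phi>' \<rho> \<rho>' \<rho>'' q R \<Theta> :: "real \<Rightarrow> complex" and k :: complex
  assumes \<phi>: "prim \<phi> \<phi>'" "prim \<phi>' (\<lambda>x. (q x - k\<^sup>2) * \<phi> x)" "\<phi> 0 = 0" "\<phi>' 0 = 1"
    and q: "continuous_on {0..1} q"
    and \<rho>: "prim \<rho> \<rho>'" "prim \<rho>' \<rho>''"
    and \<rho>b: "\<And>x. x \<in> {0..1} \<Longrightarrow> 1 / 2 \<le> norm (\<rho> x) \<and> norm (\<rho> x) \<le> 2"
    and \<Theta>: "prim \<Theta> (\<lambda>x. k / (\<rho> x)\<^sup>2)" "\<Theta> 0 = 0"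
    and \<Theta>b: "\<And>t x. \<lbrakk>0 \<le> t; t \<le> x; x \<le> 1\<rbrakk> \<Longrightarrow> \<bar>Im (\<Theta> x - \<Theta> t)\<bar> \<le> \<bar>Im k\<bar> * (x - t) + 1"
    and R: "\<And>x. x \<in> {0..1} \<Longrightarrow> R x = \<rho>'' x + \<rho> x * (k\<^sup>2 - q x) - k\<^sup>2 / (\<rho> x) ^ 3"
    and I: "(\<lambda>x. norm (R x)) integrable_on {0..1}" "integral {0..1} (\<lambda>x. norm (R x)) \<le> I" 
      "12 * I \<le> norm k" and k: "k \<noteq> 0"
  shows "norm (k * \<phi> 1 - \<rho> 0 * \<rho> 1 * sin (\<Theta> 1)) \<le> 144 * exp \<bar>Im k\<bar> * I / norm k"
proof -
  define \<tau> where "\<tau> = \<bar>Im k\<bar>"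
  have \<rho>0: "\<rho> x \<noteq> 0" if "x \<in> {0..1}" for x using \<rho>b[OF that] by auto
  note c\<rho> = prim_continuous[OF \<rho>(1)] and c\<rho>' = prim_continuous[OF \<rho>(2)]
    and c\<phi> = prim_continuous[OF \<phi>(1)] and c\<Theta> = prim_continuous[OF \<Theta>(1)]
  have I0: "0 \<le> I" using I(2) integral_nonneg[OF I(1)] by simp
  have ck: "continuous_on {0..1} (\<lambda>x. k / (\<rho> x)\<^sup>2)"
    using \<rho>0 by (intro continuous_intros c\<rho>) auto
  have conserved: "((\<lambda>t. R t * \<phi> t * exp (- (\<i> * s) * \<Theta> t)) has_integral
        \<rho> 0 - (\<phi>' x * \<rho> x - \<phi> x * \<rho>' x + \<i> * s * k * \<phi> x / \<rho> x) * exp (- (\<i> * s) * \<Theta> x)) {0..x}"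
    if s: "s\<^sup>2 = 1" and x: "0 \<le> x" "x \<le> 1" for s :: complex and x
  proof -
    define z where "z x = \<phi>' x * \<rho> x - \<phi> x * \<rho>' x + \<i> * s * k * (\<phi> x * inverse (\<rho> x))" for x
    define w where "w x = ((q x - k\<^sup>2) * \<phi> x * \<rho> x + \<phi>' x * \<rho>' x) - (\<phi>' x * \<rho>' x + \<phi> x * \<rho>'' x) +
         \<i> * s * k * (\<phi>' x * inverse (\<rho> x) + \<phi> x * - (inverse (\<rho> x) * \<rho>' x * inverse (\<rho> x)))" for x
    have z: "prim z w"
      unfolding z_def[abs_def] w_def[abs_def]
      by (intro prim_add prim_diff prim_mult \<phi> \<rho> prim_linear[OF _ bounded_linear_mult_right] prim_cdivide c\<rho>' \<rho>0)
    have w: "w x = \<i> * s * (k / (\<rho> x)\<^sup>2) * z x - R x * \<phi> x" if x: "x \<in> {0..1}" for x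
    proof -
      have s': "s * (s * y) = y" for y using s by (simp add: power2_eq_square flip: mult.assoc)
      show ?thesis
        using \<rho>0[OF x] unfolding w_def z_def R[OF x]
        by (simp add: field_simps power2_eq_square power3_eq_cube s')
    qed
    have P: "prim (\<lambda>x. z x * exp (- (\<i> * s) * \<Theta> x))
        (\<lambda>x. w x * exp (- (\<i> * s) * \<Theta> x) + z x * (exp (- (\<i> * s) * \<Theta> x) * (- (\<i> * s) * (k / (\<rho> x)\<^sup>2))))"
      by (intro prim_mult z prim_cexp \<Theta> ck)
    have "prim (\<lambda>x. z x * exp (- (\<i> * s) * \<Theta> x)) (\<lambda>x. - (R x * \<phi> x * exp (- (\<i> * s) * \<Theta> x)))"
      by (rule prim_cong[OF P]) (simp_all add: w algebra_simps)
    from prim_has_integral[OF this order_refl x]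
    have "((\<lambda>x. - (R x * \<phi> x * exp (- (\<i> * s) * \<Theta> x))) has_integral
        z x * exp (- (\<i> * s) * \<Theta> x) - z 0 * exp (- (\<i> * s) * \<Theta> 0)) {0..x}" .
    from has_integral_neg[OF this] show ?thesis
      using \<phi>(3,4) \<Theta>(2) by (simp add: z_def divide_inverse mult.assoc)
  qed
  \<comment> \<open>\<open>m\<close> is the maximum of |\<phi>(x)| exp(-\<tau> x), a weighted norm
    in which the error can be absorbed. All that is kept is that it is nonnegative and the least
    such bound.\<close>
  obtain m where m: "\<And>x. x \<in> {0..1} \<Longrightarrow> norm (\<phi> x) \<le> m * exp (\<tau> * x)"
    and m_le: "\<And>b. (\<And>x. x \<in> {0..1} \<Longrightarrow> norm (\<phi> x) \<le> b * exp (\<tau> * x)) \<Longrightarrow> m \<le> b" and m0: "0 \<le> m"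
  proof -
    have "continuous_on {0..1} (\<lambda>x. norm (\<phi> x) * exp (- (\<tau> * x)))" by (intro continuous_intros c\<phi>)
    then obtain x0 where x0: "x0 \<in> {0..1}"
      "\<And>x. x \<in> {0..1} \<Longrightarrow> norm (\<phi> x) * exp (- (\<tau> * x)) \<le> norm (\<phi> x0) * exp (- (\<tau> * x0))"
      using continuous_attains_sup[of "{0..1::real}" "\<lambda>x. norm (\<phi> x) * exp (- (\<tau> * x))"] by force
    show ?thesis
    proof (rule that[of "norm (\<phi> x0) * exp (- (\<tau> * x0))"])
      show "norm (\<phi> x) \<le> norm (\<phi> x0) * exp (- (\<tau> * x0)) * exp (\<tau> * x)" if "x \<in> {0..1}" for x
        using mult_right_mono[OF x0(2)[OF that], of "exp (\<tau> * x)"] by (simp add: mult.assoc flip: exp_add)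
      show "norm (\<phi> x0) * exp (- (\<tau> * x0)) \<le> b" if "\<And>x. x \<in> {0..1} \<Longrightarrow> norm (\<phi> x) \<le> b * exp (\<tau> * x)" for b
        using mult_right_mono[OF that[OF x0(1)], of "exp (- (\<tau> * x0))"] by (simp add: mult.assoc flip: exp_add)
    qed simp
  qed
  have tail: "norm (exp (\<i> * s * \<Theta> x) * (\<rho> 0 - (\<phi>' x * \<rho> x - \<phi> x * \<rho>' x + \<i> * s * k * \<phi> x / \<rho> x) * exp (- (\<i> * s) * \<Theta> x)))
      \<le> exp (\<tau> * x + 1) * m * I" if s: "s = 1 \<or> s = -1" and x: "0 \<le> x" "x \<le> 1" for s :: complex and x
  proof -
    have s2: "s\<^sup>2 = 1" using s by auto
    note H = has_integral_mult_right[OF conserved[OF s2 x], of "exp (\<i> * s * \<Theta> x)"]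
    have iR: "(\<lambda>x. norm (R x)) integrable_on {0..x}"
      by (rule integrable_on_subinterval[OF I(1)]) (use x in auto)
    have IR: "integral {0..x} (\<lambda>x. norm (R x)) \<le> I"
      using integral_subset_le[OF _ iR I(1)] x I(2) by force
    have b: "norm (exp (\<i> * s * \<Theta> x) * (R t * \<phi> t * exp (- (\<i> * s) * \<Theta> t))) \<le> exp (\<tau> * x + 1) * m * norm (R t)"
      if t: "t \<in> {0..x}" for t
    proof -
      have "norm (exp (\<i> * s * (\<Theta> x - \<Theta> t))) \<le> exp (\<tau> * (x - t) + 1)"
        using s \<Theta>b[of t x] t x by (auto simp: norm_exp_eq_Re \<tau>_def)
      moreover have "norm (\<phi> t) \<le> m * exp (\<tau> * t)" using m t x by auto
      ultimately have "norm (R t) * (norm (exp (\<i> * s * (\<Theta> x - \<Theta> t))) * norm (\<phi> t)) \<le>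
          norm (R t) * (exp (\<tau> * (x - t) + 1) * (m * exp (\<tau> * t)))"
        using m0 by (intro mult_left_mono mult_mono) auto
      also have "exp (\<tau> * (x - t) + 1) * (m * exp (\<tau> * t)) = m * exp (\<tau> * x + 1)"
        by (simp add: algebra_simps flip: exp_add)
      finally have 1: "norm (R t) * (norm (exp (\<i> * s * (\<Theta> x - \<Theta> t))) * norm (\<phi> t)) \<le> exp (\<tau> * x + 1) * m * norm (R t)"
        by (simp add: mult_ac)
      have 2: "exp (\<i> * s * \<Theta> x) * (R t * \<phi> t * exp (- (\<i> * s) * \<Theta> t)) = R t * (exp (\<i> * s * (\<Theta> x - \<Theta> t)) * \<phi> t)"
        by (simp add: right_diff_distrib exp_diff exp_minus divide_inverse mult_ac)
      show ?thesis unfolding 2 norm_mult by (rule 1)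
    qed
    have "norm (exp (\<i> * s * \<Theta> x) * (\<rho> 0 - (\<phi>' x * \<rho> x - \<phi> x * \<rho>' x + \<i> * s * k * \<phi> x / \<rho> x) * exp (- (\<i> * s) * \<Theta> x)))
      \<le> integral {0..x} (\<lambda>t. exp (\<tau> * x + 1) * m * norm (R t))"
      unfolding integral_unique[OF H, symmetric]
      by (rule integral_norm_bound_integral[OF has_integral_integrable[OF H]
            has_integral_integrable[OF has_integral_mult_right[OF integrable_integral[OF iR]]] b])
    also have "\<dots> = exp (\<tau> * x + 1) * m * integral {0..x} (\<lambda>t. norm (R t))" by (rule integral_mult_right)
    also have "\<dots> \<le> exp (\<tau> * x + 1) * m * I" using IR m0 by (intro mult_left_mono) auto
    finally show ?thesis .
  qed
  have err: "norm (k * \<phi> x - \<rho> 0 * \<rho> x * sin (\<Theta> x)) \<le> 2 * (exp (\<tau> * x + 1) * m * I)" if x: "0 \<le> x" "x \<le> 1" for x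
  proof -
    have x': "x \<in> {0..1}" using x by auto
    define Zp where "Zp = \<phi>' x * \<rho> x - \<phi> x * \<rho>' x + \<i> * 1 * k * \<phi> x / \<rho> x"
    define Zm where "Zm = \<phi>' x * \<rho> x - \<phi> x * \<rho>' x + \<i> * (-1) * k * \<phi> x / \<rho> x"
    define Tp where "Tp = exp (\<i> * 1 * \<Theta> x) * (\<rho> 0 - Zp * exp (- (\<i> * 1) * \<Theta> x))"
    define Tm where "Tm = exp (\<i> * (-1) * \<Theta> x) * (\<rho> 0 - Zm * exp (- (\<i> * (-1)) * \<Theta> x))"
    have T: "norm Tp \<le> exp (\<tau> * x + 1) * m * I" "norm Tm \<le> exp (\<tau> * x + 1) * m * I"
      using tail[of 1 x] tail[of "-1" x] x unfolding Tp_def Tm_def Zp_def Zm_def by auto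
    have e: "exp (\<i> * \<Theta> x) * exp (- (\<i> * \<Theta> x)) = 1" by (simp flip: exp_add)
    have "Tp = exp (\<i> * \<Theta> x) * \<rho> 0 - Zp * (exp (\<i> * \<Theta> x) * exp (- (\<i> * \<Theta> x)))"
      unfolding Tp_def by (simp add: algebra_simps)
    then have Tp: "Tp = exp (\<i> * \<Theta> x) * \<rho> 0 - Zp" using e by simp
    have "Tm = exp (- (\<i> * \<Theta> x)) * \<rho> 0 - Zm * (exp (\<i> * \<Theta> x) * exp (- (\<i> * \<Theta> x)))"
      unfolding Tm_def by (simp add: algebra_simps)
    then have Tm: "Tm = exp (- (\<i> * \<Theta> x)) * \<rho> 0 - Zm" using e by simp
    \<comment> \<open>The two signs share every term except the one with k \<phi> / \<rho>;
      subtracting them removes \<phi>' and isolates k \<phi>.\<close>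
    have "Zp - Zm = 2 * \<i> * k * \<phi> x / \<rho> x" unfolding Zp_def Zm_def by simp
    moreover have "exp (\<i> * \<Theta> x) - exp (- (\<i> * \<Theta> x)) = 2 * \<i> * sin (\<Theta> x)" by (simp add: sin_exp_eq)
    ultimately have "Tp - Tm = 2 * \<i> * sin (\<Theta> x) * \<rho> 0 - 2 * \<i> * k * \<phi> x / \<rho> x"
      unfolding Tp Tm by (simp add: algebra_simps)
    then have "\<rho> x * (Tp - Tm) = 2 * \<i> * (\<rho> 0 * \<rho> x * sin (\<Theta> x) - k * \<phi> x)"
      using \<rho>0[OF x'] by (simp add: field_simps)
    then have "norm (\<rho> x) * norm (Tp - Tm) = 2 * norm (k * \<phi> x - \<rho> 0 * \<rho> x * sin (\<Theta> x))"
      by (metis norm_mult norm_minus_commute norm_ii mult.right_neutral norm_numeral)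
    moreover have "norm (\<rho> x) * norm (Tp - Tm) \<le> 2 * (exp (\<tau> * x + 1) * m * I + exp (\<tau> * x + 1) * m * I)"
      using \<rho>b[OF x'] T by (intro mult_mono order_trans[OF norm_triangle_ineq4] add_mono) auto
    moreover have "\<lbrakk>a = 2 * N; a \<le> 2 * (Y + Y)\<rbrakk> \<Longrightarrow> N \<le> 2 * Y" for a N Y :: real by simp
    ultimately show ?thesis by blast
  qed
  have e3: "exp 1 \<le> (3::real)" by (rule exp_le)
  have nk: "norm k > 0" using k by simp
  \<comment> \<open>A self-referential bound: the error contains \<open>m\<close> itself, and 12 I
    <= |k| makes its coefficient at most 1/2. Absorbing it gives m <= 24 / |k|.\<close>
  have "m \<le> (12 + 6 * m * I) / norm k"
  proof (rule m_le)
    fix x :: real assume x: "x \<in> {0..1}"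
    have "norm (\<rho> 0 * \<rho> x * sin (\<Theta> x)) \<le> 2 * 2 * exp (\<tau> * x + 1)"
      unfolding norm_mult
    proof (intro mult_mono)
      have "\<bar>Im (\<Theta> x)\<bar> \<le> \<tau> * x + 1" using \<Theta>b[of 0 x] x \<Theta>(2) by (simp add: \<tau>_def)
      then show "norm (sin (\<Theta> x)) \<le> exp (\<tau> * x + 1)"
        by (intro order_trans[OF norm_sin_le_exp]) simp
    qed (use \<rho>b[of 0] \<rho>b[OF x] in auto)
    moreover have "norm (k * \<phi> x) \<le> norm (k * \<phi> x - \<rho> 0 * \<rho> x * sin (\<Theta> x)) + norm (\<rho> 0 * \<rho> x * sin (\<Theta> x))"
      using norm_triangle_ineq[of "k * \<phi> x - \<rho> 0 * \<rho> x * sin (\<Theta> x)" "\<rho> 0 * \<rho> x * sin (\<Theta> x)"] by simp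
    ultimately have "norm (k * \<phi> x) \<le> exp (\<tau> * x) * exp 1 * (4 + 2 * m * I)"
      using err[of x] x by (simp add: exp_add algebra_simps)
    also have "\<dots> \<le> exp (\<tau> * x) * 3 * (4 + 2 * m * I)"
      using e3 m0 I0 by (intro mult_right_mono mult_left_mono) auto
    finally show "norm (\<phi> x) \<le> (12 + 6 * m * I) / norm k * exp (\<tau> * x)"
      using nk by (simp add: norm_mult field_simps)
  qed
  also have "\<dots> \<le> (12 + m * norm k / 2) / norm k"
    using mult_left_mono[OF I(3) m0] nk by (intro divide_right_mono) auto
  also have "\<dots> = 12 / norm k + m / 2" using nk by (simp add: field_simps)
  finally have mb: "m \<le> 24 / norm k" by simp
  \<comment> \<open>The constant 144 is 2 * 3 * 24, where 3 bounds exp 1.\<close>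
  have "norm (k * \<phi> 1 - \<rho> 0 * \<rho> 1 * sin (\<Theta> 1)) \<le> 2 * (exp \<tau> * exp 1 * m * I)"
    using err[of 1] by (simp add: exp_add)
  also have "\<dots> \<le> 2 * (exp \<tau> * 3 * (24 / norm k) * I)"
    using e3 mb m0 I0 nk by (intro mult_left_mono mult_mono mult_right_mono) auto
  finally show ?thesis by (simp add: \<tau>_def mult_ac)
qed


text \<open>\<open>M\<close> is the single parameter on which all later constants depend. The
  function and its first three derivatives are bounded pointwise, the fourth only in the mean: this
  is what a bound on the Sobolev norm of order 4 yields.\<close>

definition admissible :: "real \<Rightarrow> (real \<Rightarrow> real) \<Rightarrow> (real \<Rightarrow> real) \<Rightarrow> (real \<Rightarrow> real) \<Rightarrow> (real \<Rightarrow> real) \<Rightarrow>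
    (real \<Rightarrow> real) \<Rightarrow> bool" where
  "admissible M q0 q1 q2 q3 q4 \<longleftrightarrow>
     prim q0 q1 \<and> prim q1 q2 \<and> prim q2 q3 \<and> prim q3 q4 \<and>
     (\<forall>x\<in>{0..1}. \<bar>q0 x\<bar> \<le> M \<and> \<bar>q1 x\<bar> \<le> M \<and> \<bar>q2 x\<bar> \<le> M \<and> \<bar>q3 x\<bar> \<le> M) \<and>
     integral {0..1} (\<lambda>x. \<bar>q4 x\<bar>) \<le> M"

text \<open>The k^-4 coefficient v of the amplitude: 4 v = 10 u^2 - u'' with u = q/4.\<close>

definition lgv :: "(real \<Rightarrow> real) \<Rightarrow> (real \<Rightarrow> real) \<Rightarrow> real \<Rightarrow> real" where
  "lgv q0 q2 x = 5 * (q0 x)\<^sup>2 / 32 - q2 x / 16"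

text \<open>E is u(0) + u(1), and F below is v(0) + v(1) + u(0) u(1): the coefficients of k^-2 and
  k^-4 in the product \<rho>(0) \<rho>(1) of the end amplitudes.\<close>

definition coeffE :: "(real \<Rightarrow> real) \<Rightarrow> real" where
  "coeffE q0 = (q0 0 + q0 1) / 4"

definition coeffF :: "(real \<Rightarrow> real) \<Rightarrow> (real \<Rightarrow> real) \<Rightarrow> real" where
  "coeffF q0 q2 = lgv q0 q2 0 + lgv q0 q2 1 + q0 0 * q0 1 / 16"

text \<open>The integral of 3 u^2 - 2 v, which is the k^-3 coefficient of the phase at 1.\<close>

definition coeffB :: "(real \<Rightarrow> real) \<Rightarrow> (real \<Rightarrow> real) \<Rightarrow> real" where
  "coeffB q0 q2 = integral {0..1} (\<lambda>x. (q2 x - (q0 x)\<^sup>2) / 8)"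

text \<open>The amplitude is \<open>\<rho> = 1 + u/k\<^sup>2 + v/k\<^sup>4\<close> and the phase is \<open>k \<integral> \<rho>\<^sup>-\<^sup>2\<close>.  The choice \<open>4 u = q\<close>,
  \<open>4 v = 10 u\<^sup>2 - u''\<close> cancels the two leading orders of the Ermakov equation
  \<open>\<rho>'' + (k\<^sup>2 - q) \<rho> = k\<^sup>2 \<rho>\<^sup>-\<^sup>3\<close>; \<open>resQ\<close> collects what remains of it, apart from the term in \<open>v''\<close>,
  and \<open>resZ\<close> what remains of \<open>\<rho>\<^sup>-\<^sup>2\<close> after its expansion to second order.\<close>

definition resQ :: "complex \<Rightarrow> complex \<Rightarrow> complex \<Rightarrow> complex \<Rightarrow> complex" where
  "resQ u v w e = (let s = u + v * e in
     12 * u * v + 6 * v\<^sup>2 * e - 16 * u * v + w * (3 * s + 3 * e * s\<^sup>2 + e\<^sup>2 * s ^ 3)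
     + 4 * s ^ 3 + e * s ^ 4 - 4 * u * (6 * s\<^sup>2 + 4 * e * s ^ 3 + e\<^sup>2 * s ^ 4))"

definition resZ :: "complex \<Rightarrow> complex \<Rightarrow> complex \<Rightarrow> complex" where
  "resZ u v e = (4 * u ^ 3 - 6 * u * v) + e * (v\<^sup>2 - 4 * u\<^sup>2 * v + (u\<^sup>2 + 2 * v) * (3 * u\<^sup>2 - 2 * v))
     + e\<^sup>2 * (- 2 * u * v\<^sup>2 + 2 * u * v * (3 * u\<^sup>2 - 2 * v)) + e ^ 3 * v\<^sup>2 * (3 * u\<^sup>2 - 2 * v)"

text \<open>With e = k^-2 and w = u'' the left-hand side is e \<rho>^3 times the residual of the
  Ermakov equation without its v'' term. Order e cancels by 4 u = q, built into the factor 1 - 4 u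
  e, and order e^2 by the hypothesis.\<close>

lemma resQ_identity:
  assumes "4 * v = 10 * u\<^sup>2 - w"
  shows "w * e * (1 + u * e + v * e\<^sup>2) ^ 3 * e + (1 - 4 * u * e) * (1 + u * e + v * e\<^sup>2) ^ 4 - 1 = e ^ 3 * resQ u v w e"
proof -
  have w: "w = 10 * u\<^sup>2 - 4 * v" using assms by (simp add: algebra_simps)
  show ?thesis unfolding resQ_def Let_def w by algebra
qed

text \<open>The second factor is \<rho>^-2 expanded to second order in e, so its product with
  \<rho>^2 differs from 1 by order e^3.\<close>

lemma resZ_identity:
  "1 - (1 + u * e + v * e\<^sup>2)\<^sup>2 * (1 - 2 * u * e + (3 * u\<^sup>2 - 2 * v) * e\<^sup>2) = - (e ^ 3 * resZ u v e)"
  unfolding resZ_def by algebra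

text \<open>Continuity on a compact domain supplies the constant; what matters is that it depends on
  \<open>L\<close> alone.\<close>

lemma resQ_bound: "\<exists>C\<ge>0. \<forall>u v w e. norm u \<le> L \<longrightarrow> norm v \<le> L \<longrightarrow> norm w \<le> L \<longrightarrow> norm e \<le> 1 \<longrightarrow> norm (resQ u v w e) \<le> C"
proof -
  let ?S = "cball 0 L \<times> cball 0 L \<times> cball 0 L \<times> cball (0::complex) 1"
  have "continuous_on ?S (\<lambda>(u, v, w, e). resQ u v w e)"
    unfolding resQ_def Let_def case_prod_unfold by (intro continuous_intros)
  then have "bounded ((\<lambda>(u, v, w, e). resQ u v w e) ` ?S)"
    by (intro compact_imp_bounded compact_continuous_image compact_Times compact_cball)
  then obtain C where C: "0 < C" "\<And>y. y \<in> (\<lambda>(u, v, w, e). resQ u v w e) ` ?S \<Longrightarrow> norm y \<le> C"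
    unfolding bounded_pos by blast
  have "norm (resQ u v w e) \<le> C" if "norm u \<le> L" "norm v \<le> L" "norm w \<le> L" "norm e \<le> 1" for u v w e
    by (rule C(2), rule image_eqI[of _ _ "(u, v, w, e)"]) (use that in auto)
  then show ?thesis using C(1) by (intro exI[of _ C]) auto
qed

lemma resZ_bound: "\<exists>C\<ge>0. \<forall>u v e. norm u \<le> L \<longrightarrow> norm v \<le> L \<longrightarrow> norm e \<le> 1 \<longrightarrow> norm (resZ u v e) \<le> C"
proof -
  let ?S = "cball 0 L \<times> cball 0 L \<times> cball (0::complex) 1"
  have "continuous_on ?S (\<lambda>(u, v, e). resZ u v e)"
    unfolding resZ_def case_prod_unfold by (intro continuous_intros)
  then have "bounded ((\<lambda>(u, v, e). resZ u v e) ` ?S)"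
    by (intro compact_imp_bounded compact_continuous_image compact_Times compact_cball)
  then obtain C where C: "0 < C" "\<And>y. y \<in> (\<lambda>(u, v, e). resZ u v e) ` ?S \<Longrightarrow> norm y \<le> C"
    unfolding bounded_pos by blast
  have "norm (resZ u v e) \<le> C" if "norm u \<le> L" "norm v \<le> L" "norm e \<le> 1" for u v e
    by (rule C(2), rule image_eqI[of _ _ "(u, v, e)"]) (use that in auto)
  then show ?thesis using C(1) by (intro exI[of _ C]) auto
qed

text \<open>To be read with \<open>\<eta>\<close> a phase correction and \<open>b\<close> its
  leading part. The addition formula leaves cos \<eta> - 1 and sin \<eta> - \<eta>, both at most 3
  |\<eta>|^2 because exp |Im \<eta>| <= 3, while exp |Im z| bounds sin z and cos z.\<close>

lemma sin_add_expansion: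
  fixes z \<eta> b :: complex
  assumes "norm \<eta> \<le> 1"
  shows "norm (sin (z + \<eta>) - sin z - b * cos z) \<le> exp \<bar>Im z\<bar> * (6 * (norm \<eta>)\<^sup>2 + norm (\<eta> - b))"
proof -
  have i: "exp \<bar>Im \<eta>\<bar> \<le> 3"
  proof -
    have "\<bar>Im \<eta>\<bar> \<le> 1" using abs_Im_le_cmod[of \<eta>] assms by linarith
    then have "exp \<bar>Im \<eta>\<bar> \<le> exp (1::real)" by simp
    then show ?thesis using exp_le by linarith
  qed
  have c: "norm (cos \<eta> - 1) \<le> 3 * (norm \<eta>)\<^sup>2"
  proof -
    have "norm (cos \<eta> - 1) \<le> exp \<bar>Im \<eta>\<bar> * (norm \<eta>)\<^sup>2"
      using Taylor_cos[of \<eta> 1] by (simp add: power2_eq_square cos_coeff_def)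
    also have "\<dots> \<le> 3 * (norm \<eta>)\<^sup>2" using i by (intro mult_right_mono) auto
    finally show ?thesis .
  qed
  have s: "norm (sin \<eta> - \<eta>) \<le> 3 * (norm \<eta>)\<^sup>2"
  proof -
    have "norm (sin \<eta> - \<eta>) \<le> exp \<bar>Im \<eta>\<bar> * (norm \<eta>)\<^sup>2"
      using Taylor_sin[of \<eta> 1] by (simp add: power2_eq_square sin_coeff_def)
    also have "\<dots> \<le> 3 * (norm \<eta>)\<^sup>2" using i by (intro mult_right_mono) auto
    finally show ?thesis .
  qed
  have "sin (z + \<eta>) - sin z - b * cos z = sin z * (cos \<eta> - 1) + cos z * ((sin \<eta> - \<eta>) + (\<eta> - b))"
    by (simp add: sin_add algebra_simps)
  also have "norm \<dots> \<le> exp \<bar>Im z\<bar> * (3 * (norm \<eta>)\<^sup>2) + exp \<bar>Im z\<bar> * (3 * (norm \<eta>)\<^sup>2 + norm (\<eta> - b))"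
    by (intro order_trans[OF norm_triangle_ineq] add_mono)
       (use s norm_triangle_ineq[of "sin \<eta> - \<eta>" "\<eta> - b"] in
         \<open>auto simp: norm_mult intro!: mult_mono norm_sin_le_exp norm_cos_le_exp c\<close>)
  finally show ?thesis by (simp add: algebra_simps)
qed


section \<open>Expansion of the characteristic function at large k\<close>

lemma prim_of_real: "prim f g \<Longrightarrow> prim (\<lambda>x. complex_of_real (f x)) (\<lambda>x. complex_of_real (g x))"
  by (rule prim_linear[OF _ bounded_linear_of_real])

lemma lgv_prim:
  assumes "prim q0 q1" "prim q1 q2" "prim q2 q3" "prim q3 q4"
  shows "prim (lgv q0 q2) (\<lambda>x. 5 * q0 x * q1 x / 16 - q3 x / 16)"
    "prim (\<lambda>x. 5 * q0 x * q1 x / 16 - q3 x / 16) (\<lambda>x. 5 * ((q1 x)\<^sup>2 + q0 x * q2 x) / 16 - q4 x / 16)"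
proof -
  have "prim (\<lambda>x. 5 / 32 * (q0 x * q0 x) - 1 / 16 * q2 x) (\<lambda>x. 5 / 32 * (q1 x * q0 x + q0 x * q1 x) - 1 / 16 * q3 x)"
    by (intro prim_diff prim_linear[OF _ bounded_linear_mult_right] prim_mult_real assms)
  then show "prim (lgv q0 q2) (\<lambda>x. 5 * q0 x * q1 x / 16 - q3 x / 16)"
    by (rule prim_cong) (auto simp: lgv_def power2_eq_square algebra_simps)
  have "prim (\<lambda>x. 5 / 16 * (q0 x * q1 x) - 1 / 16 * q3 x) (\<lambda>x. 5 / 16 * (q1 x * q1 x + q0 x * q2 x) - 1 / 16 * q4 x)"
    by (intro prim_diff prim_linear[OF _ bounded_linear_mult_right] prim_mult_real assms)
  then show "prim (\<lambda>x. 5 * q0 x * q1 x / 16 - q3 x / 16) (\<lambda>x. 5 * ((q1 x)\<^sup>2 + q0 x * q2 x) / 16 - q4 x / 16)"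
    by (rule prim_cong) (auto simp: power2_eq_square algebra_simps)
qed

definition lg_main :: "(real \<Rightarrow> real) \<Rightarrow> (real \<Rightarrow> real) \<Rightarrow> complex \<Rightarrow> complex" where
  "lg_main q0 q2 k = sin k * (1 + of_real (coeffE q0) / k\<^sup>2 + of_real (coeffF q0 q2) / k ^ 4)
     + of_real (coeffB q0 q2) * cos k / k ^ 3"

text \<open>\<open>liouville_green_error\<close> replaces k \<Delta>(k^2) by \<rho>(0) \<rho>(1) sin
  \<Theta>(1); amplitude product and phase are then expanded separately. The constants are
  quantified before the potential, so they depend on \<open>M\<close> only.\<close>

lemma liouville_green_expansion:
  assumes M: "1 \<le> M"
  shows "\<exists>A K. 0 \<le> A \<and> 1 \<le> K \<and> (\<forall>q0 q1 q2 q3 q4 k. admissible M q0 q1 q2 q3 q4 \<longrightarrow> integral {0..1} q0 = 0 \<longrightarrow> K \<le> norm k \<longrightarrow>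
     norm (k * char_fun q0 (k\<^sup>2) - lg_main q0 q2 k) \<le> A * exp \<bar>Im k\<bar> / norm k ^ 5)"
proof -
  \<comment> \<open>\<open>L\<close> bounds \<open>M\<close> as well as products of two quantities
    bounded by \<open>M\<close>.\<close>
  define L where "L = M\<^sup>2"
  have L1: "1 \<le> L" using M by (simp add: L_def)
  have MleL: "M \<le> L" using M by (simp add: L_def power2_eq_square)
  obtain C1 where C1: "0 \<le> C1" "\<And>u v w e. \<lbrakk>norm u \<le> L; norm v \<le> L; norm w \<le> L; norm e \<le> 1\<rbrakk> \<Longrightarrow> norm (resQ u v w e) \<le> C1"
    using resQ_bound[of L] by blast
  obtain C2 where C2: "0 \<le> C2" "\<And>u v e. \<lbrakk>norm u \<le> L; norm v \<le> L; norm e \<le> 1\<rbrakk> \<Longrightarrow> norm (resZ u v e) \<le> C2"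
    using resZ_bound[of L] by blast
  define C3 where "C3 = L + 4 * C2"
  define C4 where "C4 = 6 * C3\<^sup>2 + 4 * C2"
  define A where "A = 144 * (L + 8 * C1) + 3 * C4 + 12 * L\<^sup>2"
  \<comment> \<open>The summand 20 L keeps |\<rho> - 1| below 1/2, 12 (L + 8 C1) secures 12 I <=
    |k|, and C3 secures |\<eta>| <= 1. The first two together keep the derivative of the phase
    within 1 of k.\<close>
  define K where "K = 20 * L + 12 * (L + 8 * C1) + C3"
  have K20: "20 * L \<le> K" and K12: "12 * (L + 8 * C1) \<le> K" and K3: "C3 \<le> K" and K1: "1 \<le> K"
    using L1 C1(1) C2(1) by (auto simp: K_def C3_def)
  have A0: "0 \<le> A" using L1 C1(1) C2(1) by (auto simp: A_def C4_def)
  have "norm (k * char_fun q0 (k\<^sup>2) - lg_main q0 q2 k) \<le> A * exp \<bar>Im k\<bar> / norm k ^ 5"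
    if adm: "admissible M q0 q1 q2 q3 q4" and mean: "integral {0..1} q0 = 0" and Kk: "K \<le> norm k" for q0 q1 q2 q3 q4 k
  proof -
    have p: "prim q0 q1" "prim q1 q2" "prim q2 q3" "prim q3 q4"
      and b: "\<And>x. x \<in> {0..1} \<Longrightarrow> \<bar>q0 x\<bar> \<le> M" "\<And>x. x \<in> {0..1} \<Longrightarrow> \<bar>q1 x\<bar> \<le> M"
        "\<And>x. x \<in> {0..1} \<Longrightarrow> \<bar>q2 x\<bar> \<le> M"
      and b4: "integral {0..1} (\<lambda>x. \<bar>q4 x\<bar>) \<le> M"
      using adm unfolding admissible_def by auto
    note c0 = prim_continuous[OF p(1)] and c1 = prim_continuous[OF p(2)] and c2 = prim_continuous[OF p(3)]
    define kk where "kk = norm k"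
    have kk: "K \<le> kk" "1 \<le> kk" "0 < kk" using Kk K1 by (auto simp: kk_def)
    have k0: "k \<noteq> 0" using kk by (auto simp: kk_def)
    define e where "e = inverse (k\<^sup>2)"
    have ne: "norm e = 1 / kk\<^sup>2" by (simp add: e_def kk_def norm_inverse norm_power divide_inverse)
    have ke: "k\<^sup>2 * e = 1" using k0 by (simp add: e_def)
    have kk2: "20 * L \<le> kk\<^sup>2"
    proof -
      have "20 * L * 1 \<le> kk * kk" using K20 kk L1 by (intro mult_mono) auto
      then show ?thesis by (simp add: power2_eq_square)
    qed
    have e1: "L * norm e \<le> 1 / 20" using kk2 kk L1 by (simp add: ne field_simps)
    have e2: "norm e \<le> 1 / 20"
    proof -
      have "1 * norm e \<le> L * norm e" using L1 by (intro mult_right_mono) auto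
      then show ?thesis using e1 by simp
    qed
    define u where "u x = complex_of_real (q0 x / 4)" for x
    define v where "v x = complex_of_real (lgv q0 q2 x)" for x
    define w where "w x = complex_of_real (q2 x / 4)" for x
    define v'' where "v'' x = 5 * ((q1 x)\<^sup>2 + q0 x * q2 x) / 16 - q4 x / 16" for x
    have ub: "norm (u x) \<le> L" and wb: "norm (w x) \<le> L" if "x \<in> {0..1}" for x
      using b[OF that] MleL M by (auto simp: u_def w_def norm_divide)
    have vb: "norm (v x) \<le> L" if "x \<in> {0..1}" for x
    proof -
      have "(q0 x)\<^sup>2 \<le> M\<^sup>2" using b(1)[OF that] M by (simp add: abs_le_square_iff[symmetric])
      then have "\<bar>lgv q0 q2 x\<bar> \<le> 5 * L / 32 + L / 16"
        using b(3)[OF that] MleL zero_le_power2[of "q0 x"] unfolding lgv_def L_def by linarith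
      then show ?thesis using L1 unfolding v_def by simp
    qed
    have uvw: "4 * v x = 10 * (u x)\<^sup>2 - w x" for x
      by (simp add: u_def v_def w_def lgv_def power2_eq_square field_simps)
    define \<rho> where "\<rho> x = 1 + u x * e + v x * e\<^sup>2" for x
    define \<rho>' where "\<rho>' x = complex_of_real (q1 x) * (e / 4) + complex_of_real (5 * q0 x * q1 x / 16 - q3 x / 16) * e\<^sup>2" for x
    define \<rho>'' where "\<rho>'' x = complex_of_real (q2 x) * (e / 4) + complex_of_real (v'' x) * e\<^sup>2" for x
    have "prim (\<lambda>x. complex_of_real (q0 x) * (e / 4) + complex_of_real (lgv q0 q2 x) * e\<^sup>2 + 1) (\<lambda>x. \<rho>' x + 0)"
      unfolding \<rho>'_def
      by (intro prim_add prim_linear[OF prim_of_real bounded_linear_mult_left] p lgv_prim(1)[OF p] prim_const)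
    then have \<rho>1: "prim \<rho> \<rho>'" by (rule prim_cong) (auto simp: \<rho>_def u_def v_def)
    have \<rho>2: "prim \<rho>' \<rho>''"
      unfolding \<rho>'_def[abs_def] \<rho>''_def[abs_def] v''_def
      by (intro prim_add prim_linear[OF prim_of_real bounded_linear_mult_left] p lgv_prim(2)[OF p])
    note c\<rho> = prim_continuous[OF \<rho>1]
    have \<rho>close: "norm (\<rho> x - 1) \<le> 2 * L * norm e" if x: "x \<in> {0..1}" for x
    proof -
      have "norm (\<rho> x - 1) \<le> norm (u x) * norm e + norm (v x) * (norm e)\<^sup>2"
        unfolding \<rho>_def using norm_triangle_ineq[of "u x * e" "v x * e\<^sup>2"]
        by (simp add: norm_mult norm_power)
      also have "\<dots> \<le> L * norm e + L * (norm e * 1)"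
        using ub[OF x] vb[OF x] e2 L1 unfolding power2_eq_square by (intro add_mono mult_mono) auto
      finally show ?thesis by simp
    qed
    have \<rho>half: "norm (\<rho> x - 1) \<le> 1 / 2" if "x \<in> {0..1}" for x
      using \<rho>close[OF that] e1 by simp
    have \<rho>b: "1 / 2 \<le> norm (\<rho> x) \<and> norm (\<rho> x) \<le> 2" if x: "x \<in> {0..1}" for x
      using \<rho>half[OF x] norm_triangle_ineq2[of 1 "1 - \<rho> x"] norm_triangle_ineq[of "\<rho> x - 1" 1]
      by (simp add: norm_minus_commute)
    have \<rho>0: "\<rho> x \<noteq> 0" if "x \<in> {0..1}" for x using \<rho>b[OF that] by auto
    have \<rho>i: "norm (1 / (\<rho> x) ^ n) \<le> 2 ^ n" if "x \<in> {0..1}" for x n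
    proof -
      have "norm (\<rho> x) > 0" using \<rho>0[OF that] by simp
      then have "1 / norm (\<rho> x) \<le> 2" using \<rho>b[OF that] by (simp add: field_simps)
      then have "(1 / norm (\<rho> x)) ^ n \<le> 2 ^ n" by (intro power_mono) auto
      then show ?thesis by (simp add: norm_divide norm_power power_one_over)
    qed
    define \<Theta> where "\<Theta> x = integral {0..x} (\<lambda>x. k / (\<rho> x)\<^sup>2)" for x
    have \<Theta>: "prim \<Theta> (\<lambda>x. k / (\<rho> x)\<^sup>2)"
      unfolding \<Theta>_def by (intro prim_integral continuous_intros c\<rho>) (use \<rho>0 in auto)
    have \<Theta>0: "\<Theta> 0 = 0" by (simp add: \<Theta>_def)
    \<comment> \<open>The phase stays within bounded distance of k x since k/\<rho>^2 - k is
      O(1/|k|); this makes its exponentials comparable with those of k x.\<close>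
    have \<Theta>b: "\<bar>Im (\<Theta> x - \<Theta> t)\<bar> \<le> \<bar>Im k\<bar> * (x - t) + 1" if tx: "0 \<le> t" "t \<le> x" "x \<le> 1" for t x
    proof -
      have P: "prim (\<lambda>x. \<Theta> x - k * of_real x) (\<lambda>x. k / (\<rho> x)\<^sup>2 - k * 1)"
        by (intro prim_diff \<Theta> prim_linear[OF _ bounded_linear_mult_right])
           (auto intro!: primI_derivative derivative_eq_intros)
      have bd: "norm (k / (\<rho> s)\<^sup>2 - k * 1) \<le> 1" if s: "s \<in> {0..1}" for s
      proof -
        have "norm (\<rho> s + 1) \<le> 3" using \<rho>b[OF s] norm_triangle_ineq[of "\<rho> s" 1] by simp
        then have 1: "norm (1 - \<rho> s) * norm (\<rho> s + 1) \<le> (2 * L * norm e) * 3"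
          using \<rho>close[OF s] L1 by (intro mult_mono) (auto simp: norm_minus_commute)
        define X where "X = (1 - \<rho> s) * (\<rho> s + 1)"
        have X: "norm X \<le> 6 * L * norm e" using 1 by (simp add: X_def norm_mult)
        have "k / (\<rho> s)\<^sup>2 - k * 1 = k * X * (1 / (\<rho> s)\<^sup>2)"
          using \<rho>0[OF s] by (simp add: X_def field_simps power2_eq_square)
        also have "norm \<dots> \<le> kk * (6 * L * norm e) * 2\<^sup>2"
          unfolding norm_mult kk_def[symmetric] using X kk \<rho>i[OF s, of 2] L1 by (intro mult_mono) auto
        also have "\<dots> = 24 * L / kk" using kk by (simp add: ne power2_eq_square)
        also have "\<dots> \<le> 1" using K12 K20 kk C1(1) C2(1) L1 unfolding K_def C3_def by simp
        finally show ?thesis .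
      qed
      let ?G = "\<lambda>x. \<Theta> x - k * of_real x"
      note H = prim_has_integral[OF P tx]
      have "norm (?G x - ?G t) \<le> 1 * (x - t)"
        using has_integral_bound_real[OF zero_le_one finite.emptyI H] bd tx by simp
      then have 1: "norm (?G x - ?G t) \<le> 1" using tx by simp
      have "Im (\<Theta> x - \<Theta> t) = Im (?G x - ?G t) + Im k * (x - t)" by (simp add: algebra_simps)
      then have "\<bar>Im (\<Theta> x - \<Theta> t)\<bar> \<le> \<bar>Im (?G x - ?G t)\<bar> + \<bar>Im k\<bar> * (x - t)"
        using abs_triangle_ineq[of "Im (?G x - ?G t)" "Im k * (x - t)"] tx by (simp add: abs_mult)
      moreover have "\<bar>Im (?G x - ?G t)\<bar> \<le> 1" using 1 abs_Im_le_cmod order_trans by blast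
      ultimately show ?thesis by linarith
    qed
    define R where "R x = \<rho>'' x + \<rho> x * (k\<^sup>2 - complex_of_real (q0 x)) - k\<^sup>2 / (\<rho> x) ^ 3" for x
    have R: "R x = e\<^sup>2 * (of_real (v'' x) + resQ (u x) (v x) (w x) e * (1 / (\<rho> x) ^ 3))" if x: "x \<in> {0..1}" for x
    proof -
      have q: "complex_of_real (q0 x) = 4 * u x" "complex_of_real (q2 x) = 4 * w x" by (auto simp: u_def w_def)
      have "e * ((\<rho> x) ^ 3 * R x) = e * ((\<rho> x) ^ 3 * \<rho>'' x) + (k\<^sup>2 * e - e * of_real (q0 x)) * (\<rho> x) ^ 4 - k\<^sup>2 * e"
        using \<rho>0[OF x] unfolding R_def by (simp add: field_simps numeral_eq_Suc)
      also have "\<dots> = (w x * e * (\<rho> x) ^ 3 * e + (1 - 4 * u x * e) * (\<rho> x) ^ 4 - 1) + e ^ 3 * (of_real (v'' x) * (\<rho> x) ^ 3)"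
        unfolding ke q \<rho>''_def by (simp add: algebra_simps numeral_eq_Suc)
      also have "\<dots> = e ^ 3 * resQ (u x) (v x) (w x) e + e ^ 3 * (of_real (v'' x) * (\<rho> x) ^ 3)"
        using resQ_identity[OF uvw] unfolding \<rho>_def by simp
      also have "\<dots> = e * (e\<^sup>2 * (resQ (u x) (v x) (w x) e + of_real (v'' x) * (\<rho> x) ^ 3))"
        by (simp add: algebra_simps numeral_eq_Suc)
      finally have "(\<rho> x) ^ 3 * R x = e\<^sup>2 * (resQ (u x) (v x) (w x) e + of_real (v'' x) * (\<rho> x) ^ 3)"
        using k0 by (simp add: e_def)
      then show ?thesis using \<rho>0[OF x] by (simp add: field_simps)
    qed
    define I where "I = (L + 8 * C1) / kk ^ 4"
    have Ra: "R absolutely_integrable_on {0..1}"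
    proof -
      have "(\<lambda>x. \<rho> x * (k\<^sup>2 - complex_of_real (q0 x)) - k\<^sup>2 / (\<rho> x) ^ 3) absolutely_integrable_on {0..1}"
        by (intro absolutely_integrable_continuous_real continuous_intros c\<rho> c0) (use \<rho>0 in auto)
      from set_integral_add(1)[OF prim_abs[OF \<rho>2] this] show ?thesis
        unfolding R_def by (simp add: add_diff_eq)
    qed
    have Ri: "(\<lambda>x. norm (R x)) integrable_on {0..1}"
      using Ra unfolding absolutely_integrable_on_def by simp
    have v''a: "v'' absolutely_integrable_on {0..1}"
      using prim_abs[OF lgv_prim(2)[OF p]] unfolding v''_def .
    have q4i: "(\<lambda>x. \<bar>q4 x\<bar>) integrable_on {0..1}"
      using prim_abs[OF p(4)] unfolding absolutely_integrable_on_def by simp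
    \<comment> \<open>Only a bound in the mean is possible, as \<open>v''\<close> contains
      \<open>q4\<close>. The factor |e|^2 = |k|^-4 becomes the error |k|^-5 after the division by
      |k| in \<open>liouville_green_error\<close>.\<close>
    have RI: "integral {0..1} (\<lambda>x. norm (R x)) \<le> I"
    proof -
      have "integral {0..1} (\<lambda>x. norm (R x)) \<le> integral {0..1} (\<lambda>x. (norm e)\<^sup>2 * (1 / 16 * \<bar>q4 x\<bar> + (10 * L / 16 + 8 * C1)))"
      proof (rule integral_le[OF Ri])
        show "(\<lambda>x. (norm e)\<^sup>2 * (1 / 16 * \<bar>q4 x\<bar> + (10 * L / 16 + 8 * C1))) integrable_on {0..1}"
          using has_integral_integrable[OF has_integral_mult_right[OF has_integral_add[OF
            has_integral_mult_right[OF integrable_integral[OF q4i]] has_integral_const_real]]] by blast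
        fix x :: real assume x: "x \<in> {0..1}"
        have "(q1 x)\<^sup>2 \<le> L" unfolding L_def using b(2)[OF x] M by (simp add: abs_le_square_iff[symmetric])
        moreover have "\<bar>q0 x * q2 x\<bar> \<le> L"
          unfolding L_def power2_eq_square abs_mult using b(1,3)[OF x] M by (intro mult_mono) auto
        ultimately have v: "\<bar>v'' x\<bar> \<le> 10 * L / 16 + \<bar>q4 x\<bar> / 16"
        proof -
          define a where "a = (q1 x)\<^sup>2 + q0 x * q2 x"
          assume "(q1 x)\<^sup>2 \<le> L" "\<bar>q0 x * q2 x\<bar> \<le> L"
          then have "\<bar>a\<bar> \<le> 2 * L" unfolding a_def using zero_le_power2[of "q1 x"] by linarith
          then show ?thesis unfolding v''_def a_def[symmetric] by linarith
        qed
        have "norm (resQ (u x) (v x) (w x) e * (1 / (\<rho> x) ^ 3)) \<le> C1 * 2 ^ 3"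
          unfolding norm_mult using C1 e2 ub[OF x] vb[OF x] wb[OF x] \<rho>i[OF x, of 3] by (intro mult_mono) auto
        then have "norm (of_real (v'' x) + resQ (u x) (v x) (w x) e * (1 / (\<rho> x) ^ 3)) \<le> 1 / 16 * \<bar>q4 x\<bar> + (10 * L / 16 + 8 * C1)"
          using v norm_triangle_ineq[of "complex_of_real (v'' x)" "resQ (u x) (v x) (w x) e * (1 / (\<rho> x) ^ 3)"] by simp
        then show "norm (R x) \<le> (norm e)\<^sup>2 * (1 / 16 * \<bar>q4 x\<bar> + (10 * L / 16 + 8 * C1))"
          unfolding R[OF x] norm_mult norm_power by (intro mult_left_mono) auto
      qed
      also have "\<dots> = (norm e)\<^sup>2 * (1 / 16 * integral {0..1} (\<lambda>x. \<bar>q4 x\<bar>) + (10 * L / 16 + 8 * C1))"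
        using integral_unique[OF has_integral_mult_right[OF has_integral_add[OF
            has_integral_mult_right[OF integrable_integral[OF q4i]] has_integral_const_real]], of "(norm e)\<^sup>2" "1/16" "10 * L / 16 + 8 * C1"]
        by simp
      also have "\<dots> \<le> (norm e)\<^sup>2 * (L + 8 * C1)"
        using b4 MleL L1 by (intro mult_left_mono) auto
      also have "\<dots> = I" by (simp add: I_def ne power_divide flip: power_mult)
      finally show ?thesis .
    qed
    have I12: "12 * I \<le> kk"
    proof -
      have "1 \<le> kk ^ 4" using kk by simp
      then have "I \<le> L + 8 * C1"
        unfolding I_def using divide_left_mono[of 1 "kk ^ 4" "L + 8 * C1"] L1 C1(1) kk by simp
      then show ?thesis using K12 kk by simp
    qed
    note sc = fundamental_sol[OF c0, of "k\<^sup>2"]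
    have "norm (k * sin_sol q0 (k\<^sup>2) 1 - \<rho> 0 * \<rho> 1 * sin (\<Theta> 1)) \<le> 144 * exp \<bar>Im k\<bar> * I / norm k"
    proof (rule liouville_green_error[where \<phi> = "sin_sol q0 (k\<^sup>2)" and \<phi>' = "sin_sol' q0 (k\<^sup>2)" and k = k
          and q = "\<lambda>x. complex_of_real (q0 x)" and \<rho> = \<rho> and \<rho>' = \<rho>' and \<rho>'' = \<rho>'' and \<Theta> = \<Theta> and R = R and I = I])
      show "sin_sol q0 (k\<^sup>2) 0 = 0" "sin_sol' q0 (k\<^sup>2) 0 = 1" by (fact sc)+
      show "prim \<rho> \<rho>'" "prim \<rho>' \<rho>''" by (fact \<rho>1 \<rho>2)+
      show "1 / 2 \<le> norm (\<rho> x) \<and> norm (\<rho> x) \<le> 2" if "x \<in> {0..1}" for x by (rule \<rho>b[OF that])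
      show "prim \<Theta> (\<lambda>x. k / (\<rho> x)\<^sup>2)" "\<Theta> 0 = 0" by (fact \<Theta> \<Theta>0)+
      show "\<bar>Im (\<Theta> x - \<Theta> t)\<bar> \<le> \<bar>Im k\<bar> * (x - t) + 1" if "0 \<le> t" "t \<le> x" "x \<le> 1" for t x
        by (rule \<Theta>b[OF that])
      show "R x = \<rho>'' x + \<rho> x * (k\<^sup>2 - complex_of_real (q0 x)) - k\<^sup>2 / (\<rho> x) ^ 3" for x by (rule R_def)
      show "(\<lambda>x. norm (R x)) integrable_on {0..1}" "integral {0..1} (\<lambda>x. norm (R x)) \<le> I" "k \<noteq> 0" by (fact Ri RI k0)+
      show "prim (sin_sol q0 (k\<^sup>2)) (sin_sol' q0 (k\<^sup>2))" using sc(1) by (simp add: sol_def)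
      show "prim (sin_sol' q0 (k\<^sup>2)) (\<lambda>x. (complex_of_real (q0 x) - k\<^sup>2) * sin_sol q0 (k\<^sup>2) x)"
        using sc(1) by (simp add: sol_def pot_def)
      show "continuous_on {0..1} (\<lambda>x. complex_of_real (q0 x))" by (intro continuous_intros c0)
      show "12 * I \<le> norm k" using I12 by (simp add: kk_def)
    qed
    then have err1: "norm (k * char_fun q0 (k\<^sup>2) - \<rho> 0 * \<rho> 1 * sin (\<Theta> 1)) \<le> 144 * (L + 8 * C1) * (exp \<bar>Im k\<bar> / kk ^ 5)"
      using kk by (simp add: char_fun_def I_def kk_def[symmetric] field_simps numeral_eq_Suc)
    define B where "B = complex_of_real (coeffB q0 q2)"
    define \<eta> where "\<eta> = \<Theta> 1 - k"
    have \<eta>B: "norm (\<eta> - B / k ^ 3) \<le> 4 * C2 / kk ^ 5"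
    proof -
      have iq: "q0 integrable_on {0..1}" by (intro integrable_continuous_real c0)
      \<comment> \<open>Mean zero removes the k^-1 term of the phase.\<close>
      have "((\<lambda>x. complex_of_real (q0 x)) has_integral 0) {0..1}"
        using has_integral_linear[OF integrable_integral[OF iq] bounded_linear_of_real] mean by (simp add: o_def)
      from has_integral_mult_right[OF this, of "k * e * (- 1 / 2)"]
      have 1: "((\<lambda>x. k * (- 2 * u x * e)) has_integral 0) {0..1}" by (simp add: u_def mult_ac)
      have "(\<lambda>x. (q2 x - (q0 x)\<^sup>2) / 8) integrable_on {0..1}"
        by (intro integrable_continuous_real continuous_intros c0 c2) simp
      from has_integral_mult_right[OF has_integral_linear[OF integrable_integral[OF this] bounded_linear_of_real], of "k * e\<^sup>2"]
      have "((\<lambda>x. k * e\<^sup>2 * complex_of_real ((q2 x - (q0 x)\<^sup>2) / 8)) has_integral k * e\<^sup>2 * B) {0..1}"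
        by (simp add: o_def B_def coeffB_def)
      moreover have "k * e\<^sup>2 * complex_of_real ((q2 x - (q0 x)\<^sup>2) / 8) = k * ((3 * (u x)\<^sup>2 - 2 * v x) * e\<^sup>2)" for x
        by (simp add: u_def v_def lgv_def field_simps power2_eq_square)
      ultimately have 2: "((\<lambda>x. k * ((3 * (u x)\<^sup>2 - 2 * v x) * e\<^sup>2)) has_integral k * e\<^sup>2 * B) {0..1}"
        by (simp only:)
      have 3: "((\<lambda>x. k) has_integral k) {0..1::real}" using has_integral_const_real[of k 0 1] by simp
      have 4: "((\<lambda>x. k / (\<rho> x)\<^sup>2) has_integral \<Theta> 1) {0..1}"
        using prim_has_integral[OF \<Theta>, of 0 1] \<Theta>0 by simp
      have H: "((\<lambda>x. k / (\<rho> x)\<^sup>2 - (k + k * (- 2 * u x * e) + k * ((3 * (u x)\<^sup>2 - 2 * v x) * e\<^sup>2))) has_integral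
          \<Theta> 1 - (k + 0 + k * e\<^sup>2 * B)) {0..1}"
        by (intro has_integral_diff has_integral_add 1 2 3 4)
      have bdk: "norm (k / (\<rho> x)\<^sup>2 - (k + k * (- 2 * u x * e) + k * ((3 * (u x)\<^sup>2 - 2 * v x) * e\<^sup>2))) \<le> 4 * C2 / kk ^ 5"
        if x: "x \<in> {0..1}" for x
      proof -
        let ?Y = "1 - 2 * u x * e + (3 * (u x)\<^sup>2 - 2 * v x) * e\<^sup>2"
        have "k / (\<rho> x)\<^sup>2 - (k + k * (- 2 * u x * e) + k * ((3 * (u x)\<^sup>2 - 2 * v x) * e\<^sup>2)) = k / (\<rho> x)\<^sup>2 - k * ?Y"
          by (simp add: algebra_simps)
        also have "\<dots> = k * (1 - (\<rho> x)\<^sup>2 * ?Y) * (1 / (\<rho> x)\<^sup>2)"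
          using \<rho>0[OF x] by (simp add: field_simps)
        also have "1 - (\<rho> x)\<^sup>2 * ?Y = - (e ^ 3 * resZ (u x) (v x) e)"
          unfolding \<rho>_def by (rule resZ_identity)
        also have "norm (k * - (e ^ 3 * resZ (u x) (v x) e) * (1 / (\<rho> x)\<^sup>2)) \<le> kk * ((norm e) ^ 3 * C2) * 2\<^sup>2"
          unfolding norm_mult norm_minus_cancel norm_power kk_def[symmetric]
          using kk C2 e2 ub[OF x] vb[OF x] \<rho>i[OF x, of 2] by (intro mult_mono) auto
        also have "\<dots> = 4 * C2 / kk ^ 5" using kk by (simp add: ne field_simps numeral_eq_Suc)
        finally show ?thesis .
      qed
      have "0 \<le> 4 * C2 / kk ^ 5" using C2(1) kk by simp
      from has_integral_bound_real[OF this finite.emptyI H]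
      have "norm (\<Theta> 1 - (k + 0 + k * e\<^sup>2 * B)) \<le> 4 * C2 / kk ^ 5 * Henstock_Kurzweil_Integration.content {0..1::real}"
        using bdk by blast
      moreover have "k * e\<^sup>2 * B = B / k ^ 3" using k0 by (simp add: e_def field_simps numeral_eq_Suc)
      ultimately show ?thesis by (simp add: \<eta>_def diff_diff_eq)
    qed
    have Bb: "norm B \<le> L"
    proof -
      have H: "((\<lambda>x. (q2 x - (q0 x)\<^sup>2) / 8) has_integral coeffB q0 q2) {0..1}"
        unfolding coeffB_def by (intro integrable_integral integrable_continuous_real continuous_intros c0 c2) simp
      have bd: "norm ((q2 x - (q0 x)\<^sup>2) / 8) \<le> L" if x: "x \<in> {0..1}" for x
      proof -
        have "(q0 x)\<^sup>2 \<le> L" unfolding L_def using b(1)[OF x] M by (simp add: abs_le_square_iff[symmetric])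
        moreover have "\<bar>q2 x\<bar> \<le> L" using b(3)[OF x] MleL by linarith
        ultimately have "\<bar>q2 x - (q0 x)\<^sup>2\<bar> \<le> 8 * L" using zero_le_power2[of "q0 x"] L1 by linarith
        then show ?thesis by simp
      qed
      have "0 \<le> L" using L1 by simp
      from has_integral_bound_real[OF this finite.emptyI H]
      have "norm (coeffB q0 q2) \<le> L * Henstock_Kurzweil_Integration.content {0..1::real}"
        using bd by blast
      then show ?thesis by (simp add: B_def)
    qed
    have pw: "1 / kk ^ n \<le> 1 / kk ^ m" if "m \<le> n" for m n
      using kk that by (intro divide_left_mono power_increasing) auto
    have \<eta>3: "norm \<eta> \<le> C3 / kk ^ 3"
    proof -
      have "norm \<eta> \<le> norm (\<eta> - B / k ^ 3) + norm (B / k ^ 3)"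
        using norm_triangle_ineq[of "\<eta> - B / k ^ 3" "B / k ^ 3"] by simp
      moreover have "norm (B / k ^ 3) \<le> L / kk ^ 3"
        using Bb kk by (simp add: norm_divide norm_power kk_def[symmetric] divide_right_mono)
      moreover have "4 * C2 / kk ^ 5 \<le> 4 * C2 / kk ^ 3" using mult_left_mono[OF pw[of 3 5], of "4 * C2"] C2(1) by simp
      ultimately show ?thesis using \<eta>B unfolding C3_def add_divide_distrib by linarith
    qed
    have C30: "0 \<le> C3" using C2(1) L1 by (simp add: C3_def)
    have \<eta>1: "norm \<eta> \<le> 1"
    proof -
      have "C3 / kk ^ 3 \<le> C3 / kk" using mult_left_mono[OF pw[of 1 3] C30] by simp
      also have "\<dots> \<le> 1" using K3 kk by simp
      finally show ?thesis using \<eta>3 by simp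
    qed
    define \<tau> where "\<tau> = exp \<bar>Im k\<bar>"
    have \<tau>0: "0 \<le> \<tau>" by (simp add: \<tau>_def)
    define T where "T = sin (\<Theta> 1) - sin k - B / k ^ 3 * cos k"
    have T: "norm T \<le> \<tau> * (C4 / kk ^ 5)"
    proof -
      have "norm T \<le> \<tau> * (6 * (norm \<eta>)\<^sup>2 + norm (\<eta> - B / k ^ 3))"
        using sin_add_expansion[OF \<eta>1, of k "B / k ^ 3"] by (simp add: T_def \<tau>_def \<eta>_def)
      also have "\<dots> \<le> \<tau> * (6 * (C3 / kk ^ 3)\<^sup>2 + 4 * C2 / kk ^ 5)"
        using \<eta>3 \<eta>B \<tau>0 by (intro mult_left_mono add_mono power_mono) auto
      also have "\<dots> \<le> \<tau> * (6 * C3\<^sup>2 / kk ^ 5 + 4 * C2 / kk ^ 5)"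
      proof (intro mult_left_mono add_mono \<tau>0 order_refl)
        have "(C3 / kk ^ 3)\<^sup>2 = C3\<^sup>2 * (1 / kk ^ 6)" by (simp add: power_divide flip: power_mult)
        also have "\<dots> \<le> C3\<^sup>2 * (1 / kk ^ 5)" by (intro mult_left_mono pw) auto
        finally show "6 * (C3 / kk ^ 3)\<^sup>2 \<le> 6 * C3\<^sup>2 / kk ^ 5" by simp
      qed
      finally show ?thesis by (simp add: C4_def add_divide_distrib)
    qed
    define E where "E = u 0 + u 1"
    define F where "F = v 0 + v 1 + u 0 * u 1"
    define P where "P = 1 + E * e + F * e\<^sup>2"
    have b01: "norm (u 0) \<le> L" "norm (u 1) \<le> L" "norm (v 0) \<le> L" "norm (v 1) \<le> L" using ub vb by auto
    have "norm (u 0 * u 1) \<le> L * L" unfolding norm_mult using b01 L1 by (intro mult_mono) auto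
    moreover have "L \<le> L * L" using L1 by simp
    ultimately have Fb: "norm F \<le> 3 * L\<^sup>2" unfolding F_def power2_eq_square
      using b01 norm_triangle_ineq[of "v 0 + v 1" "u 0 * u 1"] norm_triangle_ineq[of "v 0" "v 1"] by linarith
    have Eb: "norm E \<le> 2 * L" unfolding E_def using b01 norm_triangle_ineq[of "u 0" "u 1"] by linarith
    have P1: "norm (P - 1) \<le> 3 * L * norm e"
    proof -
      have "norm (P - 1) \<le> norm E * norm e + norm F * (norm e * norm e)"
        unfolding P_def power2_eq_square using norm_triangle_ineq[of "E * e" "F * (e * e)"] by (simp add: norm_mult)
      also have "\<dots> \<le> 2 * L * norm e + 3 * L\<^sup>2 * (norm e * norm e)"
        using Eb Fb by (intro add_mono mult_right_mono) auto
      also have "3 * L\<^sup>2 * (norm e * norm e) = (3 * L * norm e) * (L * norm e)" by (simp add: power2_eq_square)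
      also have "\<dots> \<le> (3 * L * norm e) * (1 / 20)" using e1 L1 by (intro mult_left_mono) auto
      also have "2 * L * norm e + 3 * L * norm e * (1 / 20) = 43 / 20 * (L * norm e)" by simp
      also have "\<dots> \<le> 3 * (L * norm e)" using L1 by (intro mult_right_mono) auto
      finally show ?thesis by simp
    qed
    have P3: "norm P \<le> 3" using P1 e1 norm_triangle_ineq[of "P - 1" 1] by simp
    have \<rho>P: "norm (\<rho> 0 * \<rho> 1 - P) \<le> 3 * L\<^sup>2 / kk ^ 5"
    proof -
      have "\<rho> 0 * \<rho> 1 - P = e ^ 3 * ((u 0 * v 1 + u 1 * v 0) + e * (v 0 * v 1))"
        by (simp add: \<rho>_def P_def E_def F_def algebra_simps numeral_eq_Suc)
      also have "norm \<dots> \<le> (norm e) ^ 3 * ((L * L + L * L) + 1 * (L * L))"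
      proof -
        have "norm (u 0 * v 1) \<le> L * L" "norm (u 1 * v 0) \<le> L * L"
          unfolding norm_mult using b01 L1 by (auto intro!: mult_mono)
        moreover have "norm (v 0 * v 1) \<le> L * L"
          unfolding norm_mult using b01 L1 by (auto intro!: mult_mono)
        then have "norm (e * (v 0 * v 1)) \<le> 1 * (L * L)"
          unfolding norm_mult[of e] using e2 by (intro mult_mono) auto
        ultimately have "norm ((u 0 * v 1 + u 1 * v 0) + e * (v 0 * v 1)) \<le> (L * L + L * L) + 1 * (L * L)"
          by (intro order_trans[OF norm_triangle_ineq] add_mono)
        then show ?thesis unfolding norm_mult[of "e ^ 3"] norm_power by (intro mult_left_mono) auto
      qed
      also have "(norm e) ^ 3 = 1 / kk ^ 6" by (simp add: ne power_divide flip: power_mult)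
      also have "1 / kk ^ 6 * ((L * L + L * L) + 1 * (L * L)) = 3 * L\<^sup>2 * (1 / kk ^ 6)" by (simp add: power2_eq_square)
      also have "\<dots> \<le> 3 * L\<^sup>2 * (1 / kk ^ 5)" by (intro mult_left_mono pw) auto
      finally show ?thesis by simp
    qed
    have sin\<Theta>: "norm (sin (\<Theta> 1)) \<le> 3 * \<tau>"
    proof -
      have "\<bar>Im (\<Theta> 1)\<bar> \<le> \<bar>Im k\<bar> + 1" using \<Theta>b[of 0 1] \<Theta>0 by simp
      then have "norm (sin (\<Theta> 1)) \<le> exp (\<bar>Im k\<bar> + 1)" by (intro order_trans[OF norm_sin_le_exp]) simp
      also have "\<dots> = exp 1 * \<tau>" by (simp add: exp_add \<tau>_def)
      also have "\<dots> \<le> 3 * \<tau>" using exp_le \<tau>0 by (intro mult_right_mono) auto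
      finally show ?thesis .
    qed
    have main: "lg_main q0 q2 k = P * sin k + B / k ^ 3 * cos k"
    proof -
      have "of_real (coeffE q0) = E" "of_real (coeffF q0 q2) = F"
        by (auto simp: coeffE_def coeffF_def E_def F_def u_def v_def add_divide_distrib)
      then show ?thesis
        using k0 unfolding lg_main_def P_def e_def B_def
        by (simp add: field_simps flip: power_mult)
    qed
    \<comment> \<open>Four errors: of the Liouville-Green solution, of the expanded sine, of the
      cross term between amplitude and phase, and of the truncated amplitude product. The last two
      give 3 L^2 and 9 L^2, hence the 12 L^2 in \<open>A\<close>.\<close>
    have "k * char_fun q0 (k\<^sup>2) - lg_main q0 q2 k =
        (k * char_fun q0 (k\<^sup>2) - \<rho> 0 * \<rho> 1 * sin (\<Theta> 1)) + (P * T + ((P - 1) * (B / k ^ 3 * cos k) + (\<rho> 0 * \<rho> 1 - P) * sin (\<Theta> 1)))"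
      unfolding main T_def by (simp add: algebra_simps diff_divide_distrib)
    also have "norm \<dots> \<le> 144 * (L + 8 * C1) * (\<tau> / kk ^ 5) + (3 * (\<tau> * (C4 / kk ^ 5)) + (3 * L\<^sup>2 / kk ^ 5 * \<tau> + 3 * L\<^sup>2 / kk ^ 5 * (3 * \<tau>)))"
    proof (intro order_trans[OF norm_triangle_ineq] add_mono)
      show "norm (k * char_fun q0 (k\<^sup>2) - \<rho> 0 * \<rho> 1 * sin (\<Theta> 1)) \<le> 144 * (L + 8 * C1) * (\<tau> / kk ^ 5)"
        using err1 by (simp add: \<tau>_def)
      show "norm (P * T) \<le> 3 * (\<tau> * (C4 / kk ^ 5))" unfolding norm_mult using P3 T by (intro mult_mono) auto
      show "norm ((\<rho> 0 * \<rho> 1 - P) * sin (\<Theta> 1)) \<le> 3 * L\<^sup>2 / kk ^ 5 * (3 * \<tau>)"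
        unfolding norm_mult using \<rho>P sin\<Theta> kk by (intro mult_mono) auto
      have "norm ((P - 1) * (B / k ^ 3 * cos k)) \<le> (3 * L * norm e) * (L / kk ^ 3 * \<tau>)"
        unfolding norm_mult norm_divide norm_power kk_def[symmetric] \<tau>_def
        using P1 Bb kk L1 by (intro mult_mono divide_right_mono norm_cos_le_exp) auto
      also have "\<dots> = 3 * L\<^sup>2 / kk ^ 5 * \<tau>" using kk by (simp add: ne field_simps numeral_eq_Suc)
      finally show "norm ((P - 1) * (B / k ^ 3 * cos k)) \<le> 3 * L\<^sup>2 / kk ^ 5 * \<tau>" .
    qed
    also have "\<dots> = A * \<tau> / kk ^ 5" using kk by (simp add: A_def field_simps)
    finally show ?thesis by (simp add: \<tau>_def kk_def)
  qed
  then show ?thesis using A0 K1 by (intro exI[of _ A] exI[of _ K]) blast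
qed

section \<open>The unperturbed problem\<close>

lemma char_fun_zero_potential:
  assumes "k \<noteq> 0" shows "char_fun (\<lambda>x. 0) (k\<^sup>2) = sin k / k"
proof -
  let ?y = "\<lambda>x. sin (k * of_real x) / k" and ?y' = "\<lambda>x. cos (k * of_real x)"
  have "prim ?y ?y'"
  proof (rule primI_derivative)
    fix x :: real
    have "((\<lambda>z. sin (k * z) / k) has_field_derivative cos (k * of_real x)) (at (of_real x))"
      using assms by (auto intro!: derivative_eq_intros)
    then show "(?y has_vector_derivative ?y' x) (at x within {0..1})"
      by (intro has_vector_derivative_real_field) (auto intro: has_field_derivative_at_within)
  qed (intro continuous_intros)
  moreover have "prim ?y' (\<lambda>x. pot (\<lambda>x. 0) (k\<^sup>2) x * ?y x)"
  proof (rule primI_derivative)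
    fix x :: real
    have "((\<lambda>z. cos (k * z)) has_field_derivative pot (\<lambda>x. 0) (k\<^sup>2) x * ?y x) (at (of_real x))"
      using assms by (auto intro!: derivative_eq_intros simp: pot_def power2_eq_square)
    then show "(?y' has_vector_derivative pot (\<lambda>x. 0) (k\<^sup>2) x * ?y x) (at x within {0..1})"
      by (intro has_vector_derivative_real_field) (auto intro: has_field_derivative_at_within)
  qed (use assms in \<open>auto simp: pot_def intro!: continuous_intros\<close>)
  ultimately have "sol (pot (\<lambda>x. 0) (k\<^sup>2)) ?y ?y'" by (simp add: sol_def)
  then have "char_fun (\<lambda>x. 0) (k\<^sup>2) = ?y 1" by (rule char_fun_eqI[rotated]) auto
  then show ?thesis by simp
qed

lemma char_fun_zero_potential_at_0: "char_fun (\<lambda>x. 0) 0 = 1"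
proof -
  have "prim (\<lambda>x. complex_of_real x) (\<lambda>x. 1)"
    by (rule primI_derivative) (auto intro!: derivative_eq_intros)
  then have "sol (pot (\<lambda>x. 0) 0) complex_of_real (\<lambda>x. 1)"
    by (simp add: sol_def pot_def prim_const)
  then have "char_fun (\<lambda>x. 0) 0 = complex_of_real 1" by (rule char_fun_eqI[rotated]) auto
  then show ?thesis by simp
qed

lemma char_fun_zero_potential_zeros: "char_fun (\<lambda>x. 0) l = 0 \<longleftrightarrow> (\<exists>n\<ge>1. l = of_real ((pi * real n)\<^sup>2))"
proof (cases "l = 0")
  case True
  then show ?thesis using char_fun_zero_potential_at_0 by (auto simp: power2_eq_square)
next
  case False
  define k where "k = csqrt l"
  have k: "k\<^sup>2 = l" "k \<noteq> 0" using False by (auto simp: k_def)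
  have "char_fun (\<lambda>x. 0) l = 0 \<longleftrightarrow> sin k = 0" using char_fun_zero_potential[OF k(2)] k by simp
  also have "\<dots> \<longleftrightarrow> (\<exists>n::int. k = of_real (real_of_int n * pi))" by (rule Complex_Transcendental.sin_eq_0)
  also have "\<dots> \<longleftrightarrow> (\<exists>n\<ge>1. l = of_real ((pi * real n)\<^sup>2))"
  proof
    assume "\<exists>n::int. k = of_real (real_of_int n * pi)"
    then obtain n :: int where n: "k = of_real (real_of_int n * pi)" by blast
    then have "n \<noteq> 0" using k by auto
    have "real (nat \<bar>n\<bar>) = \<bar>real_of_int n\<bar>" by simp
    then have "(pi * real (nat \<bar>n\<bar>))\<^sup>2 = (real_of_int n * pi)\<^sup>2" by (simp add: power_mult_distrib)
    then have "l = of_real ((pi * real (nat \<bar>n\<bar>))\<^sup>2)" using n k(1) by (metis of_real_power)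
    moreover have "nat \<bar>n\<bar> \<ge> 1" using \<open>n \<noteq> 0\<close> by simp
    ultimately show "\<exists>n\<ge>1. l = of_real ((pi * real n)\<^sup>2)" by blast
  next
    assume "\<exists>n\<ge>1. l = of_real ((pi * real n)\<^sup>2)"
    then obtain n where "l = of_real ((pi * real n)\<^sup>2)" by blast
    then have "k\<^sup>2 = (of_real (pi * real n))\<^sup>2" using k(1) by simp
    then have "k = of_real (pi * real n) \<or> k = - of_real (pi * real n)" by (simp add: power2_eq_iff)
    then show "\<exists>n::int. k = of_real (real_of_int n * pi)"
    proof
      assume "k = of_real (pi * real n)" then show ?thesis by (intro exI[of _ "int n"]) (simp add: mult.commute)
    next
      assume "k = - of_real (pi * real n)" then show ?thesis by (intro exI[of _ "- int n"]) (simp add: mult.commute)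
    qed
  qed
  finally show ?thesis .
qed

text \<open>4 |sin k|^2 = exp(2 Im k) + exp(-2 Im k) - 2 cos(2 Re k): the last term does no harm if
  it has the right sign or if the first two outweigh it.\<close>

lemma norm_sin_lower_Im:
  fixes k :: complex
  assumes "1 \<le> \<bar>Im k\<bar> \<or> cos (2 * Re k) \<le> 0"
  shows "exp \<bar>Im k\<bar> / 4 \<le> norm (sin k)"
proof -
  define y where "y = \<bar>Im k\<bar>"
  have e: "exp (2 * Im k) + inverse (exp (2 * Im k)) = exp (2 * y) + exp (- (2 * y))"
    by (cases "Im k \<ge> 0") (auto simp: y_def exp_minus)
  have "exp (2 * y) / 4 \<le> exp (2 * y) + exp (- (2 * y)) - 2 * cos (2 * Re k)"
  proof (cases "cos (2 * Re k) \<le> 0")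
    case True
    then show ?thesis using exp_gt_zero[of "2 * y"] exp_gt_zero[of "- (2 * y)"] by linarith
  next
    case False
    then have "1 \<le> y" using assms by (simp add: y_def)
    then have "1 + 2 \<le> exp (2 * y)" using exp_ge_add_one_self[of "2 * y"] by linarith
    moreover have "cos (2 * Re k) \<le> 1" by simp
    moreover have "0 < exp (- (2 * y))" by simp
    ultimately show ?thesis by linarith
  qed
  then have "exp (2 * y) / 16 \<le> (norm (sin k))\<^sup>2"
    unfolding norm_sin_squared e by simp
  also have "exp (2 * y) / 16 = (exp y / 4)\<^sup>2" by (simp add: power_divide power2_eq_square flip: exp_add)
  finally show ?thesis using power2_le_imp_le[of "exp y / 4" "norm (sin k)"] by (simp add: y_def)
qed

text \<open>If |Im k| < 1 on the circle, then |Re k| is within 1/4 of the radius \<pi> (N + 1/2),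
  which forces cos(2 Re k) <= 0. Here N >= 1 makes the radius at least 4.\<close>

lemma norm_sin_lower_circle:
  fixes k :: complex
  assumes N: "1 \<le> N" and k: "norm k = pi * (real N + 1 / 2)"
  shows "exp \<bar>Im k\<bar> / 4 \<le> norm (sin k)"
proof (rule norm_sin_lower_Im, rule disjCI)
  assume nc: "\<not> cos (2 * Re k) \<le> 0"
  show "1 \<le> \<bar>Im k\<bar>"
  proof (rule ccontr)
    assume "\<not> 1 \<le> \<bar>Im k\<bar>"
    then have y: "(Im k)\<^sup>2 \<le> 1" by (simp add: abs_square_le_1)
    define r where "r = pi * (real N + 1 / 2)"
    define \<delta> where "\<delta> = r - \<bar>Re k\<bar>"
    have "pi * (1 + 1 / 2) \<le> r" unfolding r_def using N by (intro mult_left_mono) auto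
    then have r: "4 \<le> r" using pi_gt3 by simp
    have r2: "r\<^sup>2 = (Re k)\<^sup>2 + (Im k)\<^sup>2" using k cmod_power2[of k] by (simp add: r_def)
    have \<delta>0: "0 \<le> \<delta>" using abs_Re_le_cmod[of k] k by (simp add: \<delta>_def r_def)
    have "\<delta> * (r + \<bar>Re k\<bar>) = r\<^sup>2 - (Re k)\<^sup>2"
      by (simp add: \<delta>_def algebra_simps power2_eq_square)
    then have "\<delta> * (r + \<bar>Re k\<bar>) \<le> 1" using r2 y by simp
    moreover have "\<delta> * 4 \<le> \<delta> * (r + \<bar>Re k\<bar>)" using r \<delta>0 by (intro mult_left_mono) auto
    ultimately have \<delta>1: "\<delta> \<le> 1 / 4" by linarith
    have "cos (2 * Re k) = cos (2 * \<bar>Re k\<bar>)" by (simp add: abs_if)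
    also have "2 * \<bar>Re k\<bar> = 2 * pi * real N + pi - 2 * \<delta>" by (simp add: \<delta>_def r_def algebra_simps)
    also have "cos (2 * pi * real N + pi - 2 * \<delta>) = - cos (2 * \<delta>)"
    proof -
      have "cos (2 * pi * real N) = 1" "sin (2 * pi * real N) = 0"
        using cos_2npi[of N] sin_2npi[of N] by (simp_all add: mult_ac)
      then have "cos (2 * pi * real N + (pi - 2 * \<delta>)) = cos (pi - 2 * \<delta>)"
        by (simp add: cos_add)
      then show ?thesis by (simp add: cos_diff add_diff_eq)
    qed
    finally have "cos (2 * Re k) = - cos (2 * \<delta>)" .
    moreover have "0 \<le> cos (2 * \<delta>)" using \<delta>0 \<delta>1 pi_gt3 by (intro cos_ge_zero) auto
    ultimately show False using nc by simp
  qed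
qed

section \<open>The argument principle\<close>

lemma argument_principle_circle:
  fixes f h :: "complex \<Rightarrow> complex"
  assumes f: "f holomorphic_on UNIV" and h: "h holomorphic_on UNIV" and R: "0 < R"
    and nz: "\<And>z. norm z = R \<Longrightarrow> f z \<noteq> 0" and simple: "\<And>z. f z = 0 \<Longrightarrow> norm z < R \<Longrightarrow> deriv f z \<noteq> 0"
  shows "finite {z. norm z < R \<and> f z = 0}"
    "contour_integral (circlepath 0 R) (\<lambda>x. deriv f x * h x / f x) =
      2 * pi * \<i> * (\<Sum>z | norm z < R \<and> f z = 0. h z)"
proof -
  \<comment> \<open>The argument principle wants an open set containing the circle; zeros outside
    the circle have winding number 0 and drop out of the sum.\<close>
  let ?S = "ball (0::complex) (R + 1)"
  have fin: "finite {z \<in> cball 0 (R + 1). f z = 0}"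
  proof (cases "f constant_on UNIV")
    case True
    then obtain c where "\<And>z. f z = c" unfolding constant_on_def by auto
    moreover from this have "c \<noteq> 0" using nz[of "of_real R"] R by auto
    ultimately show ?thesis by simp
  next
    case False
    then show ?thesis by (intro holomorphic_compact_finite_zeros[OF f]) auto
  qed
  define pz where "pz = {w \<in> ?S. f w = 0 \<or> w \<in> {}}"
  have finpz: "finite pz" by (rule finite_subset[OF _ fin]) (auto simp: pz_def)
  show "finite {z. norm z < R \<and> f z = 0}" by (rule finite_subset[OF _ fin]) auto
  have "contour_integral (circlepath 0 R) (\<lambda>x. deriv f x * h x / f x) =
      2 * pi * \<i> * (\<Sum>p\<in>pz. winding_number (circlepath 0 R) p * h p * zorder f p)"
    unfolding pz_def
  proof (rule argument_principle)
    show "f holomorphic_on ?S - {}" "h holomorphic_on ?S" using f h holomorphic_on_subset by blast+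
    show "path_image (circlepath 0 R) \<subseteq> ?S - {w \<in> ?S. f w = 0 \<or> w \<in> {}}"
      using R nz by (auto simp: path_image_circlepath_nonneg)
    show "\<forall>z. z \<notin> ?S \<longrightarrow> winding_number (circlepath 0 R) z = 0"
      using R by (auto intro!: winding_number_zero_outside[of _ "cball 0 R"] simp: path_image_circlepath_nonneg)
    show "finite {w \<in> ?S. f w = 0 \<or> w \<in> {}}" using finpz unfolding pz_def .
  qed auto
  also have "(\<Sum>p\<in>pz. winding_number (circlepath 0 R) p * h p * zorder f p) = (\<Sum>z | norm z < R \<and> f z = 0. h z)"
  proof (rule sum.mono_neutral_cong_right[OF finpz])
    show "{z. norm z < R \<and> f z = 0} \<subseteq> pz" by (auto simp: pz_def)
    show "\<forall>i\<in>pz - {z. norm z < R \<and> f z = 0}. winding_number (circlepath 0 R) i * h i * zorder f i = 0"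
    proof
      fix z assume "z \<in> pz - {z. norm z < R \<and> f z = 0}"
      then have "norm z \<noteq> R" "\<not> norm z < R" using nz by (auto simp: pz_def)
      then have "winding_number (circlepath 0 R) z = 0"
        using R by (intro winding_number_zero_outside[of _ "cball 0 R"]) (auto simp: path_image_circlepath_nonneg)
      then show "winding_number (circlepath 0 R) z * h z * zorder f z = 0" by simp
    qed
    fix z assume "z \<in> {z. norm z < R \<and> f z = 0}"
    then have z: "norm z < R" "f z = 0" by auto
    have "winding_number (circlepath 0 R) z = 1"
      using z by (intro winding_number_circlepath) simp
    moreover have "zorder f z = 1"
      using z simple by (intro zorder_zero_eqI[OF f]) auto
    ultimately show "winding_number (circlepath 0 R) z * h z * zorder f z = h z" by simp
  qed
  finally show "contour_integral (circlepath 0 R) (\<lambda>x. deriv f x * h x / f x) =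
      2 * pi * \<i> * (\<Sum>z | norm z < R \<and> f z = 0. h z)" .
qed

text \<open>Integration by parts moves the derivative from the logarithm of \<open>f / g\<close> to the weight \<open>h\<close>.\<close>

lemma zero_sum_difference:
  fixes f g h :: "complex \<Rightarrow> complex"
  assumes f: "f holomorphic_on UNIV" and g: "g holomorphic_on UNIV" and h: "h holomorphic_on UNIV" and R: "0 < R"
    and gnz: "\<And>z. norm z = R \<Longrightarrow> g z \<noteq> 0" and close: "\<And>z. norm z = R \<Longrightarrow> norm (f z / g z - 1) < 1"
    and fs: "\<And>z. f z = 0 \<Longrightarrow> norm z < R \<Longrightarrow> deriv f z \<noteq> 0" and gs: "\<And>z. g z = 0 \<Longrightarrow> norm z < R \<Longrightarrow> deriv g z \<noteq> 0"
  shows "((\<lambda>z. deriv h z * Ln (f z / g z)) has_contour_integral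
     - (2 * pi * \<i> * ((\<Sum>z | norm z < R \<and> f z = 0. h z) - (\<Sum>z | norm z < R \<and> g z = 0. h z)))) (circlepath 0 R)"
proof -
  let ?C = "circlepath 0 R"
  \<comment> \<open>The ratio lies in the unit disc about 1, hence in the right half-plane, where
    the principal logarithm is holomorphic.\<close>
  have pos: "Re (f z / g z) > 0" if "norm z = R" for z
  proof -
    have "\<bar>Re (f z / g z - 1)\<bar> < 1" using close[OF that] abs_Re_le_cmod[of "f z / g z - 1"] by linarith
    then show ?thesis by simp
  qed
  then have fnz: "f z \<noteq> 0" if "norm z = R" for z using that by fastforce
  have im: "path_image ?C = sphere 0 R" using R by (simp add: path_image_circlepath_nonneg)
  have df: "deriv f holomorphic_on UNIV" "deriv g holomorphic_on UNIV"
    using f g by (auto intro: holomorphic_deriv)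
  have hd: "(f has_field_derivative deriv f z) (at z)" "(g has_field_derivative deriv g z) (at z)"
    "(h has_field_derivative deriv h z) (at z)" for z
    using f g h by (auto intro!: holomorphic_derivI[where S = UNIV])
  have int: "(\<lambda>x. deriv f x * h x / f x) contour_integrable_on ?C" "(\<lambda>x. deriv g x * h x / g x) contour_integrable_on ?C"
    using df f g h fnz gnz R unfolding im[symmetric]
    by (auto intro!: contour_integrable_continuous_circlepath continuous_intros simp: im
        intro: continuous_on_subset[OF holomorphic_on_imp_continuous_on])
  \<comment> \<open>h Ln(f/g) is single-valued along the closed circle, so its full derivative
    integrates to 0.\<close>
  have "((\<lambda>z. deriv h z * Ln (f z / g z) + (deriv f z * h z / f z - deriv g z * h z / g z)) has_contour_integral
      (h (pathfinish ?C) * Ln (f (pathfinish ?C) / g (pathfinish ?C)) - h (pathstart ?C) * Ln (f (pathstart ?C) / g (pathstart ?C)))) ?C"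
  proof (rule contour_integral_primitive[where S = "sphere 0 R" and f = "\<lambda>z. h z * Ln (f z / g z)"])
    fix z :: complex assume "z \<in> sphere 0 R"
    then have z: "norm z = R" by simp
    have "f z / g z \<notin> \<real>\<^sub>\<le>\<^sub>0" using pos[OF z] complex_nonpos_Reals_iff by auto
    from DERIV_mult[OF hd(3) DERIV_chain2[OF has_field_derivative_Ln[OF this] DERIV_divide[OF hd(1) hd(2) gnz[OF z]]]]
    have "((\<lambda>z. h z * Ln (f z / g z)) has_field_derivative
       deriv h z * Ln (f z / g z) + (inverse (f z / g z) * ((deriv f z * g z - f z * deriv g z) / (g z * g z))) * h z) (at z)" .
    also have "(inverse (f z / g z) * ((deriv f z * g z - f z * deriv g z) / (g z * g z))) * h z =
        deriv f z * h z / f z - deriv g z * h z / g z"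
      using fnz[OF z] gnz[OF z] by (simp add: field_simps)
    finally show "((\<lambda>z. h z * Ln (f z / g z)) has_field_derivative
        deriv h z * Ln (f z / g z) + (deriv f z * h z / f z - deriv g z * h z / g z)) (at z within sphere 0 R)"
      by (rule has_field_derivative_at_within)
  qed (use R in \<open>auto simp: im\<close>)
  then have "((\<lambda>z. deriv h z * Ln (f z / g z) + (deriv f z * h z / f z - deriv g z * h z / g z)) has_contour_integral 0) ?C"
    by simp
  from has_contour_integral_diff[OF this has_contour_integral_diff[OF
      has_contour_integral_integral[OF int(1)] has_contour_integral_integral[OF int(2)]]]
  show ?thesis
    using argument_principle_circle(2)[OF f h R fnz fs] argument_principle_circle(2)[OF g h R gnz gs]
    by (simp add: algebra_simps)
qed

section \<open>The logarithm of the ratio to the unperturbed function\<close>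

lemma Ln_quadratic_approx:
  assumes "norm w \<le> 1 / 2"
  shows "norm (Ln (1 + w) - w + w\<^sup>2 / 2) \<le> 8 * norm w ^ 3"
proof -
  let ?f = "\<lambda>i::nat. \<lambda>z. if i = 0 then Ln (1 + z) else if i = 1 then inverse (1 + z)
      else if i = 2 then - (inverse (1 + z) ^ 2) else 2 * inverse (1 + z) ^ 3"
  have half: "1 / 2 \<le> Re (1 + z)" if "z \<in> cball 0 (1 / 2)" for z
    using that abs_Re_le_cmod[of z] by simp
  have nz: "1 + z \<noteq> 0" "1 + z \<notin> \<real>\<^sub>\<le>\<^sub>0" if "z \<in> cball 0 (1 / 2)" for z :: complex
    using half[OF that] complex_nonpos_Reals_iff[of "1 + z"] by auto
  \<comment> \<open>The third derivative 2 (1 + z)^-3 is at most 2 * 2^3 = 16 on the disc, and the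
    remainder of \<open>complex_Taylor\<close> carries 1/2!, whence the 8.\<close>
  have "norm (?f 0 w - (\<Sum>i\<le>2. ?f i 0 * (w - 0) ^ i / fact i)) \<le> 16 * norm (w - 0) ^ Suc 2 / fact 2"
  proof (rule complex_Taylor[where S = "cball 0 (1 / 2)"])
    fix i :: nat and x :: complex assume x: "x \<in> cball 0 (1 / 2)" and i: "i \<le> 2"
    have d: "((\<lambda>z. inverse (1 + z)) has_field_derivative - (inverse (1 + x) ^ 2)) (at x within cball 0 (1 / 2))"
      using nz[OF x] by (auto intro!: derivative_eq_intros simp: power2_eq_square)
    consider "i = 0" | "i = 1" | "i = 2" using i by linarith
    then show "(?f i has_field_derivative ?f (Suc i) x) (at x within cball 0 (1 / 2))"
    proof cases
      case 1 then show ?thesis using nz[OF x] by (auto intro!: derivative_eq_intros)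
    next
      case 2 then show ?thesis using d by simp
    next
      case 3
      have "((\<lambda>z. - (inverse (1 + z) ^ 2)) has_field_derivative
          - (of_nat 2 * (- (inverse (1 + x) ^ 2) * inverse (1 + x) ^ (2 - Suc 0)))) (at x within cball 0 (1 / 2))"
        by (rule DERIV_minus[OF DERIV_power[OF d]])
      then show ?thesis using 3 by (simp add: power3_eq_cube power2_eq_square mult.assoc)
    qed
  next
    fix x :: complex assume x: "x \<in> cball 0 (1 / 2)"
    have "1 / 2 \<le> norm (1 + x)" using half[OF x] complex_Re_le_cmod[of "1 + x"] by linarith
    then have "inverse (norm (1 + x)) \<le> 2" using nz(1)[OF x] by (simp add: field_simps)
    then have "inverse (norm (1 + x)) ^ 3 \<le> 2 ^ 3" by (intro power_mono) auto
    then show "norm (?f (Suc 2) x) \<le> 16" by (simp add: norm_mult norm_power norm_inverse)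
  qed (use assms in auto)
  moreover have "(\<Sum>i\<le>2. ?f i 0 * (w - 0) ^ i / fact i) = w - w\<^sup>2 / 2"
    by (simp add: numeral_2_eq_2)
  ultimately show ?thesis by (simp add: numeral_eq_Suc fact_numeral algebra_simps)
qed

text \<open>The k^-4 coefficient of Ln (1 + E/k^2 + F/k^4).\<close>

definition coeffG :: "(real \<Rightarrow> real) \<Rightarrow> (real \<Rightarrow> real) \<Rightarrow> real" where
  "coeffG q0 q2 = coeffF q0 q2 - (coeffE q0)\<^sup>2 / 2"

lemma coeff_bounds:
  assumes M: "1 \<le> M" and a: "admissible M q0 q1 q2 q3 q4"
  shows "\<bar>coeffE q0\<bar> \<le> M\<^sup>2" "\<bar>coeffF q0 q2\<bar> \<le> M\<^sup>2" "\<bar>coeffB q0 q2\<bar> \<le> M\<^sup>2"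
proof -
  have b: "\<bar>q0 x\<bar> \<le> M" "\<bar>q2 x\<bar> \<le> M" if "x \<in> {0..1}" for x
    using a that unfolding admissible_def by auto
  have MM: "M \<le> M\<^sup>2" using M by (simp add: power2_eq_square)
  have sq: "(q0 x)\<^sup>2 \<le> M\<^sup>2" if "x \<in> {0..1}" for x
    using b(1)[OF that] M by (simp add: abs_le_square_iff[symmetric])
  show "\<bar>coeffE q0\<bar> \<le> M\<^sup>2"
  proof -
    have "\<bar>q0 0 + q0 1\<bar> \<le> 4 * M\<^sup>2" using b(1)[of 0] b(1)[of 1] MM M by simp
    then show ?thesis by (simp add: coeffE_def)
  qed
  have lg: "\<bar>lgv q0 q2 x\<bar> \<le> M\<^sup>2 / 4" if "x \<in> {0..1}" for x
    using b[OF that] sq[OF that] MM zero_le_power2[of "q0 x"] unfolding lgv_def by linarith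
  have "\<bar>q0 0 * q0 1\<bar> \<le> M\<^sup>2"
    unfolding abs_mult power2_eq_square using b(1)[of 0] b(1)[of 1] M by (intro mult_mono) auto
  then show "\<bar>coeffF q0 q2\<bar> \<le> M\<^sup>2"
    unfolding coeffF_def using lg[of 0] lg[of 1] zero_le_power2[of M] by simp
  have c: "continuous_on {0..1} q0" "continuous_on {0..1} q2"
    using a prim_continuous unfolding admissible_def by blast+
  have H: "((\<lambda>x. (q2 x - (q0 x)\<^sup>2) / 8) has_integral coeffB q0 q2) {0..1}"
    unfolding coeffB_def by (intro integrable_integral integrable_continuous_real continuous_intros c) simp
  have bd: "norm ((q2 x - (q0 x)\<^sup>2) / 8) \<le> M\<^sup>2" if x: "x \<in> {0..1}" for x
  proof -
    have "\<bar>q2 x - (q0 x)\<^sup>2\<bar> \<le> 8 * M\<^sup>2"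
      using b(2)[OF x] sq[OF x] MM zero_le_power2[of "q0 x"] zero_le_power2[of M] by linarith
    then show ?thesis by simp
  qed
  have "norm (coeffB q0 q2) \<le> M\<^sup>2 * Henstock_Kurzweil_Integration.content {0..1::real}"
    using has_integral_bound_real[OF zero_le_power2 finite.emptyI H, of M] bd by blast
  then show "\<bar>coeffB q0 q2\<bar> \<le> M\<^sup>2" by simp
qed

text \<open>Dividing by sin k turns the error exp |Im k| / |k|^5 into 4 / |k|^5 and bounds cos k /
  sin k by 4. A condition on sin k, rather than on a circle, also admits k far up the imaginary
  axis, where large negative eigenvalues have to be excluded.\<close>

lemma log_ratio_expansion:
  assumes M: "1 \<le> M"
  shows "\<exists>A K. 0 \<le> A \<and> 1 \<le> K \<and> (\<forall>q0 q1 q2 q3 q4 k. admissible M q0 q1 q2 q3 q4 \<longrightarrow> integral {0..1} q0 = 0 \<longrightarrow>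
     K \<le> norm k \<longrightarrow> exp \<bar>Im k\<bar> / 4 \<le> norm (sin k) \<longrightarrow>
     char_fun (\<lambda>x. 0) (k\<^sup>2) \<noteq> 0 \<and> norm (char_fun q0 (k\<^sup>2) / char_fun (\<lambda>x. 0) (k\<^sup>2) - 1) \<le> 1 / 2 \<and>
     norm (Ln (char_fun q0 (k\<^sup>2) / char_fun (\<lambda>x. 0) (k\<^sup>2)) - (of_real (coeffE q0) / k\<^sup>2 + of_real (coeffG q0 q2) / k ^ 4
        + of_real (coeffB q0 q2) * cos k / (sin k * k ^ 3))) \<le> A / norm k ^ 5)"
proof -
  obtain A0 K0 where A0: "0 \<le> A0" "1 \<le> K0" and main:
    "\<And>q0 q1 q2 q3 q4 k. \<lbrakk>admissible M q0 q1 q2 q3 q4; integral {0..1} q0 = 0; K0 \<le> norm k\<rbrakk> \<Longrightarrow>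
       norm (k * char_fun q0 (k\<^sup>2) - lg_main q0 q2 k) \<le> A0 * exp \<bar>Im k\<bar> / norm k ^ 5"
    using liouville_green_expansion[OF M] by blast
  define L where "L = M\<^sup>2"
  have L1: "1 \<le> L" using M by (simp add: L_def)
  \<comment> \<open>Collects L for each of E and F, 4 L for the cotangent term and 4 A0 for the
    remainder, so that |w| <= W/|k|^2.\<close>
  define W where "W = 6 * L + 4 * A0"
  have W1: "1 \<le> W" using L1 A0 by (simp add: W_def)
  define A where "A = 4 * A0 + W * (L + W) + 8 * W ^ 3"
  define K where "K = K0 + 2 * W"
  show ?thesis
  proof (rule exI[of _ A], rule exI[of _ K], intro conjI allI impI)
    show "0 \<le> A" using A0 W1 L1 by (simp add: A_def)
    show "1 \<le> K" using A0 W1 by (simp add: K_def)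
    fix q0 q1 q2 q3 q4 and k :: complex
    assume adm: "admissible M q0 q1 q2 q3 q4" and mean: "integral {0..1} q0 = 0" and Kk: "K \<le> norm k"
      and sl: "exp \<bar>Im k\<bar> / 4 \<le> norm (sin k)"
    define kk where "kk = norm k"
    have kk: "1 \<le> kk" "2 * W \<le> kk" "K0 \<le> kk" "0 < kk" using Kk A0 W1 by (auto simp: kk_def K_def)
    have k0: "k \<noteq> 0" using kk by (auto simp: kk_def)
    have "0 < exp \<bar>Im k\<bar> / 4" by simp
    then have s0: "sin k \<noteq> 0" using sl by (metis less_le_not_le norm_zero)
    have D0: "char_fun (\<lambda>x. 0) (k\<^sup>2) = sin k / k" by (rule char_fun_zero_potential[OF k0])
    show "char_fun (\<lambda>x. 0) (k\<^sup>2) \<noteq> 0" using s0 k0 by (simp add: D0)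
    define E where "E = complex_of_real (coeffE q0)"
    define F where "F = complex_of_real (coeffF q0 q2)"
    define B where "B = complex_of_real (coeffB q0 q2)"
    have b: "norm E \<le> L" "norm F \<le> L" "norm B \<le> L"
      using coeff_bounds[OF M adm] by (auto simp: E_def F_def B_def L_def)
    define c where "c = cos k / sin k"
    have cb: "norm c \<le> 4"
    proof -
      have "norm (cos k) \<le> 4 * norm (sin k)" using sl norm_cos_le_exp[of k] by linarith
      then show ?thesis using s0 by (simp add: c_def norm_divide divide_le_eq)
    qed
    define w where "w = char_fun q0 (k\<^sup>2) / char_fun (\<lambda>x. 0) (k\<^sup>2) - 1"
    define r where "r = w - (E / k\<^sup>2 + F / k ^ 4 + B * c / k ^ 3)"
    have r: "norm r \<le> 4 * A0 / kk ^ 5"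
    proof -
      have "r = (k * char_fun q0 (k\<^sup>2) - lg_main q0 q2 k) / sin k"
        using s0 k0 by (simp add: r_def w_def D0 lg_main_def E_def F_def B_def c_def field_simps)
      then have "norm r = norm (k * char_fun q0 (k\<^sup>2) - lg_main q0 q2 k) / norm (sin k)" by (simp add: norm_divide)
      also have "\<dots> \<le> (A0 * exp \<bar>Im k\<bar> / kk ^ 5) / (exp \<bar>Im k\<bar> / 4)"
        using main[OF adm mean] kk sl A0 unfolding kk_def by (intro frac_le) auto
      also have "\<dots> = 4 * A0 / kk ^ 5" by simp
      finally show ?thesis .
    qed
    have pw: "1 / kk ^ n \<le> 1 / kk ^ m" if "m \<le> n" for m n
      using kk that by (intro divide_left_mono power_increasing) auto
    have wE: "norm (w - E / k\<^sup>2) \<le> W / kk ^ 3"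
    proof -
      have "w - E / k\<^sup>2 = r + (F / k ^ 4 + B * c / k ^ 3)" by (simp add: r_def)
      also have "norm \<dots> \<le> norm r + (norm (F / k ^ 4) + norm (B * c / k ^ 3))"
        by (intro order_trans[OF norm_triangle_ineq] add_mono) auto
      also have "\<dots> \<le> 4 * A0 * (1 / kk ^ 5) + (L * (1 / kk ^ 4) + (L * 4) * (1 / kk ^ 3))"
      proof (intro add_mono)
        show "norm r \<le> 4 * A0 * (1 / kk ^ 5)" using r by simp
        show "norm (F / k ^ 4) \<le> L * (1 / kk ^ 4)"
          using b kk by (simp add: norm_divide norm_power kk_def[symmetric] divide_right_mono)
        have "norm (B * c) \<le> L * 4" unfolding norm_mult using b cb L1 by (intro mult_mono) auto
        then show "norm (B * c / k ^ 3) \<le> (L * 4) * (1 / kk ^ 3)"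
          using kk by (simp add: norm_divide norm_power kk_def[symmetric] divide_right_mono)
      qed
      also have "\<dots> \<le> 4 * A0 * (1 / kk ^ 3) + (L * (1 / kk ^ 3) + (L * 4) * (1 / kk ^ 3))"
        using A0 L1 by (intro add_mono mult_left_mono pw) auto
      also have "\<dots> = (4 * A0 + 5 * L) * (1 / kk ^ 3)" by (simp add: algebra_simps)
      also have "\<dots> \<le> W * (1 / kk ^ 3)" using L1 kk by (intro mult_right_mono) (auto simp: W_def)
      finally show ?thesis by simp
    qed
    have E2: "norm (E / k\<^sup>2) \<le> L / kk\<^sup>2"
      using b kk by (simp add: norm_divide norm_power kk_def[symmetric] divide_right_mono)
    have w2: "norm w \<le> W / kk\<^sup>2"
    proof -
      have "norm w \<le> norm r + (norm (E / k\<^sup>2) + norm (F / k ^ 4) + norm (B * c / k ^ 3))"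
        using norm_triangle_ineq[of r "E / k\<^sup>2 + F / k ^ 4 + B * c / k ^ 3"]
          norm_triangle_ineq[of "E / k\<^sup>2 + F / k ^ 4" "B * c / k ^ 3"] norm_triangle_ineq[of "E / k\<^sup>2" "F / k ^ 4"]
        by (simp add: r_def)
      also have "\<dots> \<le> 4 * A0 * (1 / kk ^ 5) + (L * (1 / kk ^ 2) + L * (1 / kk ^ 4) + (L * 4) * (1 / kk ^ 3))"
      proof (intro add_mono)
        show "norm r \<le> 4 * A0 * (1 / kk ^ 5)" using r by simp
        show "norm (E / k\<^sup>2) \<le> L * (1 / kk ^ 2)" using E2 by simp
        show "norm (F / k ^ 4) \<le> L * (1 / kk ^ 4)"
          using b kk by (simp add: norm_divide norm_power kk_def[symmetric] divide_right_mono)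
        have "norm (B * c) \<le> L * 4" unfolding norm_mult using b cb L1 by (intro mult_mono) auto
        then show "norm (B * c / k ^ 3) \<le> (L * 4) * (1 / kk ^ 3)"
          using kk by (simp add: norm_divide norm_power kk_def[symmetric] divide_right_mono)
      qed
      also have "\<dots> \<le> 4 * A0 * (1 / kk ^ 2) + (L * (1 / kk ^ 2) + L * (1 / kk ^ 2) + (L * 4) * (1 / kk ^ 2))"
        using A0 L1 by (intro add_mono mult_left_mono pw) auto
      also have "\<dots> = W * (1 / kk ^ 2)" by (simp add: W_def algebra_simps)
      finally show ?thesis by simp
    qed
    have whalf: "norm w \<le> 1 / 2"
    proof -
      have "W / kk\<^sup>2 \<le> W / kk" using mult_left_mono[OF pw[of 1 2], of W] W1 by simp
      also have "\<dots> \<le> 1 / 2" using kk by (simp add: divide_le_eq)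
      finally show ?thesis using w2 by linarith
    qed
    then show "norm (char_fun q0 (k\<^sup>2) / char_fun (\<lambda>x. 0) (k\<^sup>2) - 1) \<le> 1 / 2" by (simp add: w_def)
    have fw: "char_fun q0 (k\<^sup>2) / char_fun (\<lambda>x. 0) (k\<^sup>2) = 1 + w" by (simp add: w_def)
    have G: "complex_of_real (coeffG q0 q2) = F - E\<^sup>2 / 2" by (simp add: coeffG_def E_def F_def)
    \<comment> \<open>w^2 is E^2/k^4 plus (w - E/k^2) (w + E/k^2), and this product is O(k^-3)
      O(k^-2). Hence the E^2/2 in \<open>coeffG\<close>.\<close>
    have "Ln (1 + w) - (E / k\<^sup>2 + (F - E\<^sup>2 / 2) / k ^ 4 + B * cos k / (sin k * k ^ 3)) =
        (Ln (1 + w) - w + w\<^sup>2 / 2) + (r - (w - E / k\<^sup>2) * (w + E / k\<^sup>2) / 2)"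
      using k0 s0 by (simp add: r_def c_def field_simps power2_eq_square numeral_eq_Suc)
    also have "norm \<dots> \<le> 8 * W ^ 3 * (1 / kk ^ 5) + (4 * A0 * (1 / kk ^ 5) + W * (L + W) * (1 / kk ^ 5))"
    proof -
      have n1: "norm r \<le> 4 * A0 * (1 / kk ^ 5)" using r by simp
      have "norm (Ln (1 + w) - w + w\<^sup>2 / 2) \<le> 8 * norm w ^ 3" by (rule Ln_quadratic_approx[OF whalf])
      also have "\<dots> \<le> 8 * (W / kk\<^sup>2) ^ 3" using w2 by (intro mult_left_mono power_mono) auto
      also have "\<dots> = 8 * W ^ 3 * (1 / kk ^ 6)" by (simp add: power_divide flip: power_mult)
      also have "\<dots> \<le> 8 * W ^ 3 * (1 / kk ^ 5)" using W1 by (intro mult_left_mono pw) auto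
      finally have n2: "norm (Ln (1 + w) - w + w\<^sup>2 / 2) \<le> 8 * W ^ 3 * (1 / kk ^ 5)" .
      have s: "norm (w + E / k\<^sup>2) \<le> (L + W) / kk\<^sup>2"
        using w2 E2 norm_triangle_ineq[of w "E / k\<^sup>2"] by (simp add: add_divide_distrib)
      have "norm ((w - E / k\<^sup>2) * (w + E / k\<^sup>2) / 2) \<le> norm (w - E / k\<^sup>2) * norm (w + E / k\<^sup>2)"
        by (simp add: norm_mult norm_divide)
      also have "\<dots> \<le> W / kk ^ 3 * ((L + W) / kk\<^sup>2)"
        using wE s W1 kk by (intro mult_mono) auto
      also have "\<dots> = W * (L + W) * (1 / kk ^ 5)" by (simp flip: power_add)
      finally have n3: "norm ((w - E / k\<^sup>2) * (w + E / k\<^sup>2) / 2) \<le> W * (L + W) * (1 / kk ^ 5)" .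
      show ?thesis
        by (rule order_trans[OF norm_triangle_ineq add_mono[OF n2 order_trans[OF norm_triangle_ineq4 add_mono[OF n1 n3]]]])
    qed
    also have "\<dots> = A / kk ^ 5" by (simp add: A_def algebra_simps add_divide_distrib)
    finally show "norm (Ln (char_fun q0 (k\<^sup>2) / char_fun (\<lambda>x. 0) (k\<^sup>2)) - (of_real (coeffE q0) / k\<^sup>2 + of_real (coeffG q0 q2) / k ^ 4
        + of_real (coeffB q0 q2) * cos k / (sin k * k ^ 3))) \<le> A / norm k ^ 5"
      by (simp only: fw G E_def[symmetric] B_def[symmetric] kk_def[symmetric])
  qed
qed

section \<open>Counting and summing eigenvalues\<close>

abbreviation char_fun0 :: "complex \<Rightarrow> complex" where "char_fun0 \<equiv> char_fun (\<lambda>x. 0)"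

text \<open>A radius for k, midway between the zeros \<pi> N and \<pi> (N + 1) of the sine; the
  circles for \<lambda> = k^2 have radius \<open>(rad N)\<^sup>2\<close>.\<close>

definition rad :: "nat \<Rightarrow> real" where "rad N = pi * (real N + 1 / 2)"

lemma rad_pos: "0 < rad N"
  by (simp add: rad_def add_nonneg_pos)

lemma rad_ge: "real N + 1 \<le> rad N"
proof -
  have "3 * (real N + 1 / 2) \<le> pi * (real N + 1 / 2)" using pi_gt3 by (intro mult_right_mono) auto
  then show ?thesis unfolding rad_def by (simp add: algebra_simps)
qed

lemma norm_csqrt_circle: "norm z = (rad N)\<^sup>2 \<Longrightarrow> norm (csqrt z) = rad N"
  using rad_pos[of N] by (simp add: real_sqrt_unique)

lemma square_less_rad: "(pi * real n)\<^sup>2 < (rad N)\<^sup>2 \<longleftrightarrow> n \<le> N"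
proof -
  have "(pi * real n)\<^sup>2 < (rad N)\<^sup>2 \<longleftrightarrow> pi * real n < rad N"
    using rad_pos[of N] by (auto simp: power_strict_mono dest: power2_less_imp_less)
  also have "\<dots> \<longleftrightarrow> real n < real N + 1 / 2" unfolding rad_def by simp
  also have "\<dots> \<longleftrightarrow> n \<le> N" by linarith
  finally show ?thesis .
qed

lemma char_fun0_zero_set: "{z. norm z < (rad N)\<^sup>2 \<and> char_fun0 z = 0} = (\<lambda>n. of_real ((pi * real n)\<^sup>2)) ` {1..N}"
proof -
  have "norm (complex_of_real ((pi * real n)\<^sup>2)) < (rad N)\<^sup>2 \<longleftrightarrow> n \<le> N" for n
    unfolding norm_of_real using square_less_rad[of n N] by simp
  then show ?thesis by (auto simp: char_fun_zero_potential_zeros simp del: of_real_power of_real_mult)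
qed

lemma inj_on_square: "inj_on (\<lambda>n. complex_of_real ((pi * real n)\<^sup>2)) {1..N}"
proof (rule inj_onI)
  fix x y assume "complex_of_real ((pi * real x)\<^sup>2) = complex_of_real ((pi * real y)\<^sup>2)"
  then have "(pi * real x)\<^sup>2 = (pi * real y)\<^sup>2" by (simp only: of_real_eq_iff)
  then have "pi * real x = pi * real y" by (rule power2_eq_imp_eq) auto
  then show "x = y" by simp
qed

lemma char_fun0_sum: "(\<Sum>z | norm z < (rad N)\<^sup>2 \<and> char_fun0 z = 0. h z) = (\<Sum>n=1..N. h (of_real ((pi * real n)\<^sup>2)))"
  unfolding char_fun0_zero_set by (subst sum.reindex[OF inj_on_square]) (simp add: o_def)

lemma char_fun0_simple: "char_fun0 z = 0 \<Longrightarrow> deriv char_fun0 z \<noteq> 0"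
  using char_fun_simple_zero[of "\<lambda>x. 0"] by (auto simp: char_fun_zero_potential_zeros simp del: of_real_power of_real_mult)

lemma char_fun0_nonzero_circle:
  assumes "1 \<le> N" "norm z = (rad N)\<^sup>2" shows "sin (csqrt z) \<noteq> 0" "csqrt z \<noteq> 0" "char_fun0 z \<noteq> 0"
proof -
  have n: "norm (csqrt z) = rad N" by (rule norm_csqrt_circle[OF assms(2)])
  have "exp \<bar>Im (csqrt z)\<bar> / 4 \<le> norm (sin (csqrt z))"
    using n by (intro norm_sin_lower_circle[OF assms(1)]) (simp add: rad_def)
  moreover have "0 < exp \<bar>Im (csqrt z)\<bar> / 4" by simp
  ultimately show s: "sin (csqrt z) \<noteq> 0" by (metis less_le_not_le norm_zero)
  show k: "csqrt z \<noteq> 0" using n rad_pos[of N] by auto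
  show "char_fun0 z \<noteq> 0" using char_fun_zero_potential[OF k] s k by simp
qed

text \<open>Differentiating \<Delta>(k^2) = sin k / k, where \<Delta> is \<open>char_fun0\<close>,
  shows that the integrand is 2 \<Delta>'/\<Delta> + 1/\<lambda>: twice the N zeros, plus one. It is
  even in k, so the branch cut of \<open>csqrt\<close> leaves no trace.\<close>

lemma cot_contour_integral:
  assumes N: "1 \<le> N"
  shows "((\<lambda>z. cos (csqrt z) / (csqrt z * sin (csqrt z))) has_contour_integral 2 * pi * \<i> * (2 * of_nat N + 1)) (circlepath 0 ((rad N)\<^sup>2))"
proof -
  let ?R = "(rad N)\<^sup>2"
  have R: "0 < ?R" using rad_pos[of N] by simp
  have hol: "char_fun0 holomorphic_on UNIV" by (rule char_fun_holomorphic) simp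
  have im: "path_image (circlepath 0 ?R) = sphere 0 ?R" using R by (simp add: path_image_circlepath_nonneg)
  note nz = char_fun0_nonzero_circle[OF N]
  have I1: "(\<lambda>z. deriv char_fun0 z * 1 / char_fun0 z) contour_integrable_on circlepath 0 ?R"
  proof (rule contour_integrable_continuous_circlepath)
    show "continuous_on (path_image (circlepath 0 ?R)) (\<lambda>z. deriv char_fun0 z * 1 / char_fun0 z)"
      unfolding im using nz(3) holomorphic_deriv[OF hol] hol
      by (intro continuous_intros) (auto intro: holomorphic_on_imp_continuous_on holomorphic_on_subset)
  qed
  have "contour_integral (circlepath 0 ?R) (\<lambda>z. deriv char_fun0 z * 1 / char_fun0 z) = 2 * pi * \<i> * (\<Sum>z | norm z < ?R \<and> char_fun0 z = 0. 1)"
    by (rule argument_principle_circle(2)[OF hol _ R]) (use nz char_fun0_simple in auto)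
  also have "(\<Sum>z | norm z < ?R \<and> char_fun0 z = 0. 1::complex) = of_nat N"
    unfolding char_fun0_sum by simp
  finally have H1: "((\<lambda>z. deriv char_fun0 z * 1 / char_fun0 z) has_contour_integral 2 * pi * \<i> * of_nat N) (circlepath 0 ?R)"
    using has_contour_integral_integral[OF I1] by simp
  have I2: "(\<lambda>z. 1 / (z - 0)) contour_integrable_on circlepath 0 ?R"
  proof (rule contour_integrable_continuous_circlepath)
    show "continuous_on (path_image (circlepath 0 ?R)) (\<lambda>z. 1 / (z - 0))"
      unfolding im using R by (intro continuous_intros) auto
  qed
  have H2: "((\<lambda>z. 1 / (z - 0)) has_contour_integral 2 * pi * \<i>) (circlepath 0 ?R)"
    using has_contour_integral_integral[OF I2] contour_integral_circlepath[OF R, of 0] by simp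
  have "((\<lambda>z. 2 * (deriv char_fun0 z * 1 / char_fun0 z) + 1 / (z - 0)) has_contour_integral 2 * (2 * pi * \<i> * of_nat N) + 2 * pi * \<i>) (circlepath 0 ?R)"
    by (intro has_contour_integral_add has_contour_integral_lmul H1 H2)
  then have "((\<lambda>z. cos (csqrt z) / (csqrt z * sin (csqrt z))) has_contour_integral 2 * (2 * pi * \<i> * of_nat N) + 2 * pi * \<i>) (circlepath 0 ?R)"
  proof (rule has_contour_integral_eq)
    fix z assume "z \<in> path_image (circlepath 0 ?R)"
    then have z: "norm z = ?R" using im by simp
    define k where "k = csqrt z"
    have k: "k \<noteq> 0" "sin k \<noteq> 0" "k\<^sup>2 = z" using nz[OF z] by (auto simp: k_def)
    have "(char_fun0 has_field_derivative deriv char_fun0 (k\<^sup>2)) (at (k\<^sup>2))"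
      by (rule holomorphic_derivI[OF hol]) auto
    moreover have "((\<lambda>k. k\<^sup>2) has_field_derivative 2 * k) (at k)"
      by (auto intro!: derivative_eq_intros)
    ultimately have 1: "((\<lambda>k. char_fun0 (k\<^sup>2)) has_field_derivative deriv char_fun0 (k\<^sup>2) * (2 * k)) (at k)"
      by (rule DERIV_chain2[where f = char_fun0 and g = "\<lambda>k. k\<^sup>2"])
    have "((\<lambda>k. sin k / k) has_field_derivative (cos k * k - sin k) / (k * k)) (at k)"
      using k by (auto intro!: derivative_eq_intros)
    then have "((\<lambda>k. char_fun0 (k\<^sup>2)) has_field_derivative (cos k * k - sin k) / (k * k)) (at k)"
      by (rule has_field_derivative_transform_within_open[where S = "-{0}"]) (use k char_fun_zero_potential in auto)
    from DERIV_unique[OF 1 this] have d: "deriv char_fun0 z * (2 * k) = (cos k * k - sin k) / (k * k)" using k by simp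
    have D: "char_fun0 z = sin k / k" using char_fun_zero_potential[OF k(1)] k by simp
    have "2 * (deriv char_fun0 z * 1 / char_fun0 z) = (deriv char_fun0 z * (2 * k)) / sin k" using k by (simp add: D)
    also have "\<dots> = (cos k * k - sin k) / (k * k) / sin k" by (simp only: d)
    also have "\<dots> = cos k / (k * sin k) - 1 / z"
      unfolding k(3)[symmetric] using k(1,2) by (simp add: field_simps power2_eq_square)
    finally show "2 * (deriv char_fun0 z * 1 / char_fun0 z) + 1 / (z - 0) = cos (csqrt z) / (csqrt z * sin (csqrt z))"
      by (simp add: k_def)
  qed
  then show ?thesis by (simp add: algebra_simps)
qed

text \<open>Here \<open>\<alpha>\<close> are the eigenvalues for the potential minus its mean \<open>\<mu>\<close>, so that
  \<open>\<lambda>\<^sup>2 + 2 \<mu> \<lambda> = (\<lambda> + \<mu>)\<^sup>2 - \<mu>\<^sup>2\<close> refers back to the unshifted eigenvalues.\<close>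

definition trace_term :: "real \<Rightarrow> real \<Rightarrow> (nat \<Rightarrow> real) \<Rightarrow> nat \<Rightarrow> real" where
  "trace_term \<mu> b \<alpha> n = (\<alpha> n)\<^sup>2 + 2 * \<mu> * \<alpha> n - ((pi * real n)\<^sup>2)\<^sup>2 - 2 * \<mu> * (pi * real n)\<^sup>2 + 4 * b"

text \<open>A bootstrap, with \<theta> the deviation of k from \<pi> n. The equation first gives sin
  \<theta> = O(k^-3), and |\<theta>| <= 2 |sin \<theta>| on this range, so \<theta> = O(k^-3). Then
  sin \<theta> and cos \<theta> may be replaced by \<theta> and 1, leaving \<theta> = -b/k^3 +
  O(k^-5).\<close>

lemma real_theta_bound:
  fixes k \<theta> e f b L a :: real
  assumes k: "1 \<le> k" "4 * L \<le> k" and L: "1 \<le> L" and b: "\<bar>e\<bar> \<le> L" "\<bar>f\<bar> \<le> L" "\<bar>b\<bar> \<le> L" and a: "0 \<le> a"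
    and \<theta>: "\<bar>\<theta>\<bar> \<le> pi / 2"
    and main: "\<bar>sin \<theta> * (1 + e / k\<^sup>2 + f / k ^ 4) + b * cos \<theta> / k ^ 3\<bar> \<le> a / k ^ 5"
  shows "\<bar>\<theta>\<bar> \<le> 4 * (L + a) / k ^ 3" "\<bar>\<theta> + b / k ^ 3\<bar> \<le> (64 * (L + a) ^ 3 + 4 * L * (L + a) + 16 * L * (L + a)\<^sup>2 + a) / k ^ 5"
proof -
  define c where "c = L + a"
  have c1: "1 \<le> c" "L \<le> c" "a \<le> c" using L a by (auto simp: c_def)
  have k0: "0 < k" using k by simp
  have pw: "1 / k ^ n \<le> 1 / k ^ m" if "m \<le> n" for m n
    using k that by (intro divide_left_mono power_increasing) auto
  define g where "g = e / k\<^sup>2 + f / k ^ 4"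
  have g: "\<bar>g\<bar> \<le> 2 * L * (1 / k\<^sup>2)"
  proof -
    have "\<bar>e / k\<^sup>2\<bar> \<le> L * (1 / k\<^sup>2)" using b(1) by (simp add: abs_divide divide_right_mono)
    moreover have "\<bar>f / k ^ 4\<bar> \<le> L * (1 / k ^ 4)" using b(2) by (simp add: abs_divide divide_right_mono)
    moreover have "L * (1 / k ^ 4) \<le> L * (1 / k\<^sup>2)" using L by (intro mult_left_mono pw) auto
    ultimately show ?thesis unfolding g_def by linarith
  qed
  have ghalf: "\<bar>g\<bar> \<le> 1 / 2"
  proof -
    have "2 * L * (1 / k\<^sup>2) \<le> 2 * L * (1 / k ^ 1)" using L by (intro mult_left_mono pw) auto
    also have "\<dots> \<le> 1 / 2" using k by (simp add: divide_le_eq)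
    finally show ?thesis using g by linarith
  qed
  define h where "h = b * cos \<theta> / k ^ 3"
  have h: "\<bar>h\<bar> \<le> L * (1 / k ^ 3)"
  proof -
    have "\<bar>b * cos \<theta>\<bar> \<le> L * 1" unfolding abs_mult using b L by (intro mult_mono) auto
    then show ?thesis using k0 by (simp add: h_def abs_divide divide_right_mono)
  qed
  have mn: "\<bar>sin \<theta> + sin \<theta> * g + h\<bar> \<le> a * (1 / k ^ 5)"
    using main by (simp add: g_def h_def algebra_simps)
  have sg: "\<bar>sin \<theta> * g\<bar> \<le> \<bar>sin \<theta>\<bar> * (1 / 2)" unfolding abs_mult using ghalf by (intro mult_left_mono) auto
  have a3: "a * (1 / k ^ 5) \<le> a * (1 / k ^ 3)" using a by (intro mult_left_mono pw) auto
  have s: "\<bar>sin \<theta>\<bar> \<le> 2 * c * (1 / k ^ 3)"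
  proof -
    have "\<bar>sin \<theta>\<bar> \<le> 2 * (L * (1 / k ^ 3)) + 2 * (a * (1 / k ^ 3))" using mn sg h a3 by linarith
    also have "\<dots> = 2 * c * (1 / k ^ 3)" by (simp add: c_def algebra_simps)
    finally show ?thesis .
  qed
  have sinb: "\<bar>sin \<theta> - \<theta>\<bar> \<le> \<bar>\<theta>\<bar> ^ 3 / 6"
    using Maclaurin_sin_bound[of \<theta> 3] by (simp add: sin_coeff_def numeral_eq_Suc fact_numeral)
  have "\<bar>\<theta>\<bar> ^ 3 / 6 \<le> \<bar>\<theta>\<bar> / 2"
  proof -
    \<comment> \<open>8/5 exceeds \<pi>/2, and its square is below 3.\<close>
    have "\<bar>\<theta>\<bar> \<le> 8 / 5" using \<theta> pi_less_4 pi_approx by simp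
    then have "\<bar>\<theta>\<bar> * \<bar>\<theta>\<bar> \<le> 8 / 5 * (8 / 5)" by (intro mult_mono) auto
    then have "\<bar>\<theta>\<bar> * (\<bar>\<theta>\<bar> * \<bar>\<theta>\<bar>) \<le> \<bar>\<theta>\<bar> * 3" by (intro mult_left_mono) auto
    then show ?thesis by (simp add: power3_eq_cube)
  qed
  then have "\<bar>\<theta>\<bar> \<le> 2 * \<bar>sin \<theta>\<bar>" using sinb by linarith
  then have t: "\<bar>\<theta>\<bar> \<le> 4 * c * (1 / k ^ 3)" using s by linarith
  then show "\<bar>\<theta>\<bar> \<le> 4 * (L + a) / k ^ 3" by (simp add: c_def)
  have t3: "\<bar>\<theta>\<bar> ^ 3 \<le> 64 * c ^ 3 * (1 / k ^ 5)"
  proof -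
    have "\<bar>\<theta>\<bar> ^ 3 \<le> (4 * c * (1 / k ^ 3)) ^ 3" using t by (intro power_mono) auto
    also have "\<dots> = 64 * c ^ 3 * (1 / k ^ 9)" by (simp add: power_mult_distrib power_divide flip: power_mult)
    also have "\<dots> \<le> 64 * c ^ 3 * (1 / k ^ 5)" using c1 by (intro mult_left_mono pw) auto
    finally show ?thesis .
  qed
  have t2: "\<theta>\<^sup>2 \<le> 16 * c\<^sup>2 * (1 / k\<^sup>2)"
  proof -
    have "\<bar>\<theta>\<bar>\<^sup>2 \<le> (4 * c * (1 / k ^ 3))\<^sup>2" using t by (intro power_mono) auto
    also have "\<dots> = 16 * c\<^sup>2 * (1 / k ^ 6)" by (simp add: power_mult_distrib power_divide flip: power_mult)
    also have "\<dots> \<le> 16 * c\<^sup>2 * (1 / k\<^sup>2)" using c1 by (intro mult_left_mono pw) auto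
    finally show ?thesis by simp
  qed
  have hb: "\<bar>h - b / k ^ 3\<bar> \<le> 16 * L * c\<^sup>2 * (1 / k ^ 5)"
  proof -
    have "\<bar>cos \<theta> - 1\<bar> \<le> \<theta>\<^sup>2"
    proof -
      have "cos \<theta> = 1 - 2 * (sin (\<theta> / 2))\<^sup>2" using cos_double_sin[of "\<theta> / 2"] by simp
      moreover have "(sin (\<theta> / 2))\<^sup>2 \<le> (\<theta> / 2)\<^sup>2"
        using abs_sin_x_le_abs_x[of "\<theta> / 2"] by (simp only: abs_le_square_iff)
      moreover have "(\<theta> / 2)\<^sup>2 = \<theta>\<^sup>2 / 4" by (simp add: power_divide)
      ultimately show ?thesis using zero_le_power2[of \<theta>] zero_le_power2[of "sin (\<theta> / 2)"] by linarith
    qed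
    then have "\<bar>b\<bar> * \<bar>cos \<theta> - 1\<bar> * (1 / k ^ 3) \<le> L * (16 * c\<^sup>2 * (1 / k\<^sup>2)) * (1 / k ^ 3)"
      using b t2 L k0 by (intro mult_mono) auto
    moreover have "\<bar>h - b / k ^ 3\<bar> = \<bar>b\<bar> * \<bar>cos \<theta> - 1\<bar> * (1 / k ^ 3)"
    proof -
      have "h - b / k ^ 3 = b * (cos \<theta> - 1) * (1 / k ^ 3)" by (simp add: h_def algebra_simps diff_divide_distrib)
      then show ?thesis using k0 by (simp only: abs_mult) simp
    qed
    moreover have "L * (16 * c\<^sup>2 * (1 / k\<^sup>2)) * (1 / k ^ 3) = 16 * L * c\<^sup>2 * (1 / k ^ 5)" by (simp flip: power_add)
    ultimately show ?thesis by linarith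
  qed
  have sg5: "\<bar>sin \<theta> * g\<bar> \<le> 4 * L * c * (1 / k ^ 5)"
  proof -
    have "\<bar>sin \<theta> * g\<bar> \<le> (2 * c * (1 / k ^ 3)) * (2 * L * (1 / k\<^sup>2))"
      unfolding abs_mult using s g c1 k0 by (intro mult_mono) auto
    also have "\<dots> = 4 * L * c * (1 / k ^ 5)" by (simp flip: power_add)
    finally show ?thesis .
  qed
  have "\<bar>\<theta> + b / k ^ 3\<bar> \<le> 64 * c ^ 3 * (1 / k ^ 5) + 4 * L * c * (1 / k ^ 5) + 16 * L * c\<^sup>2 * (1 / k ^ 5) + a * (1 / k ^ 5)"
    using t3 hb sg5 mn sinb zero_le_power[OF abs_ge_zero[of \<theta>], of 3] by linarith
  also have "\<dots> = (64 * c ^ 3 + 4 * L * c + 16 * L * c\<^sup>2 + a) / k ^ 5"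
    by (simp add: add_divide_distrib)
  finally show "\<bar>\<theta> + b / k ^ 3\<bar> \<le> (64 * (L + a) ^ 3 + 4 * L * (L + a) + 16 * L * (L + a)\<^sup>2 + a) / k ^ 5"
    by (simp add: c_def)
qed

text \<open>Here k - \<theta> plays the part of \<pi> n. The difference u of the two squares is -2
  b/k^2 + O(k^-4), and in u (2 k^2 - u + 2 \<mu>) the leading contribution -4 b is cancelled by the
  added 4 b.\<close>

lemma square_term_bound:
  fixes k \<theta> b \<mu> c d L :: real
  assumes k: "1 \<le> k" and b: "\<bar>b\<bar> \<le> L" and \<mu>: "\<bar>\<mu>\<bar> \<le> L" and c: "0 \<le> c" and d: "0 \<le> d"
    and \<theta>: "\<bar>\<theta>\<bar> \<le> c / k ^ 3" "\<bar>\<theta> + b / k ^ 3\<bar> \<le> d / k ^ 5"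
  shows "\<bar>(k\<^sup>2)\<^sup>2 + 2 * \<mu> * k\<^sup>2 - ((k - \<theta>)\<^sup>2)\<^sup>2 - 2 * \<mu> * (k - \<theta>)\<^sup>2 + 4 * b\<bar> \<le>
     (2 * (2 * d + c\<^sup>2) + (2 * L + (2 * d + c\<^sup>2)) * (4 * L + (2 * d + c\<^sup>2))) / k\<^sup>2"
proof -
  have k0: "0 < k" using k by simp
  have L0: "0 \<le> L" using b by linarith
  have pw: "1 / k ^ n \<le> 1 / k ^ m" if "m \<le> n" for m n
    using k that by (intro divide_left_mono power_increasing) auto
  define z where "z = 2 * d + c\<^sup>2"
  have z0: "0 \<le> z" using d by (simp add: z_def)
  define e where "e = 2 * k * (\<theta> + b / k ^ 3) - \<theta>\<^sup>2"
  define u where "u = - (2 * b / k\<^sup>2) + e"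
  have u: "u = k\<^sup>2 - (k - \<theta>)\<^sup>2"
    using k0 by (simp add: u_def e_def power2_eq_square power3_eq_cube field_simps)
  have e: "\<bar>e\<bar> \<le> z * (1 / k ^ 4)"
  proof -
    have "\<bar>2 * k * (\<theta> + b / k ^ 3)\<bar> \<le> 2 * k * (d / k ^ 5)"
      unfolding abs_mult using \<theta>(2) k0 by (intro mult_mono) auto
    also have "\<dots> = 2 * d * (1 / k ^ 4)" using k0 by (simp add: field_simps numeral_eq_Suc)
    finally have 1: "\<bar>2 * k * (\<theta> + b / k ^ 3)\<bar> \<le> 2 * d * (1 / k ^ 4)" .
    have "\<bar>\<theta>\<bar>\<^sup>2 \<le> (c / k ^ 3)\<^sup>2" using \<theta>(1) by (intro power_mono) auto
    also have "\<dots> = c\<^sup>2 * (1 / k ^ 6)" by (simp add: power_divide flip: power_mult)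
    also have "\<dots> \<le> c\<^sup>2 * (1 / k ^ 4)" by (intro mult_left_mono pw) auto
    finally have "\<theta>\<^sup>2 \<le> c\<^sup>2 * (1 / k ^ 4)" by simp
    then have "\<bar>e\<bar> \<le> 2 * d * (1 / k ^ 4) + c\<^sup>2 * (1 / k ^ 4)"
      using 1 unfolding e_def using zero_le_power2[of \<theta>] by linarith
    then show ?thesis by (simp add: z_def algebra_simps)
  qed
  have e2: "\<bar>e\<bar> \<le> z * (1 / k\<^sup>2)" using order_trans[OF e mult_left_mono[OF pw[of 2 4] z0]] by simp
  have ub: "\<bar>u\<bar> \<le> (2 * L + z) * (1 / k\<^sup>2)"
  proof -
    have "\<bar>2 * b / k\<^sup>2\<bar> \<le> 2 * L * (1 / k\<^sup>2)" using b by (simp add: abs_divide divide_right_mono)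
    then have "\<bar>u\<bar> \<le> 2 * L * (1 / k\<^sup>2) + z * (1 / k\<^sup>2)" unfolding u_def using e2 by linarith
    then show ?thesis by (simp add: algebra_simps add_divide_distrib)
  qed
  have ub1: "\<bar>u\<bar> \<le> 2 * L + z"
  proof -
    have "(2 * L + z) * (1 / k\<^sup>2) \<le> (2 * L + z) * (1 / k ^ 0)" using L0 z0 by (intro mult_left_mono pw) auto
    then show ?thesis using ub by simp
  qed
  have "(k\<^sup>2)\<^sup>2 + 2 * \<mu> * k\<^sup>2 - ((k - \<theta>)\<^sup>2)\<^sup>2 - 2 * \<mu> * (k - \<theta>)\<^sup>2 + 4 * b = u * (2 * k\<^sup>2 - u + 2 * \<mu>) + 4 * b"
    unfolding u by (simp add: algebra_simps power2_eq_square)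
  also have "\<dots> = 2 * k\<^sup>2 * e + u * (2 * \<mu> - u)"
  proof -
    have "u * (2 * k\<^sup>2) + 4 * b = 2 * k\<^sup>2 * e" using k0 by (simp add: u_def field_simps)
    then show ?thesis by (simp add: algebra_simps)
  qed
  finally have id: "(k\<^sup>2)\<^sup>2 + 2 * \<mu> * k\<^sup>2 - ((k - \<theta>)\<^sup>2)\<^sup>2 - 2 * \<mu> * (k - \<theta>)\<^sup>2 + 4 * b = 2 * k\<^sup>2 * e + u * (2 * \<mu> - u)" .
  have A: "\<bar>2 * k\<^sup>2 * e\<bar> \<le> 2 * z / k\<^sup>2"
  proof -
    have "\<bar>2 * k\<^sup>2 * e\<bar> \<le> 2 * k\<^sup>2 * (z * (1 / k ^ 4))" unfolding abs_mult using e by (intro mult_mono) auto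
    also have "\<dots> = 2 * z / k\<^sup>2" using k0 by (simp add: field_simps numeral_eq_Suc)
    finally show ?thesis .
  qed
  have B: "\<bar>u * (2 * \<mu> - u)\<bar> \<le> (2 * L + z) * (4 * L + z) / k\<^sup>2"
  proof -
    have "\<bar>u * (2 * \<mu> - u)\<bar> \<le> (2 * L + z) * (1 / k\<^sup>2) * (4 * L + z)"
      unfolding abs_mult using ub ub1 \<mu> L0 z0 by (intro mult_mono) auto
    then show ?thesis by simp
  qed
  show ?thesis unfolding id z_def[symmetric] add_divide_distrib using A B by linarith
qed

text \<open>The trace formula for mean-zero potentials, with \<open>\<mu>\<close> kept free so that
  the shift by the mean can be undone afterwards. The constants 2 G + 2 \<mu> E come from the
  1/\<lambda> terms of weight times logarithm, and 2 B from the cotangent. The rates 1/N and 1/n^2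
  serve uniform and absolute convergence.\<close>

theorem trace_core:
  assumes M: "1 \<le> M"
  shows "\<exists>C N0. 0 \<le> C \<and> (1::nat) \<le> N0 \<and> (\<forall>q0 q1 q2 q3 q4 \<mu> \<alpha>. admissible M q0 q1 q2 q3 q4 \<longrightarrow> integral {0..1} q0 = 0 \<longrightarrow>
     \<bar>\<mu>\<bar> \<le> M \<longrightarrow> strict_mono_on {1..} \<alpha> \<longrightarrow> {l. char_fun q0 l = 0} = (\<lambda>n. complex_of_real (\<alpha> n)) ` {1..} \<longrightarrow>
     (\<forall>N\<ge>N0. \<bar>(\<Sum>n=1..N. trace_term \<mu> (coeffB q0 q2) \<alpha> n) + 2 * coeffG q0 q2 + 2 * \<mu> * coeffE q0 + 2 * coeffB q0 q2\<bar> \<le> C / real N) \<and>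
     (\<forall>n>N0. \<bar>trace_term \<mu> (coeffB q0 q2) \<alpha> n\<bar> \<le> C / (real n)\<^sup>2))"
proof -
  obtain A1 K1 where A1: "0 \<le> A1" "1 \<le> K1" and lg:
    "\<And>q0 q1 q2 q3 q4 k. \<lbrakk>admissible M q0 q1 q2 q3 q4; integral {0..1} q0 = 0; K1 \<le> norm k\<rbrakk> \<Longrightarrow>
       norm (k * char_fun q0 (k\<^sup>2) - lg_main q0 q2 k) \<le> A1 * exp \<bar>Im k\<bar> / norm k ^ 5"
    using liouville_green_expansion[OF M] by blast
  obtain A2 K2 where A2: "0 \<le> A2" "1 \<le> K2" and lr:
    "\<And>q0 q1 q2 q3 q4 k. \<lbrakk>admissible M q0 q1 q2 q3 q4; integral {0..1} q0 = 0; K2 \<le> norm k; exp \<bar>Im k\<bar> / 4 \<le> norm (sin k)\<rbrakk> \<Longrightarrow>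
     char_fun0 (k\<^sup>2) \<noteq> 0 \<and> norm (char_fun q0 (k\<^sup>2) / char_fun0 (k\<^sup>2) - 1) \<le> 1 / 2 \<and>
     norm (Ln (char_fun q0 (k\<^sup>2) / char_fun0 (k\<^sup>2)) - (of_real (coeffE q0) / k\<^sup>2 + of_real (coeffG q0 q2) / k ^ 4
        + of_real (coeffB q0 q2) * cos k / (sin k * k ^ 3))) \<le> A2 / norm k ^ 5"
    using log_ratio_expansion[OF M] by metis
  define L where "L = M\<^sup>2"
  have L1: "1 \<le> L" using one_le_power[OF M, of 2] by (simp add: L_def)
  have MleL: "M \<le> L" using M by (simp add: L_def power2_eq_square)
  obtain N0 :: nat where N0: "K1 + K2 + 4 * L \<le> real N0" using real_arch_simple by blast
  have N01: "1 \<le> N0" using N0 A1 A2 L1 by linarith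
  define c where "c = 4 * (L + A1)"
  define d where "d = 64 * (L + A1) ^ 3 + 4 * L * (L + A1) + 16 * L * (L + A1)\<^sup>2 + A1"
  have cd: "0 \<le> c" "0 \<le> d" using L1 A1 by (auto simp: c_def d_def)
  define C1 where "C1 = 2 * (2 * d + c\<^sup>2) + (2 * L + (2 * d + c\<^sup>2)) * (4 * L + (2 * d + c\<^sup>2))"
  define C2 where "C2 = 4 * A2 + 8 * L * L"
  have C10: "0 \<le> C1" and C20: "0 \<le> C2" using cd L1 A2 by (auto simp: C1_def C2_def)
  have "(\<forall>N\<ge>N0. \<bar>(\<Sum>n=1..N. trace_term \<mu> (coeffB q0 q2) \<alpha> n) + 2 * coeffG q0 q2 + 2 * \<mu> * coeffE q0 + 2 * coeffB q0 q2\<bar> \<le> (C1 + C2) / real N) \<and>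
     (\<forall>n>N0. \<bar>trace_term \<mu> (coeffB q0 q2) \<alpha> n\<bar> \<le> (C1 + C2) / (real n)\<^sup>2)"
    if adm: "admissible M q0 q1 q2 q3 q4" and mean: "integral {0..1} q0 = 0" and \<mu>: "\<bar>\<mu>\<bar> \<le> M"
      and mono: "strict_mono_on {1..} \<alpha>" and zeros: "{l. char_fun q0 l = 0} = (\<lambda>n. complex_of_real (\<alpha> n)) ` {1..}"
    for q0 q1 q2 q3 q4 \<mu> \<alpha>
  proof -
    have c0: "continuous_on {0..1} q0" using adm prim_continuous unfolding admissible_def by blast
    have hol: "char_fun q0 holomorphic_on UNIV" and hol0: "char_fun0 holomorphic_on UNIV"
      by (auto intro!: char_fun_holomorphic c0)
    have zero_iff: "char_fun q0 l = 0 \<longleftrightarrow> (\<exists>n\<ge>1. l = of_real (\<alpha> n))" for l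
    proof -
      have "char_fun q0 l = 0 \<longleftrightarrow> l \<in> {l. char_fun q0 l = 0}" by simp
      also have "\<dots> \<longleftrightarrow> (\<exists>n\<ge>1. l = of_real (\<alpha> n))" unfolding zeros by auto
      finally show ?thesis .
    qed
    \<comment> \<open>All zeros are real because the real sequence \<open>\<alpha>\<close> lists
      them, and simplicity rests on that.\<close>
    have simple: "deriv (char_fun q0) z \<noteq> 0" if "char_fun q0 z = 0" for z
      using that char_fun_simple_zero[OF c0] zero_iff by metis
    have inj: "inj_on \<alpha> {1..}" using mono by (rule strict_mono_on_imp_inj_on)
    have lrk: "char_fun0 (k\<^sup>2) \<noteq> 0" "norm (char_fun q0 (k\<^sup>2) / char_fun0 (k\<^sup>2) - 1) \<le> 1 / 2" "char_fun q0 (k\<^sup>2) \<noteq> 0"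
      if "K2 \<le> norm k" "exp \<bar>Im k\<bar> / 4 \<le> norm (sin k)" for k
      using lr[OF adm mean that] by auto
    have N: "1 \<le> N" "K1 \<le> rad N" "K2 \<le> rad N" "4 * L \<le> rad N" "M \<le> rad N" if "N0 \<le> N" for N
    proof -
      have "real N0 \<le> real N" using that by simp
      then show "1 \<le> N" "K1 \<le> rad N" "K2 \<le> rad N" "4 * L \<le> rad N" "M \<le> rad N"
        using that N01 N0 A1 A2 L1 MleL rad_ge[of N] by linarith+
    qed
    have sl: "exp \<bar>Im (csqrt z)\<bar> / 4 \<le> norm (sin (csqrt z))" "K2 \<le> norm (csqrt z)"
      if "N0 \<le> N" "norm z = (rad N)\<^sup>2" for N z
    proof -
      have nk: "norm (csqrt z) = rad N" by (rule norm_csqrt_circle[OF that(2)])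
      show "exp \<bar>Im (csqrt z)\<bar> / 4 \<le> norm (sin (csqrt z))"
        by (rule norm_sin_lower_circle[OF N(1)[OF that(1)] nk[unfolded rad_def]])
      show "K2 \<le> norm (csqrt z)" unfolding nk by (rule N(3)[OF that(1)])
    qed
    have circ: "norm (char_fun q0 z / char_fun0 z - 1) < 1" if "N0 \<le> N" "norm z = (rad N)\<^sup>2" for N z
      using lrk(2)[OF sl(2)[OF that] sl(1)[OF that]] by simp
    have diffI: "((\<lambda>z. deriv h z * Ln (char_fun q0 z / char_fun0 z)) has_contour_integral
     - (2 * pi * \<i> * ((\<Sum>z | norm z < (rad N)\<^sup>2 \<and> char_fun q0 z = 0. h z) - (\<Sum>n=1..N. h (of_real ((pi * real n)\<^sup>2)))))) (circlepath 0 ((rad N)\<^sup>2))"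
      if n: "N0 \<le> N" and h: "h holomorphic_on UNIV" for N h
    proof -
      have "0 < (rad N)\<^sup>2" using rad_pos[of N] by simp
      from zero_sum_difference[OF hol hol0 h this char_fun0_nonzero_circle(3)[OF N(1)[OF n]] circ[OF n] simple char_fun0_simple]
      show ?thesis unfolding char_fun0_sum by simp
    qed
    \<comment> \<open>A value \<alpha> n <= -(rad N)^2 would be k^2 with k on the imaginary axis and
      Im k >= rad N, where the ratio is close to 1. So the disc and the half-line up to its radius
      contain the same \<alpha> n; there are N of them, and monotonicity makes their indices an
      initial segment.\<close>
    have index: "{n. 1 \<le> n \<and> \<bar>\<alpha> n\<bar> < (rad N)\<^sup>2} = {1..N}" "{n. 1 \<le> n \<and> \<alpha> n < (rad N)\<^sup>2} = {1..N}" if n: "N0 \<le> N" for N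
    proof -
      have neg: "- (rad N)\<^sup>2 < \<alpha> n" if "1 \<le> n" for n
      proof (rule ccontr)
        assume "\<not> - (rad N)\<^sup>2 < \<alpha> n"
        then have le: "(rad N)\<^sup>2 \<le> - \<alpha> n" by simp
        define k where "k = \<i> * of_real (sqrt (- \<alpha> n))"
        have "0 \<le> - \<alpha> n" using le zero_le_power2[of "rad N"] by linarith
        then have k2: "k\<^sup>2 = of_real (\<alpha> n)" by (simp add: k_def power_mult_distrib flip: of_real_power)
        have "rad N \<le> sqrt (- \<alpha> n)" using le by (rule real_le_rsqrt)
        then have r: "rad N \<le> Im k" "rad N \<le> norm k" by (auto simp: k_def norm_mult)
        have "1 \<le> rad N" using rad_ge[of N] by simp
        then have "exp \<bar>Im k\<bar> / 4 \<le> norm (sin k)" using r by (intro norm_sin_lower_Im) auto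
        moreover have "K2 \<le> norm k" using r N(3)[OF n] by linarith
        ultimately have "char_fun q0 (k\<^sup>2) \<noteq> 0" using lrk(3) by blast
        moreover have "char_fun q0 (k\<^sup>2) = 0" unfolding k2 zero_iff using that by blast
        ultimately show False by simp
      qed
      define J where "J = {n. 1 \<le> n \<and> \<alpha> n < (rad N)\<^sup>2}"
      have J: "{n. 1 \<le> n \<and> \<bar>\<alpha> n\<bar> < (rad N)\<^sup>2} = J" using neg by (auto simp: J_def abs_less_iff minus_less_iff)
      have Z: "{z. norm z < (rad N)\<^sup>2 \<and> char_fun q0 z = 0} = (\<lambda>n. complex_of_real (\<alpha> n)) ` J"
        unfolding J[symmetric] by (auto simp: zero_iff)
      have injJ: "inj_on (\<lambda>n. complex_of_real (\<alpha> n)) J"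
        using inj unfolding inj_on_def J_def by auto
      have R: "0 < (rad N)\<^sup>2" using rad_pos[of N] by simp
      have nz: "char_fun q0 z \<noteq> 0" if "norm z = (rad N)\<^sup>2" for z
        using lrk(3)[OF sl(2)[OF n that] sl(1)[OF n that]] by simp
      have "finite {z. norm z < (rad N)\<^sup>2 \<and> char_fun q0 z = 0}"
        by (rule argument_principle_circle(1)[OF hol holomorphic_on_const[of 1] R nz simple])
      then have fin: "finite J" unfolding Z using injJ finite_image_iff by blast
      \<comment> \<open>The weight 1 has derivative 0, so the contour integral vanishes and both
        functions have equally many zeros in the disc.\<close>
      have "((\<lambda>z. deriv (\<lambda>z. 1) z * Ln (char_fun q0 z / char_fun0 z)) has_contour_integral
       - (2 * pi * \<i> * ((\<Sum>z | norm z < (rad N)\<^sup>2 \<and> char_fun q0 z = 0. 1) - (\<Sum>n=1..N. 1)))) (circlepath 0 ((rad N)\<^sup>2))"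
        by (rule diffI[OF n]) simp
      then have "((\<lambda>z. 0) has_contour_integral - (2 * pi * \<i> * (of_nat (card J) - of_nat N))) (circlepath 0 ((rad N)\<^sup>2))"
        unfolding Z by (simp add: card_image[OF injJ])
      then have "of_nat (card J) - of_nat N = (0::complex)"
        using has_contour_integral_unique[OF _ has_contour_integral_0] by fastforce
      then have card: "card J = N" by simp
      have down: "m \<in> J" if "n \<in> J" "1 \<le> m" "m \<le> n" for m n
      proof (cases "m = n")
        case False
        then have "\<alpha> m < \<alpha> n" using that by (intro strict_mono_onD[OF mono]) auto
        then show ?thesis using that by (auto simp: J_def)
      qed (use that in simp)
      have "J \<subseteq> {1..N}"
      proof
        fix n assume n: "n \<in> J"
        then have "{1..n} \<subseteq> J" using down by auto
        then have "n \<le> card J" using card_mono[OF fin, of "{1..n}"] by simp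
        then show "n \<in> {1..N}" using n card by (auto simp: J_def)
      qed
      then have "J = {1..N}" using card by (intro card_subset_eq) auto
      then show "{n. 1 \<le> n \<and> \<bar>\<alpha> n\<bar> < (rad N)\<^sup>2} = {1..N}" "{n. 1 \<le> n \<and> \<alpha> n < (rad N)\<^sup>2} = {1..N}"
        using J unfolding J_def by auto
    qed
    define E where "E = coeffE q0"
    define G where "G = coeffG q0 q2"
    define B where "B = coeffB q0 q2"
    have bE: "\<bar>E\<bar> \<le> L" and bF: "\<bar>coeffF q0 q2\<bar> \<le> L" and bB: "\<bar>B\<bar> \<le> L"
      using coeff_bounds[OF M adm] by (auto simp: E_def B_def L_def)
    have partial: "\<bar>(\<Sum>n=1..N. trace_term \<mu> B \<alpha> n) + 2 * G + 2 * \<mu> * E + 2 * B\<bar> \<le> C2 / real N" if n: "N0 \<le> N" for N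
    proof -
      let ?R = "(rad N)\<^sup>2"
      have R: "0 < ?R" using rad_pos[of N] by simp
      define r where "r = rad N"
      have r: "1 \<le> r" "0 < r" "M \<le> r" "real N \<le> r" using rad_ge[of N] N[OF n] rad_pos[of N] by (auto simp: r_def)
      define h where "h z = z\<^sup>2 + 2 * complex_of_real \<mu> * z" for z
      have hh: "h holomorphic_on UNIV" unfolding h_def by (intro holomorphic_intros)
      have dh: "deriv h z = 2 * z + 2 * of_real \<mu>" for z
        unfolding h_def by (rule DERIV_imp_deriv) (auto intro!: derivative_eq_intros)
      have Z: "{z. norm z < ?R \<and> char_fun q0 z = 0} = (\<lambda>n. complex_of_real (\<alpha> n)) ` {1..N}"
        unfolding index(1)[OF n, symmetric] by (auto simp: zero_iff)
      have inj1: "inj_on (\<lambda>n. complex_of_real (\<alpha> n)) {1..N}"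
        using inj unfolding inj_on_def by auto
      define \<Delta> where "\<Delta> = (\<Sum>n=1..N. (\<alpha> n)\<^sup>2 + 2 * \<mu> * \<alpha> n - ((pi * real n)\<^sup>2)\<^sup>2 - 2 * \<mu> * (pi * real n)\<^sup>2)"
      have "(\<Sum>z | norm z < ?R \<and> char_fun q0 z = 0. h z) - (\<Sum>n=1..N. h (of_real ((pi * real n)\<^sup>2))) = of_real \<Delta>"
      proof -
        have "(\<Sum>z | norm z < ?R \<and> char_fun q0 z = 0. h z) = (\<Sum>n=1..N. h (of_real (\<alpha> n)))"
          unfolding Z by (subst sum.reindex[OF inj1]) (simp add: o_def)
        then show ?thesis by (simp add: \<Delta>_def h_def sum_subtractf sum.distrib)
      qed
      then have I1: "((\<lambda>z. (2 * z + 2 * of_real \<mu>) * Ln (char_fun q0 z / char_fun0 z)) has_contour_integral - (2 * pi * \<i> * of_real \<Delta>)) (circlepath 0 ?R)"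
        using diffI[OF n hh] unfolding dh by simp
      define \<kappa> where "\<kappa> z = cos (csqrt z) / (csqrt z * sin (csqrt z))" for z
      have I\<kappa>: "(\<kappa> has_contour_integral 2 * pi * \<i> * (2 * of_nat N + 1)) (circlepath 0 ?R)"
        unfolding \<kappa>_def by (rule cot_contour_integral[OF N(1)[OF n]])
      have Ic: "((\<lambda>z. c) has_contour_integral 0) (circlepath 0 ?R)" for c :: complex
        by (rule Cauchy_theorem_primitive[where S = UNIV and f = "\<lambda>z. c * z"]) (auto intro!: derivative_eq_intros)
      have im: "path_image (circlepath 0 ?R) = sphere 0 ?R" using R by (simp add: path_image_circlepath_nonneg)
      have Ii: "((\<lambda>z. 1 / z) has_contour_integral 2 * pi * \<i>) (circlepath 0 ?R)"
      proof -
        have "(\<lambda>z. 1 / z) contour_integrable_on circlepath 0 ?R"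
          by (rule contour_integrable_continuous_circlepath) (use R im in \<open>auto intro!: continuous_intros\<close>)
        then show ?thesis using has_contour_integral_integral contour_integral_circlepath[OF R, of 0] by fastforce
      qed
      have Ii2: "((\<lambda>z. 1 / z\<^sup>2) has_contour_integral 0) (circlepath 0 ?R)"
      proof (rule Cauchy_theorem_primitive[where S = "sphere 0 ?R" and f = "\<lambda>z. - (1 / z)"])
        fix z :: complex assume "z \<in> sphere 0 ?R"
        then have "z \<noteq> 0" using R by auto
        then show "((\<lambda>z. - (1 / z)) has_field_derivative 1 / z\<^sup>2) (at z within sphere 0 ?R)"
          by (auto intro!: derivative_eq_intros simp: power2_eq_square)
      qed (use im in auto)
      \<comment> \<open>Weight times expansion, using cos k / (sin k k^3) = \<kappa> / z. The
        product 2 \<mu> B \<kappa> / z is left out, being O(r^-3), the size of the error.\<close>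
      define m where "m z = 2 * of_real E + 2 * of_real B * \<kappa> z + (2 * of_real G + 2 * of_real \<mu> * of_real E) * (1 / z)
          + (2 * of_real \<mu> * of_real G) * (1 / z\<^sup>2)" for z :: complex
      have Im: "(m has_contour_integral 0 + 2 * of_real B * (2 * pi * \<i> * (2 * of_nat N + 1)) + (2 * of_real G + 2 * of_real \<mu> * of_real E) * (2 * pi * \<i>)
          + (2 * of_real \<mu> * of_real G) * 0) (circlepath 0 ?R)"
        unfolding m_def by (intro has_contour_integral_add has_contour_integral_lmul Ic I\<kappa> Ii Ii2)
      \<comment> \<open>All that the contour integrals evaluate. The part 4 B N is later spread over
        the N summands as the 4 b of \<open>trace_term\<close>.\<close>
      define X where "X = \<Delta> + 2 * B * (2 * real N + 1) + 2 * G + 2 * \<mu> * E"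
      have Id: "((\<lambda>z. (2 * z + 2 * of_real \<mu>) * Ln (char_fun q0 z / char_fun0 z) - m z) has_contour_integral - (2 * pi * \<i> * of_real X)) (circlepath 0 ?R)"
        using has_contour_integral_diff[OF I1 Im] by (simp add: X_def algebra_simps)
      have bd: "norm ((2 * z + 2 * of_real \<mu>) * Ln (char_fun q0 z / char_fun0 z) - m z) \<le> C2 / r ^ 3" if z: "norm (z - 0) = ?R" for z
      proof -
        define k where "k = csqrt z"
        have z': "norm z = ?R" using z by simp
        have nk: "norm k = r" using norm_csqrt_circle[OF z'] by (simp add: k_def r_def)
        have kz: "k\<^sup>2 = z" by (simp add: k_def)
        have s: "sin k \<noteq> 0" "k \<noteq> 0" using char_fun0_nonzero_circle[OF N(1)[OF n] z'] by (auto simp: k_def)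
        define y where "y = Ln (char_fun q0 z / char_fun0 z) - (of_real E / k\<^sup>2 + of_real G / k ^ 4 + of_real B * cos k / (sin k * k ^ 3))"
        have y: "norm y \<le> A2 / r ^ 5"
          using lr[OF adm mean, of k] sl[OF n z'] nk by (simp add: y_def k_def E_def G_def B_def)
        have cot: "norm (cos k) \<le> 4 * norm (sin k)" using sl(1)[OF n z'] norm_cos_le_exp[of k] by (simp add: k_def)
        have "(2 * z + 2 * of_real \<mu>) * Ln (char_fun q0 z / char_fun0 z) - m z =
           (2 * z + 2 * of_real \<mu>) * y + 2 * of_real \<mu> * of_real B * (cos k / sin k) / k ^ 3"
        proof -
          \<comment> \<open>With i = 1/k and t = cot k the identity becomes polynomial modulo k i =
            1.\<close>
          define i where "i = inverse k"
          define t where "t = cos k / sin k"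
          have ki: "k * i = 1" using s by (simp add: i_def)
          have "Ln (char_fun q0 z / char_fun0 z) = y + (of_real E * i\<^sup>2 + of_real G * i ^ 4 + of_real B * t * i ^ 3)"
            by (simp add: y_def i_def t_def power_inverse divide_inverse mult_ac)
          moreover have "m z = 2 * of_real E + 2 * of_real B * (t * i) + (2 * of_real G + 2 * of_real \<mu> * of_real E) * i\<^sup>2
              + (2 * of_real \<mu> * of_real G) * i ^ 4"
          proof -
            have "\<kappa> z = t * i" by (simp add: \<kappa>_def k_def[symmetric] i_def t_def divide_inverse mult_ac)
            moreover have "1 / z = i\<^sup>2" unfolding kz[symmetric] by (simp add: i_def power_inverse divide_inverse)
            moreover have "1 / z\<^sup>2 = i ^ 4"
              unfolding kz[symmetric] by (simp add: i_def power_inverse divide_inverse flip: power_mult)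
            ultimately show ?thesis by (simp only: m_def)
          qed
          moreover have "2 * of_real \<mu> * of_real B * (cos k / sin k) / k ^ 3 = 2 * of_real \<mu> * of_real B * t * i ^ 3"
            by (simp add: t_def i_def power_inverse divide_inverse)
          moreover have "(2 * k\<^sup>2 + 2 * u) * (y + (e * i\<^sup>2 + g * i ^ 4 + b * t * i ^ 3)) -
              (2 * e + 2 * b * (t * i) + (2 * g + 2 * u * e) * i\<^sup>2 + (2 * u * g) * i ^ 4) =
              (2 * k\<^sup>2 + 2 * u) * y + 2 * u * b * t * i ^ 3" for u e g b :: complex
            using ki by algebra
          ultimately show ?thesis unfolding kz by (simp only:)
        qed
        also have "norm \<dots> \<le> 4 * r\<^sup>2 * (A2 / r ^ 5) + 2 * L * L * 4 / r ^ 3"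
        proof (rule order_trans[OF norm_triangle_ineq add_mono])
          have "norm (2 * z + 2 * complex_of_real \<mu>) \<le> 2 * r\<^sup>2 + 2 * M"
            using \<mu> z' by (intro order_trans[OF norm_triangle_ineq] add_mono) (auto simp: norm_mult r_def)
          also have "\<dots> \<le> 4 * r\<^sup>2" using r mult_mono[of 1 r M r] M by (simp add: power2_eq_square)
          finally show "norm ((2 * z + 2 * complex_of_real \<mu>) * y) \<le> 4 * r\<^sup>2 * (A2 / r ^ 5)"
            unfolding norm_mult using y by (intro mult_mono) auto
          have "norm (cos k / sin k) \<le> 4" using cot s by (simp add: norm_divide divide_le_eq)
          then have "norm (2 * complex_of_real \<mu> * complex_of_real B * (cos k / sin k)) \<le> 2 * L * L * 4"
            unfolding norm_mult using \<mu> bB MleL L1 by (intro mult_mono) auto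
          then show "norm (2 * complex_of_real \<mu> * complex_of_real B * (cos k / sin k) / k ^ 3) \<le> 2 * L * L * 4 / r ^ 3"
            unfolding norm_divide[of _ "k ^ 3"] norm_power nk using r by (intro divide_right_mono) auto
        qed
        also have "\<dots> = C2 / r ^ 3" using r by (simp add: C2_def field_simps numeral_eq_Suc)
        finally show ?thesis .
      qed
      \<comment> \<open>An integrand of size r^-3 on a circle of length 2 \<pi> r^2 leaves
        O(1/r).\<close>
      have "norm (- (2 * pi * \<i> * complex_of_real X)) \<le> C2 / r ^ 3 * (2 * pi * ?R)"
        using bd C20 r R by (intro has_contour_integral_bound_circlepath[OF Id]) auto
      then have "2 * pi * \<bar>X\<bar> \<le> 2 * pi * (C2 / r)"
        using r by (simp add: norm_mult r_def[symmetric] field_simps numeral_eq_Suc)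
      then have X: "\<bar>X\<bar> \<le> C2 / r" by (rule mult_left_le_imp_le) simp
      also have "\<dots> \<le> C2 / real N" using r C20 N(1)[OF n] by (intro divide_left_mono) auto
      finally have "\<bar>X\<bar> \<le> C2 / real N" .
      moreover have "X = (\<Sum>n=1..N. trace_term \<mu> B \<alpha> n) + 2 * G + 2 * \<mu> * E + 2 * B"
      proof -
        have "(\<Sum>n=1..N. trace_term \<mu> B \<alpha> n) = \<Delta> + (\<Sum>n=1..N. 4 * B)"
          unfolding \<Delta>_def trace_term_def sum.distrib[symmetric] by simp
        then show ?thesis by (simp add: X_def algebra_simps)
      qed
      ultimately show ?thesis by simp
    qed
    have terms: "\<bar>trace_term \<mu> B \<alpha> n\<bar> \<le> C1 / (real n)\<^sup>2" if n: "N0 < n" for n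
    proof -
      \<comment> \<open>The n-th zero lies outside the disc with index N = n - 1 and inside the next
        one, so k is within \<pi>/2 of \<pi> n.\<close>
      obtain N where nN: "n = Suc N" "N0 \<le> N" using n by (cases n) auto
      have "n \<notin> {n. 1 \<le> n \<and> \<alpha> n < (rad N)\<^sup>2}" unfolding index(2)[OF nN(2)] using nN by simp
      then have lo: "(rad N)\<^sup>2 \<le> \<alpha> n" using nN by auto
      have "n \<in> {m. 1 \<le> m \<and> \<alpha> m < (rad n)\<^sup>2}" unfolding index(2)[of n, OF less_imp_le[OF n]] using nN by simp
      then have hi: "\<alpha> n < (rad n)\<^sup>2" by simp
      define k where "k = sqrt (\<alpha> n)"
      have \<alpha>0: "0 \<le> \<alpha> n" using lo zero_le_power2[of "rad N"] by linarith
      have k2: "k\<^sup>2 = \<alpha> n" using \<alpha>0 by (simp add: k_def)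
      have klo: "rad N \<le> k" unfolding k_def using lo by (rule real_le_rsqrt)
      have khi: "k < rad n" unfolding k_def using hi rad_pos[of n] by (intro real_less_lsqrt) auto
      define \<theta> where "\<theta> = k - pi * real n"
      have \<theta>: "\<bar>\<theta>\<bar> \<le> pi / 2"
      proof -
        have "pi * real N + pi / 2 \<le> k" using klo by (simp add: rad_def algebra_simps)
        moreover have "k < pi * real N + 3 * pi / 2" using khi by (simp add: rad_def nN algebra_simps)
        moreover have "\<theta> = k - (pi * real N + pi)" by (simp add: \<theta>_def nN algebra_simps)
        ultimately show ?thesis by linarith
      qed
      have k1: "1 \<le> k" "4 * L \<le> k" "K1 \<le> k" using klo N[OF nN(2)] rad_ge[of N] by linarith+
      have kn: "real n \<le> k" using klo rad_ge[of N] nN by simp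
      have "char_fun q0 (of_real (\<alpha> n)) = 0" unfolding zero_iff using nN by auto
      then have "char_fun q0 ((complex_of_real k)\<^sup>2) = 0" by (simp add: k2 flip: of_real_power)
      then have m: "norm (lg_main q0 q2 (complex_of_real k)) \<le> A1 / k ^ 5"
        using lg[OF adm mean, of "complex_of_real k"] k1 by simp
      define F where "F = coeffF q0 q2"
      have "lg_main q0 q2 (complex_of_real k) = of_real (sin k * (1 + E / k\<^sup>2 + F / k ^ 4) + B * cos k / k ^ 3)"
        by (simp add: lg_main_def E_def F_def B_def sin_of_real cos_of_real)
      then have m2: "\<bar>sin k * (1 + E / k\<^sup>2 + F / k ^ 4) + B * cos k / k ^ 3\<bar> \<le> A1 / k ^ 5"
        using m by (metis norm_of_real)
      have k\<theta>: "k = \<theta> + real n * pi" by (simp add: \<theta>_def mult.commute)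
      have sc: "sin k = (-1) ^ n * sin \<theta>" "cos k = (-1) ^ n * cos \<theta>"
        unfolding k\<theta> by (simp_all add: sin_add cos_add)
      have "sin k * (1 + E / k\<^sup>2 + F / k ^ 4) + B * cos k / k ^ 3 =
          (-1) ^ n * (sin \<theta> * (1 + E / k\<^sup>2 + F / k ^ 4) + B * cos \<theta> / k ^ 3)"
        unfolding sc by (simp add: algebra_simps)
      then have m3: "\<bar>sin \<theta> * (1 + E / k\<^sup>2 + F / k ^ 4) + B * cos \<theta> / k ^ 3\<bar> \<le> A1 / k ^ 5"
        using m2 by (simp add: abs_mult power_abs)
      have bF': "\<bar>F\<bar> \<le> L" using bF by (simp add: F_def)
      note tb = real_theta_bound[OF k1(1,2) L1 bE bF' bB A1(1) \<theta> m3]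
      have \<mu>L: "\<bar>\<mu>\<bar> \<le> L" using \<mu> MleL by linarith
      have "\<bar>(k\<^sup>2)\<^sup>2 + 2 * \<mu> * k\<^sup>2 - ((k - \<theta>)\<^sup>2)\<^sup>2 - 2 * \<mu> * (k - \<theta>)\<^sup>2 + 4 * B\<bar> \<le> C1 / k\<^sup>2"
        unfolding C1_def
        by (rule square_term_bound[OF k1(1) bB \<mu>L cd]) (use tb in \<open>simp_all add: c_def d_def\<close>)
      then have "\<bar>trace_term \<mu> B \<alpha> n\<bar> \<le> C1 / k\<^sup>2"
        by (simp add: trace_term_def k2 \<theta>_def)
      also have "\<dots> \<le> C1 / (real n)\<^sup>2"
        using kn n C10 k1 by (intro divide_left_mono power_mono) auto
      finally show ?thesis .
    qed
    show ?thesis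
    proof (intro conjI allI impI)
      fix N assume n: "N0 \<le> N"
      have "C2 / real N \<le> (C1 + C2) / real N" using C10 by (intro divide_right_mono) auto
      then show "\<bar>(\<Sum>n=1..N. trace_term \<mu> (coeffB q0 q2) \<alpha> n) + 2 * coeffG q0 q2 + 2 * \<mu> * coeffE q0 + 2 * coeffB q0 q2\<bar> \<le> (C1 + C2) / real N"
        using partial[OF n] unfolding B_def E_def G_def by linarith
    next
      fix n assume n: "N0 < n"
      have "C1 / (real n)\<^sup>2 \<le> (C1 + C2) / (real n)\<^sup>2" using C20 by (intro divide_right_mono) auto
      then show "\<bar>trace_term \<mu> (coeffB q0 q2) \<alpha> n\<bar> \<le> (C1 + C2) / (real n)\<^sup>2"
        using terms[OF n] unfolding B_def by linarith
    qed
  qed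
  then show ?thesis using C10 C20 N01 by (intro exI[of _ "C1 + C2"] exI[of _ N0]) auto
qed

section \<open>The trace formula\<close>

text \<open>The inequality |F x| <= |F t| + (integral of |f|) is averaged over t. This leads from
  the L1 norms in \<open>sobolev_norm\<close> to the pointwise bounds in
  \<open>admissible\<close>.\<close>

lemma prim_sup_bound:
  fixes F :: "real \<Rightarrow> real"
  assumes F: "prim F f" and x: "x \<in> {0..1}"
  shows "\<bar>F x\<bar> \<le> integral {0..1} (\<lambda>x. \<bar>F x\<bar>) + integral {0..1} (\<lambda>x. \<bar>f x\<bar>)"
proof -
  have fi: "(\<lambda>x. \<bar>f x\<bar>) integrable_on {0..1}"
    using prim_abs[OF F] unfolding absolutely_integrable_on_def by simp
  let ?I = "integral {0..1} (\<lambda>x. \<bar>f x\<bar>)"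
  have inc: "\<bar>F b - F a\<bar> \<le> ?I" if "0 \<le> a" "a \<le> b" "b \<le> 1" for a b
  proof -
    note H = prim_has_integral[OF F that]
    have i: "(\<lambda>x. \<bar>f x\<bar>) integrable_on {a..b}"
      by (rule integrable_on_subinterval[OF fi]) (use that in auto)
    have "\<bar>F b - F a\<bar> \<le> integral {a..b} (\<lambda>x. \<bar>f x\<bar>)"
      using integral_norm_bound_integral[OF has_integral_integrable[OF H] i] integral_unique[OF H] by simp
    also have "\<dots> \<le> ?I" by (rule integral_subset_le[OF _ i fi]) (use that in auto)
    finally show ?thesis .
  qed
  have c: "(\<lambda>t. \<bar>F t\<bar>) integrable_on {0..1}"
    by (intro integrable_continuous_real continuous_intros prim_continuous[OF F])
  have "integral {0..1} (\<lambda>t::real. \<bar>F x\<bar>) \<le> integral {0..1} (\<lambda>t. \<bar>F t\<bar> + ?I)"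
  proof (rule integral_le)
    show "(\<lambda>t. \<bar>F t\<bar> + ?I) integrable_on {0..1}" using c by (intro integrable_add integrable_const_ivl)
    fix t :: real assume t: "t \<in> {0..1}"
    have "\<bar>F x - F t\<bar> \<le> ?I"
    proof (cases "t \<le> x")
      case True then show ?thesis using inc[of t x] t x by auto
    next
      case False then show ?thesis using inc[of x t] t x by auto
    qed
    then show "\<bar>F x\<bar> \<le> \<bar>F t\<bar> + ?I" by linarith
  qed (rule integrable_const_ivl)
  also have "\<dots> = integral {0..1} (\<lambda>t. \<bar>F t\<bar>) + ?I"
    using integral_add[OF c integrable_const_ivl[of ?I 0 1]] by simp
  finally show ?thesis by simp
qed

text \<open>Everything in the final statement that refers to weak derivatives or continuous
  representatives is translated here into one chain \<open>f 0\<close>, ..., \<open>f 4\<close> of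
  successive derivatives, continuous up to \<open>f 3\<close>.\<close>

lemma sobolev_representative:
  fixes p :: "real \<Rightarrow> real"
  assumes "p \<in> sobolev 4"
  obtains f :: "nat \<Rightarrow> real \<Rightarrow> real" where
    "\<And>j. j < 4 \<Longrightarrow> prim (f j) (f (Suc j))" "AE x in unit_measure. p x = f 0 x"
    "integrable unit_measure p"
    "sobolev_norm 4 p = (\<Sum>j\<le>4. integral {0..1} (\<lambda>x. \<bar>f j x\<bar>))"
    "(\<integral>t. p t \<partial>unit_measure) = integral {0..1} (f 0)"
    "(\<integral>t. weak_deriv 2 p t + (p t)\<^sup>2 \<partial>unit_measure) = integral {0..1} (\<lambda>t. f 2 t + (f 0 t)\<^sup>2)"
    "\<And>x. x \<in> {0..1} \<Longrightarrow> cont_rep p x = f 0 x"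
    "\<And>x. x \<in> {0..1} \<Longrightarrow> cont_rep (weak_deriv 2 p) x = f 2 x"
proof -
  obtain g where "has_weak_deriv 4 p g" using assms by (auto simp: sobolev_def)
  then have pa: "p absolutely_integrable_on {0..1}" and "\<exists>F::nat \<Rightarrow> real \<Rightarrow> real. (AE x in unit_measure. p x = F 0 x) \<and>
           (\<forall>j<4. prim (F j) (F (Suc j))) \<and> F 4 = g"
    by (auto simp: has_weak_deriv_iff intro: has_weak_deriv_imp_chain)
  then obtain f :: "nat \<Rightarrow> real \<Rightarrow> real" where f: "AE x in unit_measure. p x = f 0 x" "\<And>j. j < 4 \<Longrightarrow> prim (f j) (f (Suc j))"
    by blast
  have fc: "continuous_on {0..1} (f j)" if "j < 4" for j using prim_continuous[OF f(2)[OF that]] .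
  have fa: "f j absolutely_integrable_on {0..1}" if "j \<le> 4" for j
  proof (cases "j < 4")
    case True then show ?thesis by (intro absolutely_integrable_continuous_real fc)
  next
    case False
    then have "j = Suc 3" using that by simp
    then show ?thesis using prim_abs[OF f(2)[of 3]] by simp
  qed
  have w: "has_weak_deriv j p (f j)" if "j \<le> 4" for j
    by (rule chain_imp_has_weak_deriv[OF f(2) pa f(1) fa[OF that]]) (use that in auto)
  have wd: "AE x in unit_measure. weak_deriv j p x = f j x" if "j \<le> 4" for j
    by (rule weak_deriv_AE_eq[OF w[OF that]])
  have wm: "weak_deriv j p \<in> borel_measurable unit_measure" if "j \<le> 4" for j
  proof -
    have "has_weak_deriv j p (weak_deriv j p)"
      unfolding weak_deriv_def using w[OF that] by (rule someI[where P = "has_weak_deriv j p"])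
    then show ?thesis by (auto simp: has_weak_deriv_def)
  qed
  have fm: "f j \<in> borel_measurable unit_measure" if "j \<le> 4" for j
    using fa[OF that] unfolding unit_integrable_iff[symmetric] by (rule borel_measurable_integrable)
  have pi: "integrable unit_measure p" using pa by (simp only: unit_integrable_iff)
  have pm: "p \<in> borel_measurable unit_measure" using pi by (rule borel_measurable_integrable)
  have norm: "sobolev_norm 4 p = (\<Sum>j\<le>4. integral {0..1} (\<lambda>x. \<bar>f j x\<bar>))"
    unfolding sobolev_norm_def
  proof (rule sum.cong[OF refl])
    fix j :: nat assume "j \<in> {..4}"
    then have j: "j \<le> 4" by simp
    have "(\<integral>x. norm (weak_deriv j p x) \<partial>unit_measure) = (\<integral>x. \<bar>f j x\<bar> \<partial>unit_measure)"
    proof (rule integral_cong_AE)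
      show "(\<lambda>x. norm (weak_deriv j p x)) \<in> borel_measurable unit_measure" using wm[OF j] by measurable
      show "(\<lambda>x. \<bar>f j x\<bar>) \<in> borel_measurable unit_measure" using fm[OF j] by measurable
      show "AE x in unit_measure. norm (weak_deriv j p x) = \<bar>f j x\<bar>" using wd[OF j] by eventually_elim simp
    qed
    also have "\<dots> = integral {0..1} (\<lambda>x. \<bar>f j x\<bar>)"
      using absolutely_integrable_norm[OF fa[OF j]] by (intro unit_integral_eq) (simp add: o_def)
    finally show "(\<integral>x. norm (weak_deriv j p x) \<partial>unit_measure) = integral {0..1} (\<lambda>x. \<bar>f j x\<bar>)" .
  qed
  have "(\<integral>t. p t \<partial>unit_measure) = (\<integral>t. f 0 t \<partial>unit_measure)"
    using f(1) pm fm[of 0] by (intro integral_cong_AE) auto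
  also have "\<dots> = integral {0..1} (f 0)" by (rule unit_integral_eq[OF fa]) simp
  finally have mean: "(\<integral>t. p t \<partial>unit_measure) = integral {0..1} (f 0)" .
  have "(\<integral>t. weak_deriv 2 p t + (p t)\<^sup>2 \<partial>unit_measure) = (\<integral>t. f 2 t + (f 0 t)\<^sup>2 \<partial>unit_measure)"
  proof (rule integral_cong_AE)
    have [measurable]: "weak_deriv 2 p \<in> borel_measurable unit_measure" "f 2 \<in> borel_measurable unit_measure"
      "f 0 \<in> borel_measurable unit_measure" using wm fm by auto
    note pm [measurable]
    show "(\<lambda>t. weak_deriv 2 p t + (p t)\<^sup>2) \<in> borel_measurable unit_measure"
      "(\<lambda>t. f 2 t + (f 0 t)\<^sup>2) \<in> borel_measurable unit_measure" by measurable
    have "AE t in unit_measure. weak_deriv 2 p t = f 2 t" by (rule wd) simp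
    then show "AE t in unit_measure. weak_deriv 2 p t + (p t)\<^sup>2 = f 2 t + (f 0 t)\<^sup>2"
      using f(1) by eventually_elim simp
  qed
  also have "\<dots> = integral {0..1} (\<lambda>t. f 2 t + (f 0 t)\<^sup>2)"
    by (intro unit_integral_eq absolutely_integrable_continuous_real continuous_intros fc) auto
  finally have P: "(\<integral>t. weak_deriv 2 p t + (p t)\<^sup>2 \<partial>unit_measure) = integral {0..1} (\<lambda>t. f 2 t + (f 0 t)\<^sup>2)" .
  show ?thesis
  proof (rule that[OF f(2) f(1) pi norm mean P])
    show "cont_rep p x = f 0 x" if "x \<in> {0..1}" for x
      by (rule cont_rep_eq[OF fc f(1) that]) simp
    show "cont_rep (weak_deriv 2 p) x = f 2 x" if "x \<in> {0..1}" for x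
      by (rule cont_rep_eq[OF fc wd that]) simp_all
  qed
qed

section \<open>Bounds uniform in the potential, and the theorem\<close>

definition p_mean :: "(real \<Rightarrow> real) \<Rightarrow> real" where
  "p_mean p = (\<integral>t. p t \<partial>unit_measure)"

definition p_quad :: "(real \<Rightarrow> real) \<Rightarrow> real" where
  "p_quad p = (\<integral>t. weak_deriv 2 p t + (p t)\<^sup>2 \<partial>unit_measure)"

definition eigen_term :: "(real \<Rightarrow> real) \<Rightarrow> (nat \<Rightarrow> real) \<Rightarrow> nat \<Rightarrow> real" where
  "eigen_term p \<alpha> n = (\<alpha> n)\<^sup>2 - ((pi * real n)\<^sup>2 - p_mean p)\<^sup>2 - (p_quad p - (p_mean p)\<^sup>2) / 2"

definition trace_value :: "(real \<Rightarrow> real) \<Rightarrow> real" where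
  "trace_value p = (p_quad p + (p_mean p)\<^sup>2) / 4 - ((cont_rep p 0)\<^sup>2 + (cont_rep p 1)\<^sup>2) / 4
     - (cont_rep (weak_deriv 2 p) 0 + cont_rep (weak_deriv 2 p) 1) / 8"

text \<open>Transfers \<open>trace_core\<close> to p, with potential q0 = c - p for the mean c of p,
  eigenvalues shifted to \<alpha> + c, and \<mu> = -c.\<close>

lemma trace_bounds:
  "\<exists>A N0. 0 \<le> A \<and> (1::nat) \<le> N0 \<and> (\<forall>p \<alpha>. p \<in> sobolev 4 \<longrightarrow> sobolev_norm 4 p \<le> K \<longrightarrow>
     strict_mono_on {1..} \<alpha> \<longrightarrow> h_eigenvalues p = (\<lambda>n. complex_of_real (\<alpha> n)) ` {1..} \<longrightarrow>
     (\<forall>N\<ge>N0. \<bar>(\<Sum>n=1..N. eigen_term p \<alpha> n) - trace_value p\<bar> \<le> A / real N) \<and>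
     (\<forall>n>N0. \<bar>eigen_term p \<alpha> n\<bar> \<le> A / (real n)\<^sup>2))"
proof -
  \<comment> \<open>The factor 2 is there because subtracting the mean can double the supremum; the
    1 secures M >= 1.\<close>
  define M where "M = 2 * \<bar>K\<bar> + 1"
  have M: "1 \<le> M" by (simp add: M_def)
  obtain A N0 where A: "0 \<le> A" "1 \<le> N0" and core:
    "\<And>q0 q1 q2 q3 q4 \<mu> \<alpha>. \<lbrakk>admissible M q0 q1 q2 q3 q4; integral {0..1} q0 = 0; \<bar>\<mu>\<bar> \<le> M; strict_mono_on {1..} \<alpha>;
       {l. char_fun q0 l = 0} = (\<lambda>n. complex_of_real (\<alpha> n)) ` {1..}\<rbrakk> \<Longrightarrow>
     (\<forall>N\<ge>N0. \<bar>(\<Sum>n=1..N. trace_term \<mu> (coeffB q0 q2) \<alpha> n) + 2 * coeffG q0 q2 + 2 * \<mu> * coeffE q0 + 2 * coeffB q0 q2\<bar> \<le> A / real N) \<and>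
     (\<forall>n>N0. \<bar>trace_term \<mu> (coeffB q0 q2) \<alpha> n\<bar> \<le> A / (real n)\<^sup>2)"
    using trace_core[OF M] by blast
  have "(\<forall>N\<ge>N0. \<bar>(\<Sum>n=1..N. eigen_term p \<alpha> n) - trace_value p\<bar> \<le> A / real N) \<and>
     (\<forall>n>N0. \<bar>eigen_term p \<alpha> n\<bar> \<le> A / (real n)\<^sup>2)"
    if p: "p \<in> sobolev 4" and K: "sobolev_norm 4 p \<le> K" and mono: "strict_mono_on {1..} \<alpha>"
      and ev: "h_eigenvalues p = (\<lambda>n. complex_of_real (\<alpha> n)) ` {1..}" for p \<alpha>
  proof -
    obtain f where f: "\<And>j. j < 4 \<Longrightarrow> prim (f j) (f (Suc j))" and pf: "AE x in unit_measure. p x = f 0 x"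
      and pint: "integrable unit_measure p"
      and norm: "sobolev_norm 4 p = (\<Sum>j\<le>4. integral {0..1} (\<lambda>x. \<bar>f j x\<bar>))"
      and mean: "(\<integral>t. p t \<partial>unit_measure) = integral {0..1} (f 0)"
      and quad: "(\<integral>t. weak_deriv 2 p t + (p t)\<^sup>2 \<partial>unit_measure) = integral {0..1} (\<lambda>t. f 2 t + (f 0 t)\<^sup>2)"
      and cr0: "\<And>x. x \<in> {0..1} \<Longrightarrow> cont_rep p x = f 0 x"
      and cr2: "\<And>x. x \<in> {0..1} \<Longrightarrow> cont_rep (weak_deriv 2 p) x = f 2 x"
      using sobolev_representative[OF p] by blast
    have P: "prim (f 0) (f 1)" "prim (f 1) (f 2)" "prim (f 2) (f 3)" "prim (f 3) (f 4)"
      using f[of 0] f[of 1] f[of 2] f[of 3] by (simp_all add: numeral_eq_Suc)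
    note c0 = prim_continuous[OF P(1)] and c2 = prim_continuous[OF P(3)]
    define I where "I j = integral {0..1} (\<lambda>x. \<bar>f j x\<bar>)" for j
    \<comment> \<open>An integral that does not exist has the value 0.\<close>
    have Ipos: "0 \<le> I j" for j
      unfolding I_def by (cases "(\<lambda>x. \<bar>f j x\<bar>) integrable_on {0..1}") (auto intro: integral_nonneg simp: not_integrable_integral)
    have "(\<Sum>j\<le>4. I j) \<le> K" using K norm by (simp add: I_def)
    then have IK: "I 0 + I 1 + I 2 + I 3 + I 4 \<le> K" by (simp add: numeral_eq_Suc atMost_Suc)
    have sup: "\<bar>f 0 x\<bar> \<le> K" "\<bar>f 1 x\<bar> \<le> K" "\<bar>f 2 x\<bar> \<le> K" "\<bar>f 3 x\<bar> \<le> K" if "x \<in> {0..1}" for x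
      using prim_sup_bound[OF P(1) that] prim_sup_bound[OF P(2) that] prim_sup_bound[OF P(3) that] prim_sup_bound[OF P(4) that]
        IK Ipos[of 0] Ipos[of 1] Ipos[of 2] Ipos[of 3] Ipos[of 4] unfolding I_def[symmetric] by linarith+
    define c where "c = integral {0..1} (f 0)"
    have fi: "f 0 integrable_on {0..1}" by (rule integrable_continuous_real[OF c0])
    have cK: "\<bar>c\<bar> \<le> K"
    proof -
      have "\<bar>c\<bar> \<le> I 0" unfolding c_def I_def
        using integral_norm_bound_integral[OF fi, of "\<lambda>x. \<bar>f 0 x\<bar>"]
        by (simp add: integrable_continuous_real continuous_intros c0)
      then show ?thesis using IK Ipos[of 1] Ipos[of 2] Ipos[of 3] Ipos[of 4] by linarith
    qed
    have K0: "0 \<le> K" using cK by linarith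
    \<comment> \<open>The potential of the operator is minus p, and its mean is -c.\<close>
    define q0 where "q0 x = - f 0 x - (- c)" for x
    define q where "q j x = - f j x" for j :: nat and x
    have Pq: "prim q0 (q 1)"
    proof -
      have "prim (\<lambda>x. - f 0 x + c) (\<lambda>x. - f 1 x + 0)"
        by (intro prim_add prim_linear[OF P(1) bounded_linear_minus[OF bounded_linear_ident]] prim_const)
      then show ?thesis by (rule prim_cong) (auto simp: q0_def q_def)
    qed
    have Pn: "prim (q 1) (q 2)" "prim (q 2) (q 3)" "prim (q 3) (q 4)"
      unfolding q_def by (intro prim_linear[OF _ bounded_linear_minus[OF bounded_linear_ident]] P)+
    have adm: "admissible M q0 (q 1) (q 2) (q 3) (q 4)"
      unfolding admissible_def
    proof (intro conjI ballI Pq Pn)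
      fix x :: real assume x: "x \<in> {0..1}"
      show "\<bar>q0 x\<bar> \<le> M" using sup(1)[OF x] cK K0 unfolding q0_def M_def by linarith
      show "\<bar>q 1 x\<bar> \<le> M" "\<bar>q 2 x\<bar> \<le> M" "\<bar>q 3 x\<bar> \<le> M"
        using sup(2-4)[OF x] K0 by (auto simp: q_def M_def)
    next
      have "integral {0..1} (\<lambda>x. \<bar>q 4 x\<bar>) = I 4" by (simp add: q_def I_def)
      then show "integral {0..1} (\<lambda>x. \<bar>q 4 x\<bar>) \<le> M"
        using IK Ipos[of 0] Ipos[of 1] Ipos[of 2] Ipos[of 3] K0 unfolding M_def by linarith
    qed
    have q0mean: "integral {0..1} q0 = 0"
    proof -
      have "(q0 has_integral - c - (- c) * (1 - 0)) {0..1}"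
        unfolding q0_def[abs_def]
        using has_integral_diff[OF has_integral_neg[OF integrable_integral[OF fi]] has_integral_const_real[of "- c" 0 1]]
        by (simp add: c_def)
      then show ?thesis by (simp add: integral_unique)
    qed
    define \<beta> where "\<beta> n = \<alpha> n + c" for n
    have \<beta>: "strict_mono_on {1..} \<beta>"
      using mono unfolding strict_mono_on_def \<beta>_def by simp
    have zeros: "{l. char_fun q0 l = 0} = (\<lambda>n. complex_of_real (\<beta> n)) ` {1..}"
    proof -
      have "char_fun q0 l = char_fun (\<lambda>x. - f 0 x) (l - of_real c)" for l
        using char_fun_shift[of "\<lambda>x. - f 0 x" "- c" "l - of_real c"] unfolding q0_def[abs_def] by simp
      then have "char_fun q0 l = 0 \<longleftrightarrow> l - of_real c \<in> h_eigenvalues p" for l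
        using eigenvalue_iff[OF pint c0 pf] by simp
      then show ?thesis unfolding ev \<beta>_def by (auto simp: image_iff algebra_simps)
    qed
    have cM: "\<bar>- c\<bar> \<le> M" using cK K0 by (simp add: M_def)
    note main = core[OF adm q0mean cM \<beta> zeros]
    have pm: "p_mean p = c" by (simp add: p_mean_def mean c_def)
    have B: "coeffB q0 (q 2) = - (p_quad p - c\<^sup>2) / 8"
    proof -
      have i2: "(\<lambda>t. f 2 t + (f 0 t)\<^sup>2) integrable_on {0..1}"
        by (intro integrable_continuous_real continuous_intros c0 c2)
      have Q: "((\<lambda>t. f 2 t + (f 0 t)\<^sup>2) has_integral p_quad p) {0..1}"
        using integrable_integral[OF i2] by (simp add: p_quad_def quad)
      have C: "((\<lambda>t. 2 * c * f 0 t) has_integral 2 * c * c) {0..1}"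
        using has_integral_mult_right[OF integrable_integral[OF fi]] by (simp add: c_def)
      have "((\<lambda>t. - (1 / 8) * ((f 2 t + (f 0 t)\<^sup>2) - 2 * c * f 0 t + c\<^sup>2)) has_integral
          - (1 / 8) * (p_quad p - 2 * c * c + c\<^sup>2 * (1 - 0))) {0..1}"
        using has_integral_mult_right[OF has_integral_add[OF has_integral_diff[OF Q C] has_integral_const_real[of "c\<^sup>2" 0 1]], of "- (1 / 8)"]
        by simp
      moreover have "- (1 / 8) * ((f 2 t + (f 0 t)\<^sup>2) - 2 * c * f 0 t + c\<^sup>2) = (q 2 t - (q0 t)\<^sup>2) / 8" for t
        by (simp add: q0_def q_def power2_eq_square algebra_simps)
      ultimately have "((\<lambda>t. (q 2 t - (q0 t)\<^sup>2) / 8) has_integral - (1 / 8) * (p_quad p - 2 * c * c + c\<^sup>2 * (1 - 0))) {0..1}"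
        by (simp only:)
      then show ?thesis
        unfolding coeffB_def by (simp only: integral_unique) (simp add: power2_eq_square field_simps)
    qed
    \<comment> \<open>With x = (\<pi> n)^2, the expressions \<beta>^2 - 2 c \<beta> and x^2 - 2 c x
      are \<alpha>^2 and (x - c)^2 up to the same c^2, which cancels; 4 B is -(P - c^2)/2.\<close>
    have term_eq: "trace_term (- c) (coeffB q0 (q 2)) \<beta> n = eigen_term p \<alpha> n" for n
      unfolding trace_term_def eigen_term_def B pm \<beta>_def by (simp add: power2_eq_square field_simps)
    have val: "2 * coeffG q0 (q 2) + 2 * (- c) * coeffE q0 + 2 * coeffB q0 (q 2) = - trace_value p"
      unfolding coeffG_def coeffF_def lgv_def coeffE_def B trace_value_def pm
      by (simp add: cr0 cr2 q0_def q_def power2_eq_square field_simps)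
    have "x + 2 * coeffG q0 (q 2) + 2 * (- c) * coeffE q0 + 2 * coeffB q0 (q 2) = x - trace_value p" for x
      using val by linarith
    then show ?thesis using main unfolding term_eq by (simp only:)
  qed
  then show ?thesis using A by blast
qed

text \<open>A common norm bound in \<open>trace_bounds\<close> gives the uniform limit at rate 1/N.
  The value of each single series is the case of a singleton set, and absolute convergence is
  comparison with 1/n^2.\<close>

theorem corollary1p2:
  fixes \<alpha> :: "(real \<Rightarrow> real) \<Rightarrow> nat \<Rightarrow> real"
  assumes "\<And>p. p \<in> sobolev 4 \<Longrightarrow> strict_mono_on {1..} (\<alpha> p)"
    and "\<And>p. p \<in> sobolev 4 \<Longrightarrow> h_eigenvalues p = (\<lambda>n. complex_of_real (\<alpha> p n)) ` {1..}"
  shows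
    "let p\<^sub>0 = (\<lambda>p. \<integral>t. p t \<partial>unit_measure);
         P = (\<lambda>p. \<integral>t. weak_deriv 2 p t + (p t)\<^sup>2 \<partial>unit_measure);
         s = (\<lambda>p n. (\<alpha> p n)\<^sup>2 - ((pi * real n)\<^sup>2 - p\<^sub>0 p)\<^sup>2 - (P p - (p\<^sub>0 p)\<^sup>2) / 2);
         S = (\<lambda>p. (P p + (p\<^sub>0 p)\<^sup>2) / 4
                  - ((cont_rep p 0)\<^sup>2 + (cont_rep p 1)\<^sup>2) / 4
                  - (cont_rep (weak_deriv 2 p) 0 + cont_rep (weak_deriv 2 p) 1) / 8)
     in (\<forall>p \<in> sobolev 4. summable (\<lambda>n. \<bar>s p (Suc n)\<bar>) \<and> (\<lambda>n. s p (Suc n)) sums S p) \<and>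
        (\<forall>B \<subseteq> sobolev 4. (\<exists>C. \<forall>p \<in> B. sobolev_norm 4 p \<le> C) \<longrightarrow>
           uniform_limit B (\<lambda>N p. \<Sum>n = 1..N. s p n) S sequentially)"
proof -
  have unif: "uniform_limit B (\<lambda>N p. \<Sum>n = 1..N. eigen_term p (\<alpha> p) n) trace_value sequentially"
    if B: "B \<subseteq> sobolev 4" "\<forall>p\<in>B. sobolev_norm 4 p \<le> K" for B K
  proof -
    obtain A N0 where A: "0 \<le> A" "1 \<le> N0" and bd: "\<And>p N. \<lbrakk>p \<in> B; N0 \<le> N\<rbrakk> \<Longrightarrow>
        \<bar>(\<Sum>n=1..N. eigen_term p (\<alpha> p) n) - trace_value p\<bar> \<le> A / real N"
      using trace_bounds[of K] assms B by (metis subsetD)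
    show ?thesis
    proof (rule uniform_limitI)
      fix e :: real assume e: "0 < e"
      obtain N1 :: nat where N1: "A / e < real N1" using reals_Archimedean2 by blast
      show "\<forall>\<^sub>F N in sequentially. \<forall>p\<in>B. dist (\<Sum>n = 1..N. eigen_term p (\<alpha> p) n) (trace_value p) < e"
        unfolding eventually_sequentially
      proof (intro exI[of _ "max N0 N1"] allI impI ballI)
        fix N p assume N: "max N0 N1 \<le> N" and p: "p \<in> B"
        have "A / e < real N" using N1 N by linarith
        moreover have "0 < real N" using N A(2) by linarith
        ultimately have "A / real N < e" using e by (simp add: field_simps)
        then show "dist (\<Sum>n = 1..N. eigen_term p (\<alpha> p) n) (trace_value p) < e"
          using bd[OF p, of N] N by (simp add: dist_real_def)
      qed
    qed
  qed
  have pointwise: "summable (\<lambda>n. \<bar>eigen_term p (\<alpha> p) (Suc n)\<bar>)" "(\<lambda>n. eigen_term p (\<alpha> p) (Suc n)) sums trace_value p"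
    if p: "p \<in> sobolev 4" for p
  proof -
    obtain A N0 where A: "\<And>n. N0 < n \<Longrightarrow> \<bar>eigen_term p (\<alpha> p) n\<bar> \<le> A / (real n)\<^sup>2"
      using trace_bounds[of "sobolev_norm 4 p"] assms[OF p] p by blast
    have "summable (\<lambda>n. A * inverse (real n ^ 2))"
      by (intro summable_mult inverse_power_summable) simp
    then have "summable (\<lambda>n. \<bar>eigen_term p (\<alpha> p) n\<bar>)"
      by (rule summable_comparison_test[rotated]) (use A in \<open>auto simp: divide_inverse intro!: exI[of _ "Suc N0"]\<close>)
    then show "summable (\<lambda>n. \<bar>eigen_term p (\<alpha> p) (Suc n)\<bar>)" by (rule summable_ignore_initial_segment[where k = 1, simplified])
    have "(\<lambda>N. \<Sum>n = 1..N. eigen_term p (\<alpha> p) n) \<longlonglongrightarrow> trace_value p"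
      using tendsto_uniform_limitI[OF unif[of "{p}" "sobolev_norm 4 p"]] p by simp
    moreover have "(\<Sum>n = 1..N. eigen_term p (\<alpha> p) n) = (\<Sum>n<N. eigen_term p (\<alpha> p) (Suc n))" for N
      by (simp add: sum.atLeast1_atMost_eq)
    ultimately show "(\<lambda>n. eigen_term p (\<alpha> p) (Suc n)) sums trace_value p" by (simp add: sums_def)
  qed
  note defs = eigen_term_def trace_value_def[abs_def] p_mean_def p_quad_def
  show ?thesis
    unfolding Let_def
  proof (intro conjI ballI allI impI)
    fix B :: "(real \<Rightarrow> real) set" assume B: "B \<subseteq> sobolev 4" "\<exists>C. \<forall>p\<in>B. sobolev_norm 4 p \<le> C"
    then obtain C where "\<forall>p\<in>B. sobolev_norm 4 p \<le> C" by blast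
    then show "uniform_limit B
     (\<lambda>N p. \<Sum>n = 1..N. (\<alpha> p n)\<^sup>2 - ((pi * real n)\<^sup>2 - (\<integral>t. p t \<partial>unit_measure))\<^sup>2 -
           ((\<integral>t. weak_deriv 2 p t + (p t)\<^sup>2 \<partial>unit_measure) - (\<integral>t. p t \<partial>unit_measure)\<^sup>2) / 2)
     (\<lambda>p. ((\<integral>t. weak_deriv 2 p t + (p t)\<^sup>2 \<partial>unit_measure) + (\<integral>t. p t \<partial>unit_measure)\<^sup>2) / 4 -
           ((cont_rep p 0)\<^sup>2 + (cont_rep p 1)\<^sup>2) / 4 - (cont_rep (weak_deriv 2 p) 0 + cont_rep (weak_deriv 2 p) 1) / 8)
     sequentially"
      using unif[OF B(1)] unfolding defs by blast
  qed (use pointwise in \<open>simp_all only: defs\<close>)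
qed

end
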